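(* Let $\mathcal M=(M,\mathcal L,\mathcal F)$ be a conservative conic pseudo-Finslerian mechanical system with potential function $\phi:M\to\mathbb R$, where $\mathcal L=\tfrac12L$ and $L:\mathcal U\to\mathbb R$ is a conic pseudo-Finslerian metric on $M$, and let $\tilde{\mathcal L}=\mathcal L-\phi\circ\pi:\mathcal U\to\mathbb R$. Then the $\mathcal M$-motions coincide with the $\tilde{\mathcal L}$-geodesics. Furthermore, $\mathcal E^{\tilde{\mathcal L}}=\mathcal L+\phi\circ\pi$.
   Context: Let $M$ be a smooth manifold, $\pi:TM\to M$ the projection, and $\mathcal U\subset TM\setminus 0$ an open set invariant under positive scalar multiplication. A conic pseudo-Finslerian metric is a smooth function $L:\mathcal U\to\mathbb R$ with $L(\lambda v)=\lambda^2L(v)$ for $\lambda>0$ whose fundamental tensor $g_v(u,w)=\tfrac12\frac{\partial^2}{\partial t\partial s}\big|_{t=s=0}L(v+tu+sw)$, $u,w\in T_{\pi(v)}M$, is nondegenerate for every $v\in\mathcal U$. An anisotropic vector field is a smooth map $X:\mathcal U\to TM$ with $X(v)\in T_{\pi(v)}M$. The anisotropic gradient of a smooth $f:M\to\mathbb R$ is the anisotropic vector field $v\mapsto\nabla^vf$ defined by $g_v(\nabla^vf,w)=df_{\pi(v)}(w)$ for all $w\in T_{\pi(v)}M$. An anisotropic linear connection is a map $(v,X,Y)\in\mathcal U\times\mathfrak X(M)\times\mathfrak X(M)\mapsto\nabla^v_XY\in T_{\pi(v)}M$, with $v\mapsto \nabla^v_XY$ an anisotropic vector field, such that for each local vector field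 $V$ with values in $\mathcal U$, $\nabla^V$ is a linear connection on the domain of $V$. The Chern connection of $L$ is the unique anisotropic linear connection that is torsion-free ($\nabla^v_XY-\nabla^v_YX=[X,Y]$) and metric-compatible: $Xg_V(Y,Z)=g_V(\nabla^V_XY,Z)+g_V(Y,\nabla^V_XZ)+2C_V(Y,Z,\nabla^V_XV)$, where $C_v(u_1,u_2,u_3)=\tfrac12\frac{d}{dt}\big|_{t=0}g_{v+tu_1}(u_2,u_3)$. In coordinates put $\nabla^v_{\partial_i}\partial_j=\sum_k\Gamma^k_{ij}(v)\partial_k$. For a smooth curve $\gamma$ with $\gamma'\in\mathcal U$ ($\mathcal U$-admissible) and a vector field $X=\sum_kx_k\,\partial_k\circ\gamma$ along $\gamma$, $D^{\gamma'}_\gamma X=\sum_k\{x_k'+\sum_{ij}\Gamma^k_{ij}(\gamma')\gamma_i'x_j\}\partial_k$. An $\mathcal M$-motion of a mechanical system $(M,\tfrac12L,\mathcal F)$ ($\mathcal F:\mathcal U\to TM$ an anisotropic vector field) is a $\mathcal U$-admissible smooth curve with $D^{\gamma'}_\gamma\gamma'=\mathcal F(\gamma')$. The system is conservative with potential $\phi$ (smooth) if $\mathcal F(v)=-\nabla^v\phi$ for all $v\in\mathcal U$. For a smooth Lagrangian $\mathcal K:\mathcal U\to\mathbb R$, a $\mathcal K$-geodesic is a $\mathcal U$-admissible smooth curve that is a critical point of the action $\int\mathcal K(\gamma'(t))\,dt$ with respect to variations with fixed endpoints (on compact subintervals). The energy of $\mathcal K$ is $\mathcal E^{\mathcal K}(v)=\frac{d}{dt}\big|_{t=0}\mathcal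 K(v+tv)-\mathcal K(v)$. *)

theory Defs
  imports "HOL-Analysis.Analysis"
begin

section \<open>Smoothness in Euclidean spaces\<close>

text \<open>Derivatives are taken within the domain, so that the same notion serves open sets
  (where it is the usual one) and, with one-sided derivatives at the boundary, intervals and
  boxes with nonempty interior and relatively open subsets of these. It is used for such
  domains only; on them the derivative is unique.\<close>

primrec Ck_on ::
  "nat \<Rightarrow> 'a::real_normed_vector set \<Rightarrow> ('a \<Rightarrow> 'b::real_normed_vector) \<Rightarrow> bool" where
  "Ck_on 0 S f \<longleftrightarrow> continuous_on S f"
| "Ck_on (Suc k) S f \<longleftrightarrow>
     (\<forall>x\<in>S. f differentiable (at x within S)) \<and>
     (\<forall>e. Ck_on k S (\<lambda>x. frechet_derivative f (at x within S) e))"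

definition smooth_on :: "'a::real_normed_vector set \<Rightarrow> ('a \<Rightarrow> 'b::real_normed_vector) \<Rightarrow> bool" where
  "smooth_on S f \<longleftrightarrow> (\<forall>k. Ck_on k S f)"


section \<open>Smooth manifolds\<close>

text \<open>A chart is a pair of its domain and its coordinate map; the values of the latter outside
  the domain are irrelevant.\<close>

type_synonym ('a, 'e) chart = "'a set \<times> ('a \<Rightarrow> 'e)"

definition transition :: "('a, 'e) chart \<Rightarrow> ('a, 'e) chart \<Rightarrow> 'e \<Rightarrow> 'e" where
  "transition c d = snd d \<circ> inv_into (fst c) (snd c)"

definition smooth_manifold ::
  "'a topology \<Rightarrow> ('a, 'e::euclidean_space) chart set \<Rightarrow> bool" where
  "smooth_manifold T A \<longleftrightarrow>
     Hausdorff_space T \<and> second_countable T \<and> (\<Union>c\<in>A. fst c) = topspace T \<and>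
     (\<forall>c\<in>A. openin T (fst c) \<and> open (snd c ` fst c) \<and>
        homeomorphic_map (subtopology T (fst c)) (top_of_set (snd c ` fst c)) (snd c)) \<and>
     (\<forall>c\<in>A. \<forall>d\<in>A. smooth_on (snd c ` (fst c \<inter> fst d)) (transition c d))"

definition points :: "('a, 'e) chart set \<Rightarrow> 'a set" where
  "points A = (\<Union>c\<in>A. fst c)"

text \<open>Openness read off in charts. For a manifold this is openness in its topology; on the
  tangent bundle, with the atlas defined below, it defines the topology.\<close>

definition atlas_open :: "('a, 'e::topological_space) chart set \<Rightarrow> 'a set \<Rightarrow> bool" where
  "atlas_open A W \<longleftrightarrow> W \<subseteq> points A \<and> (\<forall>c\<in>A. open (snd c ` (W \<inter> fst c)))"

definition smooth_fun ::
  "('a, 'e::real_normed_vector) chart set \<Rightarrow> 'a set \<Rightarrow> ('a \<Rightarrow> real) \<Rightarrow> bool" where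
  "smooth_fun A W f \<longleftrightarrow>
     (\<forall>c\<in>A. smooth_on (snd c ` (W \<inter> fst c)) (f \<circ> inv_into (fst c) (snd c)))"

text \<open>Requiring the images of the sets \<open>D\<close> to be open amounts to continuity of \<open>F\<close>.\<close>

definition smooth_map ::
  "('a, 'e::real_normed_vector) chart set \<Rightarrow> 'a set \<Rightarrow>
   ('b, 'f::real_normed_vector) chart set \<Rightarrow> ('a \<Rightarrow> 'b) \<Rightarrow> bool" where
  "smooth_map A W B F \<longleftrightarrow> F ` W \<subseteq> points B \<and>
     (\<forall>c\<in>A. \<forall>d\<in>B. let D = W \<inter> fst c \<inter> F -` fst d in
        open (snd c ` D) \<and> smooth_on (snd c ` D) (snd d \<circ> F \<circ> inv_into (fst c) (snd c)))"

text \<open>Smoothness of a map from a subset of a Euclidean space that need not be open, such as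
  an arbitrary interval.\<close>

definition smooth_into ::
  "('a, 'e::real_normed_vector) chart set \<Rightarrow> 'p::real_normed_vector set \<Rightarrow> ('p \<Rightarrow> 'a) \<Rightarrow> bool" where
  "smooth_into A S F \<longleftrightarrow> F ` S \<subseteq> points A \<and>
     (\<forall>c\<in>A. let D = S \<inter> F -` fst c in
        openin (top_of_set S) D \<and> smooth_on D (snd c \<circ> F))"


section \<open>The tangent bundle\<close>

text \<open>A tangent vector is its base point together with the family of its coordinate vectors in
  all charts around that point, related by the derivatives of the transition maps. The family
  is \<open>0\<close> at the charts not containing the base point, which makes equality of tangent vectors
  equality of pairs.\<close>

type_synonym ('a, 'e) tangent = "'a \<times> (('a, 'e) chart \<Rightarrow> 'e)"

definition tangent_space ::
  "('a, 'e::real_normed_vector) chart set \<Rightarrow> 'a \<Rightarrow> ('a, 'e) tangent set" where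
  "tangent_space A p = {v. fst v = p \<and>
     (\<forall>c. \<not> (c \<in> A \<and> p \<in> fst c) \<longrightarrow> snd v c = 0) \<and>
     (\<forall>c\<in>A. \<forall>d\<in>A. p \<in> fst c \<and> p \<in> fst d \<longrightarrow>
        snd v d = frechet_derivative (transition c d) (at (snd c p)) (snd v c))}"

definition tangent_chart ::
  "('a, 'e::real_normed_vector) chart set \<Rightarrow> ('a, 'e) chart \<Rightarrow>
   (('a, 'e) tangent, 'e \<times> 'e) chart" where
  "tangent_chart A c = (\<Union>p\<in>fst c. tangent_space A p, \<lambda>v. (snd c (fst v), snd v c))"

definition tangent_atlas ::
  "('a, 'e::real_normed_vector) chart set \<Rightarrow> (('a, 'e) tangent, 'e \<times> 'e) chart set" where
  "tangent_atlas A = tangent_chart A ` A"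

definition tzero :: "'a \<Rightarrow> ('a, 'e::real_normed_vector) tangent" where
  "tzero p = (p, \<lambda>c. 0)"

definition tadd :: "('a, 'e::real_normed_vector) tangent \<Rightarrow> ('a, 'e) tangent \<Rightarrow> ('a, 'e) tangent"
    (infixl "+\<^sub>T" 65) where
  "v +\<^sub>T w = (fst v, \<lambda>c. snd v c + snd w c)"

definition tscale :: "real \<Rightarrow> ('a, 'e::real_normed_vector) tangent \<Rightarrow> ('a, 'e) tangent"
    (infixr "*\<^sub>T" 75) where
  "r *\<^sub>T v = (fst v, \<lambda>c. r *\<^sub>R snd v c)"

text \<open>The value \<open>df(w)\<close> does not depend on the chart used to compute it.\<close>

definition differential ::
  "('a, 'e::real_normed_vector) chart set \<Rightarrow> ('a \<Rightarrow> real) \<Rightarrow> ('a, 'e) tangent \<Rightarrow> real" where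
  "differential A f w = (let c = (SOME c. c \<in> A \<and> fst w \<in> fst c) in
     frechet_derivative (f \<circ> inv_into (fst c) (snd c)) (at (snd c (fst w))) (snd w c))"

definition vector_fields ::
  "('a, 'e::real_normed_vector) chart set \<Rightarrow> 'a set \<Rightarrow> ('a \<Rightarrow> ('a, 'e) tangent) set" where
  "vector_fields A W =
     {X. smooth_map A W (tangent_atlas A) X \<and> (\<forall>p\<in>W. X p \<in> tangent_space A p)}"

definition coord_field ::
  "('a, 'e::real_normed_vector) chart set \<Rightarrow> ('a, 'e) chart \<Rightarrow> 'e \<Rightarrow> 'a \<Rightarrow> ('a, 'e) tangent" where
  "coord_field A c e p = (p, \<lambda>d. if d \<in> A \<and> p \<in> fst d
     then frechet_derivative (transition c d) (at (snd c p)) e else 0)"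

text \<open>The component of a field in the chart \<open>c\<close>, as a function of the coordinates.\<close>

definition field_rep ::
  "('a, 'e::real_normed_vector) chart \<Rightarrow> ('a \<Rightarrow> ('a, 'e) tangent) \<Rightarrow> 'e \<Rightarrow> 'e" where
  "field_rep c X x = snd (X (inv_into (fst c) (snd c) x)) c"

definition lie_bracket ::
  "('a, 'e::real_normed_vector) chart set \<Rightarrow>
   ('a \<Rightarrow> ('a, 'e) tangent) \<Rightarrow> ('a \<Rightarrow> ('a, 'e) tangent) \<Rightarrow> 'a \<Rightarrow> ('a, 'e) tangent" where
  "lie_bracket A X Y p = (p, \<lambda>c. if c \<in> A \<and> p \<in> fst c
     then frechet_derivative (field_rep c Y) (at (snd c p)) (snd (X p) c)
        - frechet_derivative (field_rep c X) (at (snd c p)) (snd (Y p) c) else 0)"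


section \<open>Conic pseudo-Finslerian metrics\<close>

definition conic_domain ::
  "('a, 'e::real_normed_vector) chart set \<Rightarrow> ('a, 'e) tangent set \<Rightarrow> bool" where
  "conic_domain A U \<longleftrightarrow> atlas_open (tangent_atlas A) U \<and> (\<forall>v\<in>U. v \<noteq> tzero (fst v)) \<and>
     (\<forall>v\<in>U. \<forall>r>0. r *\<^sub>T v \<in> U)"

definition fundamental_tensor ::
  "(('a, 'e::real_normed_vector) tangent \<Rightarrow> real) \<Rightarrow>
   ('a, 'e) tangent \<Rightarrow> ('a, 'e) tangent \<Rightarrow> ('a, 'e) tangent \<Rightarrow> real" where
  "fundamental_tensor L v u w =
     1/2 * deriv (\<lambda>t. deriv (\<lambda>s. L (v +\<^sub>T t *\<^sub>T u +\<^sub>T s *\<^sub>T w)) 0) 0"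

definition cartan_tensor ::
  "(('a, 'e::real_normed_vector) tangent \<Rightarrow> real) \<Rightarrow>
   ('a, 'e) tangent \<Rightarrow> ('a, 'e) tangent \<Rightarrow> ('a, 'e) tangent \<Rightarrow> ('a, 'e) tangent \<Rightarrow> real" where
  "cartan_tensor L v u1 u2 u3 =
     1/2 * deriv (\<lambda>t. fundamental_tensor L (v +\<^sub>T t *\<^sub>T u1) u2 u3) 0"

definition conic_pseudo_finsler ::
  "('a, 'e::real_normed_vector) chart set \<Rightarrow> ('a, 'e) tangent set \<Rightarrow>
   (('a, 'e) tangent \<Rightarrow> real) \<Rightarrow> bool" where
  "conic_pseudo_finsler A U L \<longleftrightarrow> conic_domain A U \<and>
     smooth_fun (tangent_atlas A) U L \<and>
     (\<forall>v\<in>U. \<forall>r>0. L (r *\<^sub>T v) = r^2 * L v) \<and>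
     (\<forall>v\<in>U. \<forall>u\<in>tangent_space A (fst v).
        (\<forall>w\<in>tangent_space A (fst v). fundamental_tensor L v u w = 0) \<longrightarrow> u = tzero (fst v))"

definition anisotropic_field ::
  "('a, 'e::real_normed_vector) chart set \<Rightarrow> ('a, 'e) tangent set \<Rightarrow>
   (('a, 'e) tangent \<Rightarrow> ('a, 'e) tangent) \<Rightarrow> bool" where
  "anisotropic_field A U F \<longleftrightarrow> smooth_map (tangent_atlas A) U (tangent_atlas A) F \<and>
     (\<forall>v\<in>U. F v \<in> tangent_space A (fst v))"

definition anisotropic_gradient ::
  "('a, 'e::real_normed_vector) chart set \<Rightarrow> (('a, 'e) tangent \<Rightarrow> real) \<Rightarrow> ('a \<Rightarrow> real) \<Rightarrow>
   ('a, 'e) tangent \<Rightarrow> ('a, 'e) tangent" where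
  "anisotropic_gradient A L f v = (THE u. u \<in> tangent_space A (fst v) \<and>
     (\<forall>w\<in>tangent_space A (fst v). fundamental_tensor L v u w = differential A f w))"


section \<open>Anisotropic linear connections and the Chern connection\<close>

definition linear_connection ::
  "('a, 'e::real_normed_vector) chart set \<Rightarrow> 'a set \<Rightarrow>
   (('a \<Rightarrow> ('a, 'e) tangent) \<Rightarrow> ('a \<Rightarrow> ('a, 'e) tangent) \<Rightarrow> 'a \<Rightarrow> ('a, 'e) tangent) \<Rightarrow> bool" where
  "linear_connection A W D \<longleftrightarrow>
     (\<forall>X\<in>vector_fields A W. \<forall>Y\<in>vector_fields A W. D X Y \<in> vector_fields A W) \<and>
     (\<forall>X\<in>vector_fields A W. \<forall>Y\<in>vector_fields A W. \<forall>Z\<in>vector_fields A W. \<forall>p\<in>W.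
        D (\<lambda>q. X q +\<^sub>T Z q) Y p = D X Y p +\<^sub>T D Z Y p \<and>
        D X (\<lambda>q. Y q +\<^sub>T Z q) p = D X Y p +\<^sub>T D X Z p) \<and>
     (\<forall>X\<in>vector_fields A W. \<forall>Y\<in>vector_fields A W. \<forall>f. smooth_fun A W f \<longrightarrow> (\<forall>p\<in>W.
        D (\<lambda>q. f q *\<^sub>T X q) Y p = f p *\<^sub>T D X Y p \<and>
        D X (\<lambda>q. f q *\<^sub>T Y q) p = differential A f (X p) *\<^sub>T Y p +\<^sub>T f p *\<^sub>T D X Y p))"

text \<open>An anisotropic connection \<open>nab v X Y\<close> is taken to act on vector fields that are defined
  on an open set around the base point of \<open>v\<close>, so that it can be applied to coordinate fields.
  As usual, it is local: replacing \<open>X\<close> and \<open>Y\<close> by fields that agree with them near the base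
  point does not change the value (multiply by functions that are \<open>1\<close> on a smaller open set
  and arbitrary outside).\<close>

type_synonym ('a, 'e) connection =
  "('a, 'e) tangent \<Rightarrow> ('a \<Rightarrow> ('a, 'e) tangent) \<Rightarrow> ('a \<Rightarrow> ('a, 'e) tangent) \<Rightarrow> ('a, 'e) tangent"

definition anisotropic_connection ::
  "('a, 'e::real_normed_vector) chart set \<Rightarrow> ('a, 'e) tangent set \<Rightarrow> ('a, 'e) connection \<Rightarrow> bool" where
  "anisotropic_connection A U nab \<longleftrightarrow>
     (\<forall>W. atlas_open A W \<longrightarrow>
        (\<forall>X\<in>vector_fields A W. \<forall>Y\<in>vector_fields A W.
           anisotropic_field A {v\<in>U. fst v \<in> W} (\<lambda>v. nab v X Y)) \<and>
        (\<forall>V\<in>vector_fields A W. V ` W \<subseteq> U \<longrightarrow>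
           linear_connection A W (\<lambda>X Y p. nab (V p) X Y)))"

definition torsion_free ::
  "('a, 'e::real_normed_vector) chart set \<Rightarrow> ('a, 'e) tangent set \<Rightarrow> ('a, 'e) connection \<Rightarrow> bool" where
  "torsion_free A U nab \<longleftrightarrow>
     (\<forall>W. atlas_open A W \<longrightarrow>
        (\<forall>X\<in>vector_fields A W. \<forall>Y\<in>vector_fields A W. \<forall>v\<in>U. fst v \<in> W \<longrightarrow>
           nab v X Y +\<^sub>T (-1) *\<^sub>T nab v Y X = lie_bracket A X Y (fst v)))"

definition metric_compatible ::
  "('a, 'e::real_normed_vector) chart set \<Rightarrow> ('a, 'e) tangent set \<Rightarrow> (('a, 'e) tangent \<Rightarrow> real) \<Rightarrow>
   ('a, 'e) connection \<Rightarrow> bool" where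
  "metric_compatible A U L nab \<longleftrightarrow>
     (\<forall>W. atlas_open A W \<longrightarrow>
        (\<forall>V\<in>vector_fields A W. V ` W \<subseteq> U \<longrightarrow>
          (\<forall>X\<in>vector_fields A W. \<forall>Y\<in>vector_fields A W. \<forall>Z\<in>vector_fields A W. \<forall>p\<in>W.
             differential A (\<lambda>q. fundamental_tensor L (V q) (Y q) (Z q)) (X p) =
               fundamental_tensor L (V p) (nab (V p) X Y) (Z p)
             + fundamental_tensor L (V p) (Y p) (nab (V p) X Z)
             + 2 * cartan_tensor L (V p) (Y p) (Z p) (nab (V p) X V))))"

definition chern_connection ::
  "('a, 'e::real_normed_vector) chart set \<Rightarrow> ('a, 'e) tangent set \<Rightarrow> (('a, 'e) tangent \<Rightarrow> real) \<Rightarrow>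
   ('a, 'e) connection \<Rightarrow> bool" where
  "chern_connection A U L nab \<longleftrightarrow>
     anisotropic_connection A U nab \<and> torsion_free A U nab \<and> metric_compatible A U L nab"

text \<open>The coefficient \<open>\<Gamma>\<^sup>k\<^sub>i\<^sub>j(v)\<close> in the chart \<open>c\<close>, with elements of the standard basis of the
  model space as indices.\<close>

definition christoffel ::
  "('a, 'e::euclidean_space) chart set \<Rightarrow> ('a, 'e) connection \<Rightarrow> ('a, 'e) chart \<Rightarrow>
   ('a, 'e) tangent \<Rightarrow> 'e \<Rightarrow> 'e \<Rightarrow> 'e \<Rightarrow> real" where
  "christoffel A nab c v k i j = snd (nab v (coord_field A c i) (coord_field A c j)) c \<bullet> k"


section \<open>Curves, motions and geodesics\<close>

definition velocity ::
  "('a, 'e::real_normed_vector) chart set \<Rightarrow> real set \<Rightarrow> (real \<Rightarrow> 'a) \<Rightarrow> real \<Rightarrow> ('a, 'e) tangent" where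
  "velocity A I \<gamma> t = (\<gamma> t, \<lambda>c. if c \<in> A \<and> \<gamma> t \<in> fst c
     then vector_derivative (snd c \<circ> \<gamma>) (at t within I) else 0)"

text \<open>The parameter interval may be open, closed or half-open, bounded or unbounded.\<close>

definition admissible_curve ::
  "('a, 'e::real_normed_vector) chart set \<Rightarrow> ('a, 'e) tangent set \<Rightarrow> real set \<Rightarrow>
   (real \<Rightarrow> 'a) \<Rightarrow> bool" where
  "admissible_curve A U I \<gamma> \<longleftrightarrow> is_interval I \<and> interior I \<noteq> {} \<and> smooth_into A I \<gamma> \<and>
     (\<forall>t\<in>I. velocity A I \<gamma> t \<in> U)"

text \<open>The covariant derivative \<open>D\<^sup>\<gamma>\<^sup>'X\<close> of a vector field \<open>X\<close> along \<open>\<gamma>\<close>,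
  given by its coordinates in every chart around the point of the curve.\<close>

definition cov_deriv ::
  "('a, 'e::euclidean_space) chart set \<Rightarrow> ('a, 'e) connection \<Rightarrow> real set \<Rightarrow> (real \<Rightarrow> 'a) \<Rightarrow>
   (real \<Rightarrow> ('a, 'e) tangent) \<Rightarrow> real \<Rightarrow> ('a, 'e) tangent" where
  "cov_deriv A nab I \<gamma> X t = (\<gamma> t, \<lambda>c. if c \<in> A \<and> \<gamma> t \<in> fst c
     then \<Sum>k\<in>Basis. (vector_derivative (\<lambda>s. snd (X s) c \<bullet> k) (at t within I)
            + (\<Sum>i\<in>Basis. \<Sum>j\<in>Basis. christoffel A nab c (velocity A I \<gamma> t) k i j
                 * vector_derivative (\<lambda>s. snd c (\<gamma> s) \<bullet> i) (at t within I)
                 * (snd (X t) c \<bullet> j))) *\<^sub>R k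
     else 0)"

definition motion ::
  "('a, 'e::euclidean_space) chart set \<Rightarrow> ('a, 'e) tangent set \<Rightarrow> ('a, 'e) connection \<Rightarrow>
   (('a, 'e) tangent \<Rightarrow> ('a, 'e) tangent) \<Rightarrow> real set \<Rightarrow> (real \<Rightarrow> 'a) \<Rightarrow> bool" where
  "motion A U nab F I \<gamma> \<longleftrightarrow> admissible_curve A U I \<gamma> \<and>
     (\<forall>t\<in>I. cov_deriv A nab I \<gamma> (velocity A I \<gamma>) t = F (velocity A I \<gamma> t))"

definition action ::
  "('a, 'e::real_normed_vector) chart set \<Rightarrow> (('a, 'e) tangent \<Rightarrow> real) \<Rightarrow> real \<Rightarrow> real \<Rightarrow>
   (real \<Rightarrow> 'a) \<Rightarrow> real" where
  "action A K a b \<gamma> = integral {a..b} (\<lambda>t. K (velocity A {a..b} \<gamma> t))"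

text \<open>Smooth variations by admissible curves with fixed endpoints, with \<open>\<Gamma> (s, t)\<close> the point
  at time \<open>t\<close> of the curve with variation parameter \<open>s\<close>.\<close>

definition fixed_endpoint_variation ::
  "('a, 'e::real_normed_vector) chart set \<Rightarrow> ('a, 'e) tangent set \<Rightarrow> real \<Rightarrow> real \<Rightarrow>
   (real \<Rightarrow> 'a) \<Rightarrow> real \<Rightarrow> (real \<times> real \<Rightarrow> 'a) \<Rightarrow> bool" where
  "fixed_endpoint_variation A U a b \<gamma> \<epsilon> \<Gamma> \<longleftrightarrow> \<epsilon> > 0 \<and>
     smooth_into A ({-\<epsilon><..<\<epsilon>} \<times> {a..b}) \<Gamma> \<and>
     (\<forall>t\<in>{a..b}. \<Gamma> (0, t) = \<gamma> t) \<and>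
     (\<forall>s\<in>{-\<epsilon><..<\<epsilon>}. \<Gamma> (s, a) = \<gamma> a \<and> \<Gamma> (s, b) = \<gamma> b \<and>
        admissible_curve A U {a..b} (\<lambda>t. \<Gamma> (s, t)))"

definition lagrangian_geodesic ::
  "('a, 'e::real_normed_vector) chart set \<Rightarrow> ('a, 'e) tangent set \<Rightarrow>
   (('a, 'e) tangent \<Rightarrow> real) \<Rightarrow> real set \<Rightarrow> (real \<Rightarrow> 'a) \<Rightarrow> bool" where
  "lagrangian_geodesic A U K I \<gamma> \<longleftrightarrow> admissible_curve A U I \<gamma> \<and>
     (\<forall>a b \<epsilon> \<Gamma>. a < b \<and> {a..b} \<subseteq> I \<and> fixed_endpoint_variation A U a b \<gamma> \<epsilon> \<Gamma> \<longrightarrow>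
        ((\<lambda>s. action A K a b (\<lambda>t. \<Gamma> (s, t))) has_real_derivative 0) (at 0))"

definition energy ::
  "(('a, 'e::real_normed_vector) tangent \<Rightarrow> real) \<Rightarrow> ('a, 'e) tangent \<Rightarrow> real" where
  "energy K v = deriv (\<lambda>t. K (v +\<^sub>T t *\<^sub>T v)) 0 - K v"


section \<open>Mechanical systems\<close>

definition mechanical_system ::
  "('a, 'e::real_normed_vector) chart set \<Rightarrow> ('a, 'e) tangent set \<Rightarrow> (('a, 'e) tangent \<Rightarrow> real) \<Rightarrow>
   (('a, 'e) tangent \<Rightarrow> ('a, 'e) tangent) \<Rightarrow> bool" where
  "mechanical_system A U L F \<longleftrightarrow> conic_pseudo_finsler A U L \<and> anisotropic_field A U F"

definition conservative ::
  "('a, 'e::real_normed_vector) chart set \<Rightarrow> ('a, 'e) tangent set \<Rightarrow> (('a, 'e) tangent \<Rightarrow> real) \<Rightarrow>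
   (('a, 'e) tangent \<Rightarrow> ('a, 'e) tangent) \<Rightarrow> ('a \<Rightarrow> real) \<Rightarrow> bool" where
  "conservative A U L F \<phi> \<longleftrightarrow> smooth_fun A (points A) \<phi> \<and>
     (\<forall>v\<in>U. F v = (-1) *\<^sub>T anisotropic_gradient A L \<phi> v)"

end

theory Submission
  imports Defs
begin

text \<open>In a chart, write \<open>\<ell>(x, y)\<close> for \<open>L\<close> and \<open>g\<close> for the vertical Hessian of \<open>\<ell> / 2\<close>. Evaluating
  metric compatibility on fields with constant coefficients, one of which is the reference
  field \<open>V = y\<close> itself, removes the Cartan tensor, because \<open>C\<^sub>v(v, \<cdot>, \<cdot>) = 0\<close>; together with
  torsion-freeness and Euler's relations it gives
  \<open>g(\<Gamma>(y, y), w) = (\<partial>\<^sub>x\<partial>\<^sub>y\<ell>(y, w) - \<partial>\<^sub>x\<ell>(w)) / 2\<close>. Hence the Euler-Lagrange covector of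
  \<open>\<ell> / 2 - \<phi>\<close> along \<open>\<gamma>\<close> is \<open>g(D\<gamma>' + \<nabla>\<phi>, w)\<close>, and by nondegeneracy its vanishing is the equation
  of motion. By the first variation formula the vanishing of this covector is also the
  condition for critical points of the action.\<close>


section \<open>Calculus on domains with unique derivatives\<close>

text \<open>Curves live on intervals that may contain their endpoints and variations on strips
  \<open>{-\<epsilon><..<\<epsilon>} \<times> {a..b}\<close>, so derivatives are one-sided at the
  boundary; their uniqueness must be secured before any rule of calculus can identify the
  \<open>frechet_derivative\<close> inside \<open>Ck_on\<close>. Symmetry of second derivatives is
  used at interior times only. At the end times the momentum of the variation field merely has to be
  continuous, because the fundamental theorem asks no more there.

  The reference field V = y is constant in one chart and has values in \<open>U\<close> only over
  part of that chart, so metric compatibility is evaluated over this open part. The Cartan term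
  drops out because V itself is an argument of the metric; the derivative of V need not vanish.

  That a critical curve satisfies the equation is tested on intervals so short that they stay in one
  chart, on whichever side of the given time the parameter interval extends.\<close>

definition thick :: "'a::euclidean_space set \<Rightarrow> bool" where
  "thick S \<longleftrightarrow> (\<forall>x\<in>S. \<forall>i\<in>Basis. \<forall>e>0. \<exists>d. 0 < \<bar>d\<bar> \<and> \<bar>d\<bar> < e \<and> x + d *\<^sub>R i \<in> S)"

text \<open>Thickness is the premise of \<open>frechet_derivative_unique_within\<close> as a
  property of sets. It asks for arbitrarily small steps along each axis, of either sign, and
  therefore holds at boundary points of intervals and strips. The preimages of chart domains inside
  these are only relatively open, which is why it has to pass to such subsets.\<close>

lemma thick_openin:
  assumes "thick S" "openin (top_of_set S) D"
  shows "thick D"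
  unfolding thick_def
proof (intro ballI allI impI)
  fix x and i :: 'a and e :: real
  assume x: "x \<in> D" and i: "i \<in> Basis" and e: "e > 0"
  obtain r where r: "r > 0" "\<And>y. y \<in> S \<Longrightarrow> dist y x < r \<Longrightarrow> y \<in> D"
    using assms(2) x unfolding openin_euclidean_subtopology_iff by blast
  have "x \<in> S" using assms(2) x openin_imp_subset by blast
  moreover have "min e r > 0" using e r by simp
  ultimately obtain d where d: "0 < \<bar>d\<bar>" "\<bar>d\<bar> < min e r" "x + d *\<^sub>R i \<in> S"
    using assms(1) i unfolding thick_def by blast
  moreover have "dist (x + d *\<^sub>R i) x < r" using d i by (simp add: dist_norm)
  ultimately show "\<exists>d. 0 < \<bar>d\<bar> \<and> \<bar>d\<bar> < e \<and> x + d *\<^sub>R i \<in> D" using r by auto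
qed

lemma thick_UNIV: "thick UNIV"
  unfolding thick_def by (metis UNIV_I abs_of_pos dense)

lemma thick_open: "open S \<Longrightarrow> thick S"
  using thick_openin[OF thick_UNIV] by simp

lemma thick_convex:
  fixes S :: "real set"
  assumes "convex S" "x \<in> S" "y \<in> S" "x \<noteq> y"
  shows "thick S"
  unfolding thick_def
proof (intro ballI allI impI)
  fix z i e :: real assume z: "z \<in> S" and i: "i \<in> Basis" and e: "e > 0"
  obtain w where w: "w \<in> S" "w \<noteq> z" using assms by metis
  \<comment> \<open>The step towards \<open>w\<close> is \<open>u * (w - z)\<close>: the bound
    \<open>1/2\<close> keeps it inside the segment, the other bound makes its length at most
    \<open>e / 2\<close>.\<close>
  define u where "u = min (1/2) (e / (2 * \<bar>w - z\<bar>))"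
  have u: "0 < u" "u \<le> 1" using e w by (auto simp: u_def)
  have "u * \<bar>w - z\<bar> \<le> e / 2"
  proof -
    have "u * \<bar>w - z\<bar> \<le> e / (2 * \<bar>w - z\<bar>) * \<bar>w - z\<bar>"
      by (rule mult_right_mono) (auto simp: u_def)
    also have "\<dots> = e / 2" using w by simp
    finally show ?thesis .
  qed
  moreover have "z + u * (w - z) \<in> S"
    using convexD_alt[OF assms(1) z w(1), of u] u by (simp add: algebra_simps)
  ultimately show "\<exists>d. 0 < \<bar>d\<bar> \<and> \<bar>d\<bar> < e \<and> z + d *\<^sub>R i \<in> S"
    using i u w e by (intro exI[of _ "u * (w - z)"]) (auto simp: abs_mult)
qed

lemma thick_Icc: "a < (b::real) \<Longrightarrow> thick {a..b}"
  by (rule thick_convex[of _ a b]) auto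

lemma thick_interval:
  fixes I :: "real set"
  assumes "is_interval I" "interior I \<noteq> {}"
  shows "thick I"
proof -
  obtain x e where "e > 0" "ball x e \<subseteq> I"
    using assms(2) by (metis equals0I mem_interior)
  moreover have "x \<in> ball x e" "x + e/2 \<in> ball x e" using \<open>e > 0\<close> by (auto simp: dist_norm)
  ultimately show ?thesis
    using assms(1) thick_convex[of I x "x + e/2"] \<open>e > 0\<close> by (auto simp: is_interval_convex_1 subset_iff)
qed

lemma thick_Times:
  assumes "thick S" "thick R"
  shows "thick (S \<times> R)"
  unfolding thick_def
proof (intro ballI allI impI)
  fix z and i :: "'a \<times> 'b" and e :: real
  assume z: "z \<in> S \<times> R" and i: "i \<in> Basis" and e: "e > 0"
  obtain x y where [simp]: "z = (x, y)" and xy: "x \<in> S" "y \<in> R" using z by auto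
  from i consider j where "i = (j, 0)" "j \<in> Basis" | j where "i = (0, j)" "j \<in> Basis"
    by (auto simp: Basis_prod_def)
  then show "\<exists>d. 0 < \<bar>d\<bar> \<and> \<bar>d\<bar> < e \<and> z + d *\<^sub>R i \<in> S \<times> R"
  proof cases
    case 1
    then show ?thesis using assms(1) xy e unfolding thick_def by fastforce
  next
    case 2
    then show ?thesis using assms(2) xy e unfolding thick_def by fastforce
  qed
qed

lemma thick_frechet:
  assumes "thick S" "x \<in> S" "(f has_derivative D) (at x within S)"
  shows "frechet_derivative f (at x within S) = D"
proof -
  have "(f has_derivative frechet_derivative f (at x within S)) (at x within S)"
    using assms(3) frechet_derivative_works by (blast intro: differentiableI)
  then show ?thesis
    using assms by (intro frechet_derivative_unique_within[of f _ x S]) (auto simp: thick_def)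
qed

lemma thick_not_bot:
  assumes "thick S" "x \<in> S"
  shows "at x within S \<noteq> bot"
proof -
  obtain i :: 'a where i: "i \<in> Basis" using nonempty_Basis by blast
  have "x islimpt S"
    unfolding islimpt_approachable
  proof (intro allI impI)
    fix e :: real assume "e > 0"
    then obtain d where "0 < \<bar>d\<bar>" "\<bar>d\<bar> < e" "x + d *\<^sub>R i \<in> S"
      using assms i unfolding thick_def by blast
    then show "\<exists>x'\<in>S. x' \<noteq> x \<and> dist x' x < e"
      using i by (intro bexI[of _ "x + d *\<^sub>R i"]) (auto simp: dist_norm)
  qed
  then show ?thesis by (simp add: trivial_limit_within)
qed

lemma has_derivative_cong_on:
  assumes "x \<in> S" "\<And>x. x \<in> S \<Longrightarrow> f x = g x"
  shows "(f has_derivative D) (at x within S) \<longleftrightarrow> (g has_derivative D) (at x within S)"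
  using assms has_derivative_transform[of x S f g D] has_derivative_transform[of x S g f D] by metis

lemma frechet_derivative_cong:
  assumes "x \<in> S" "\<And>x. x \<in> S \<Longrightarrow> f x = g x"
  shows "frechet_derivative f (at x within S) = frechet_derivative g (at x within S)"
proof -
  have "(f has_derivative D) (at x within S) \<longleftrightarrow> (g has_derivative D) (at x within S)" for D
    using assms by (rule has_derivative_cong_on)
  then show ?thesis unfolding frechet_derivative_def by simp
qed

section \<open>Closure properties of k times differentiable functions\<close>

lemma Ck_on_cong:
  assumes "\<And>x. x \<in> S \<Longrightarrow> f x = g x"
  shows "Ck_on k S f \<longleftrightarrow> Ck_on k S g"
  using assms
proof (induction k arbitrary: f g)
  case 0
  then show ?case by (auto cong: continuous_on_cong)
next
  case (Suc k)
  have "Ck_on k S (\<lambda>x. frechet_derivative f (at x within S) e) \<longleftrightarrow>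
        Ck_on k S (\<lambda>x. frechet_derivative g (at x within S) e)" for e
    by (rule Suc.IH) (use frechet_derivative_cong[of _ S f g] Suc.prems in metis)
  moreover have "f differentiable (at x within S) \<longleftrightarrow> g differentiable (at x within S)" if "x \<in> S" for x
    using Suc.prems that unfolding differentiable_def
    by (intro ex_cong1 has_derivative_cong_on) auto
  ultimately show ?case by simp
qed

lemma smooth_on_cong: "(\<And>x. x \<in> S \<Longrightarrow> f x = g x) \<Longrightarrow> smooth_on S f \<longleftrightarrow> smooth_on S g"
  unfolding smooth_on_def using Ck_on_cong by blast

lemma Ck_on_SucD: "Ck_on (Suc k) S f \<Longrightarrow> Ck_on k S f"
proof (induction k arbitrary: f)
  case 0
  then show ?case
    by (auto simp: continuous_on_eq_continuous_within differentiable_imp_continuous_within)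
qed simp

lemma smooth_on_continuous: "smooth_on S f \<Longrightarrow> continuous_on S f"
  unfolding smooth_on_def by (metis Ck_on.simps(1))

lemma smooth_on_differentiable: "smooth_on S f \<Longrightarrow> x \<in> S \<Longrightarrow> f differentiable (at x within S)"
  unfolding smooth_on_def by (metis Ck_on.simps(2))

lemma smooth_on_has_derivative:
  "smooth_on S f \<Longrightarrow> x \<in> S \<Longrightarrow>
    (f has_derivative frechet_derivative f (at x within S)) (at x within S)"
  using smooth_on_differentiable frechet_derivative_works by blast

lemma smooth_on_frechet:
  "smooth_on S f \<Longrightarrow> smooth_on S (\<lambda>x. frechet_derivative f (at x within S) e)"
  unfolding smooth_on_def by (metis Ck_on.simps(2))

text \<open>\<open>Ck_on\<close> refers to \<open>frechet_derivative\<close>, a chosen derivative.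
  On a thick set the choice is forced, so any derivative \<open>D\<close> that the differentiation
  rules produce may take its place; the closure properties below rest on this.\<close>

lemma Ck_on_SucI:
  assumes "thick S" "\<And>x. x \<in> S \<Longrightarrow> (f has_derivative D x) (at x within S)"
    and "\<And>e. Ck_on k S (\<lambda>x. D x e)"
  shows "Ck_on (Suc k) S f"
proof -
  have "Ck_on k S (\<lambda>x. frechet_derivative f (at x within S) e)" for e
    using assms(3)[of e] thick_frechet[OF assms(1) _ assms(2)]
    by (subst Ck_on_cong[where g = "\<lambda>x. D x e"]) auto
  then show ?thesis using assms(2) by (auto simp: differentiable_def)
qed

lemma Ck_on_const: "Ck_on k S (\<lambda>x. c)"
  if "thick S"
  using that
proof (induction k arbitrary: c)
  case (Suc k)
  show ?case by (rule Ck_on_SucI[OF Suc.prems, where D = "\<lambda>x h. 0"]) (auto intro: Suc)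
qed simp

lemma Ck_on_linear:
  assumes "bounded_linear L" "thick S"
  shows "Ck_on k S L"
proof (cases k)
  case (Suc j)
  then show ?thesis
    using Ck_on_SucI[OF assms(2), of L "\<lambda>x. L"] assms Ck_on_const
    by (auto simp: bounded_linear_imp_has_derivative)
qed (use assms in \<open>auto simp: linear_continuous_on\<close>)

lemma Ck_on_bounded_linear:
  assumes "bounded_linear L" "thick S" "Ck_on k S f"
  shows "Ck_on k S (\<lambda>x. L (f x))"
  using assms(3)
proof (induction k arbitrary: f)
  case 0
  then show ?case
    using bounded_linear.continuous_on[OF assms(1)] by simp
next
  case (Suc k)
  then show ?case
    by (intro Ck_on_SucI[OF assms(2), where D = "\<lambda>x h. L (frechet_derivative f (at x within S) h)"])
      (auto intro: bounded_linear.has_derivative[OF assms(1)] simp: frechet_derivative_works)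
qed

lemma Ck_on_add:
  assumes "thick S" "Ck_on k S f" "Ck_on k S g"
  shows "Ck_on k S (\<lambda>x. f x + g x)"
  using assms(2,3)
proof (induction k arbitrary: f g)
  case 0
  then show ?case by (auto intro: continuous_intros)
next
  case (Suc k)
  then show ?case
    by (intro Ck_on_SucI[OF assms(1), where D = "\<lambda>x h. frechet_derivative f (at x within S) h
       + frechet_derivative g (at x within S) h"])
      (auto intro!: has_derivative_add simp: frechet_derivative_works)
qed

lemma Ck_on_bilinear:
  assumes "bounded_bilinear B" "thick S" "Ck_on k S f" "Ck_on k S g"
  shows "Ck_on k S (\<lambda>x. B (f x) (g x))"
  using assms(3,4)
proof (induction k arbitrary: f g)
  case 0
  then show ?case by (auto intro: bounded_bilinear.continuous_on[OF assms(1)])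
next
  case (Suc k)
  \<comment> \<open>The product rule leaves one factor undifferentiated; it is of class k + 1 and
    enters the induction at class k.\<close>
  note * = Ck_on_SucD[OF Suc.prems(1)] Ck_on_SucD[OF Suc.prems(2)]
  show ?case
    using Suc *
    by (intro Ck_on_SucI[OF assms(2), where D = "\<lambda>x h. B (f x) (frechet_derivative g (at x within S) h)
       + B (frechet_derivative f (at x within S) h) (g x)"])
      (auto intro!: bounded_bilinear.FDERIV[OF assms(1)] Ck_on_add[OF assms(2)] simp: frechet_derivative_works)
qed

lemma Ck_on_sum:
  assumes "thick S" "finite N" "\<And>i. i \<in> N \<Longrightarrow> Ck_on k S (f i)"
  shows "Ck_on k S (\<lambda>x. \<Sum>i\<in>N. f i x)"
  using assms(2,3) by (induction N) (auto intro!: Ck_on_add Ck_on_const assms(1))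

lemma Ck_on_Pair:
  assumes "thick S" "Ck_on k S f" "Ck_on k S g"
  shows "Ck_on k S (\<lambda>x. (f x, g x))"
  using Ck_on_add[OF assms(1) Ck_on_bounded_linear[OF _ assms(1,2), of "\<lambda>x. (x, 0)"]
      Ck_on_bounded_linear[OF _ assms(1,3), of "\<lambda>x. (0, x)"]]
  by (auto simp: bounded_linear_Pair bounded_linear_ident bounded_linear_zero)

text \<open>Since \<open>p'\<close> is the same everywhere, the derivative of the composite in
  direction \<open>e\<close> is that of \<open>f\<close> in the fixed direction \<open>p' e\<close>,
  and the induction needs no expansion in a basis. Restriction to subsets, slices of a variation and
  projections are instances.\<close>

lemma Ck_on_affine_comp:
  assumes p: "\<And>z. (p has_derivative p') (at z)" and "thick S" "p ` S \<subseteq> R" "Ck_on k R f"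
  shows "Ck_on k S (\<lambda>x. f (p x))"
  using assms(4)
proof (induction k arbitrary: f)
  case 0
  have "continuous_on S p"
    by (rule has_derivative_continuous_on, rule has_derivative_at_withinI, rule p)
  then show ?case using 0 assms(3) by (auto intro: continuous_on_compose2)
next
  case (Suc k)
  show ?case
  proof (rule Ck_on_SucI[OF assms(2)])
    fix x assume "x \<in> S"
    then have "(f has_derivative frechet_derivative f (at (p x) within R)) (at (p x) within p ` S)"
      using Suc.prems assms(3) has_derivative_subset
      by (metis Ck_on.simps(2) frechet_derivative_works image_subset_iff)
    then show "((\<lambda>x. f (p x)) has_derivative (\<lambda>h. frechet_derivative f (at (p x) within R) (p' h))) (at x within S)"
      using has_derivative_in_compose[OF has_derivative_at_withinI[OF p]] by blast
  next
    show "Ck_on k S (\<lambda>x. frechet_derivative f (at (p x) within R) (p' e))" for e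
      using Suc.IH[of "\<lambda>x. frechet_derivative f (at x within R) (p' e)"] Suc.prems by simp
  qed
qed

lemma frechet_sum_Basis:
  fixes D :: "'a::euclidean_space \<Rightarrow> 'b::real_normed_vector"
  assumes "linear D"
  shows "D h = (\<Sum>b\<in>Basis. (h \<bullet> b) *\<^sub>R D b)"
proof -
  have "D h = D (\<Sum>b\<in>Basis. (h \<bullet> b) *\<^sub>R b)" by (simp add: euclidean_representation)
  then show ?thesis by (simp only: linear_sum[OF assms] linear_scale[OF assms] o_def)
qed

text \<open>The chain rule evaluates the derivative of \<open>g\<close> in a direction that moves
  with \<open>x\<close>, whereas \<open>Ck_on\<close> controls fixed directions only. Expanding the
  moving direction in the basis gives a finite sum of products, to which the induction hypothesis
  applies.\<close>

lemma Ck_on_compose: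
  fixes f :: "'a::euclidean_space \<Rightarrow> 'b::euclidean_space"
  assumes "thick S" "f ` S \<subseteq> R" "Ck_on k S f" "Ck_on k R g"
  shows "Ck_on k S (\<lambda>x. g (f x))"
  using assms(3,4)
proof (induction k arbitrary: g)
  case 0
  then show ?case using assms(2) by (auto intro: continuous_on_compose2)
next
  case (Suc k)
  let ?g' = "\<lambda>x. frechet_derivative g (at (f x) within R)"
  let ?f' = "\<lambda>x. frechet_derivative f (at x within S)"
  have g': "(g has_derivative ?g' x) (at (f x) within R)" if "x \<in> S" for x
    using Suc.prems(2) that assms(2) by (auto simp: frechet_derivative_works)
  show ?case
  proof (rule Ck_on_SucI[OF assms(1)])
    fix x assume x: "x \<in> S"
    have "((\<lambda>x. g (f x)) has_derivative (\<lambda>h. ?g' x (?f' x h))) (at x within S)"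
    proof (rule has_derivative_in_compose[where f = f and g = g])
      show "(f has_derivative ?f' x) (at x within S)"
        using Suc.prems x by (auto simp: frechet_derivative_works)
      show "(g has_derivative ?g' x) (at (f x) within f ` S)"
        using g'[OF x] assms(2) has_derivative_subset by blast
    qed
    then show "((\<lambda>x. g (f x)) has_derivative (\<lambda>h. \<Sum>b\<in>Basis. (?f' x h \<bullet> b) *\<^sub>R ?g' x b)) (at x within S)"
      by (subst frechet_sum_Basis[symmetric]) (auto intro: has_derivative_linear g' x)
  next
    fix e
    show "Ck_on k S (\<lambda>x. \<Sum>b\<in>Basis. (?f' x e \<bullet> b) *\<^sub>R ?g' x b)"
    proof (intro Ck_on_sum[OF assms(1)] finite_Basis)
      fix b :: 'b
      have "Ck_on k S (\<lambda>x. ?f' x e \<bullet> b)"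
        using Suc.prems(1) by (intro Ck_on_bounded_linear[OF bounded_linear_inner_left assms(1)]) auto
      moreover have "Ck_on k S (\<lambda>x. ?g' x b)"
        using Suc.prems(2) by (intro Suc.IH[OF Ck_on_SucD[OF Suc.prems(1)]]) auto
      ultimately show "Ck_on k S (\<lambda>x. (?f' x e \<bullet> b) *\<^sub>R ?g' x b)"
        by (rule Ck_on_bilinear[OF bounded_bilinear_scaleR assms(1)])
    qed
  qed
qed

lemma smooth_on_const: "thick S \<Longrightarrow> smooth_on S (\<lambda>x. c)"
  by (simp add: smooth_on_def Ck_on_const)

lemma smooth_on_linear: "bounded_linear L \<Longrightarrow> thick S \<Longrightarrow> smooth_on S L"
  by (simp add: smooth_on_def Ck_on_linear)

lemma smooth_on_add:
  "thick S \<Longrightarrow> smooth_on S f \<Longrightarrow> smooth_on S g \<Longrightarrow> smooth_on S (\<lambda>x. f x + g x)"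
  by (simp add: smooth_on_def Ck_on_add)

lemma smooth_on_bilinear:
  "bounded_bilinear B \<Longrightarrow> thick S \<Longrightarrow> smooth_on S f \<Longrightarrow> smooth_on S g \<Longrightarrow> smooth_on S (\<lambda>x. B (f x) (g x))"
  by (simp add: smooth_on_def Ck_on_bilinear)

lemma smooth_on_bounded_linear:
  "bounded_linear L \<Longrightarrow> thick S \<Longrightarrow> smooth_on S f \<Longrightarrow> smooth_on S (\<lambda>x. L (f x))"
  by (simp add: smooth_on_def Ck_on_bounded_linear)

lemma smooth_on_Pair:
  "thick S \<Longrightarrow> smooth_on S f \<Longrightarrow> smooth_on S g \<Longrightarrow> smooth_on S (\<lambda>x. (f x, g x))"
  by (simp add: smooth_on_def Ck_on_Pair)

lemma smooth_on_affine_comp: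
  "(\<And>z. (p has_derivative p') (at z)) \<Longrightarrow> thick S \<Longrightarrow> p ` S \<subseteq> R \<Longrightarrow> smooth_on R f \<Longrightarrow>
    smooth_on S (\<lambda>x. f (p x))"
  unfolding smooth_on_def using Ck_on_affine_comp by blast

lemma smooth_on_subset: "smooth_on R f \<Longrightarrow> thick S \<Longrightarrow> S \<subseteq> R \<Longrightarrow> smooth_on S f"
  by (rule smooth_on_affine_comp[OF has_derivative_ident]) auto

lemma smooth_on_compose:
  fixes f :: "'a::euclidean_space \<Rightarrow> 'b::euclidean_space"
  shows "thick S \<Longrightarrow> smooth_on S f \<Longrightarrow> smooth_on R g \<Longrightarrow> f ` S \<subseteq> R \<Longrightarrow> smooth_on S (\<lambda>x. g (f x))"
  unfolding smooth_on_def using Ck_on_compose by blast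

lemma at_within_openin:
  assumes "openin (top_of_set S) D" "x \<in> D"
  shows "at x within D = at x within S"
proof -
  obtain O' where "open O'" "D = S \<inter> O'" using assms(1) by (auto simp: openin_open)
  then show ?thesis
    using assms(2) by (intro at_within_nhd[of x O']) auto
qed

lemma smooth_on_open_has_derivative:
  "smooth_on S f \<Longrightarrow> open S \<Longrightarrow> x \<in> S \<Longrightarrow> (f has_derivative frechet_derivative f (at x)) (at x)"
  using smooth_on_has_derivative[of S f x] at_within_open[of x S] by simp

lemma smooth_on_open_frechet:
  "smooth_on S f \<Longrightarrow> open S \<Longrightarrow> smooth_on S (\<lambda>x. frechet_derivative f (at x) e)"
  using smooth_on_frechet[of S f e]
  by (subst smooth_on_cong[where g = "\<lambda>x. frechet_derivative f (at x within S) e"]) (auto simp: at_within_open[of _ S])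

section \<open>Homogeneous Lagrangians and the Euler-Lagrange covector\<close>

abbreviation dd :: "('a::real_normed_vector \<Rightarrow> 'b::real_normed_vector) \<Rightarrow> 'a \<Rightarrow> 'a \<Rightarrow> 'b" where
  "dd f z h \<equiv> frechet_derivative f (at z) h"

lemma dd_eqI: "(f has_derivative D) (at z) \<Longrightarrow> dd f z h = D h"
  using frechet_derivative_at by metis

lemma smooth_on_open_linear:
  "smooth_on S f \<Longrightarrow> open S \<Longrightarrow> z \<in> S \<Longrightarrow> linear (dd f z)"
  using has_derivative_linear smooth_on_open_has_derivative by blast

text \<open>In the basis expansion of \<open>dd l x v\<close> the coefficients carry the motion of
  the direction and the partial derivatives that of the point. Two cases matter: the momentum in the
  direction of a variation field, and \<open>dd l z (0, snd z)\<close> in Euler's relation.\<close>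

lemma dd_moving:
  fixes l :: "'a::euclidean_space \<Rightarrow> 'b::real_normed_vector"
  assumes l: "smooth_on W l" "open W" and S: "z \<in> S" "p ` S \<subseteq> W"
    and p: "(p has_derivative p') (at z within S)" and q: "(q has_derivative q') (at z within S)"
  shows "((\<lambda>z. dd l (p z) (q z)) has_derivative
     (\<lambda>h. dd (\<lambda>x. dd l x (q z)) (p z) (p' h) + dd l (p z) (q' h))) (at z within S)"
proof -
  have exp: "dd l x v = (\<Sum>b\<in>Basis. (v \<bullet> b) *\<^sub>R dd l x b)" if "x \<in> W" for x v
    using frechet_sum_Basis smooth_on_open_linear[OF l that] by blast
  have pz: "p z \<in> W" using S by auto
  have lb: "((\<lambda>x. dd l x b) has_derivative dd (\<lambda>x. dd l x b) (p z)) (at (p z))" for b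
    by (rule smooth_on_open_has_derivative[OF smooth_on_open_frechet[OF l] l(2) pz])
  have "((\<lambda>x. \<Sum>b\<in>Basis. (v \<bullet> b) *\<^sub>R dd l x b) has_derivative
      (\<lambda>h. \<Sum>b\<in>Basis. (v \<bullet> b) *\<^sub>R dd (\<lambda>x. dd l x b) (p z) h)) (at (p z))" for v
    by (intro derivative_intros lb)
  then have "((\<lambda>x. dd l x v) has_derivative
      (\<lambda>h. \<Sum>b\<in>Basis. (v \<bullet> b) *\<^sub>R dd (\<lambda>x. dd l x b) (p z) h)) (at (p z))" for v
    by (rule has_derivative_transform_within_open[OF _ l(2) pz]) (simp add: exp[symmetric])
  then have d2: "dd (\<lambda>x. dd l x v) (p z) h = (\<Sum>b\<in>Basis. (v \<bullet> b) *\<^sub>R dd (\<lambda>x. dd l x b) (p z) h)" for v h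
    by (rule dd_eqI)
  have "((\<lambda>z. dd l (p z) b) has_derivative (\<lambda>h. dd (\<lambda>x. dd l x b) (p z) (p' h))) (at z within S)" for b
    by (rule has_derivative_compose[OF p lb])
  then have "((\<lambda>z. \<Sum>b\<in>Basis. (q z \<bullet> b) *\<^sub>R dd l (p z) b) has_derivative
     (\<lambda>h. \<Sum>b\<in>Basis. (q z \<bullet> b) *\<^sub>R dd (\<lambda>x. dd l x b) (p z) (p' h) + (q' h \<bullet> b) *\<^sub>R dd l (p z) b)) (at z within S)"
    by (auto intro!: derivative_eq_intros q)
  then have "((\<lambda>z. dd l (p z) (q z)) has_derivative
     (\<lambda>h. \<Sum>b\<in>Basis. (q z \<bullet> b) *\<^sub>R dd (\<lambda>x. dd l x b) (p z) (p' h) + (q' h \<bullet> b) *\<^sub>R dd l (p z) b)) (at z within S)"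
    by (rule has_derivative_transform[OF S(1), rotated]) (use S in \<open>auto intro: exp\<close>)
  then show ?thesis
    by (simp only: sum.distrib d2[symmetric] exp[OF pz, symmetric])
qed

text \<open>The inner derivative is linear in \<open>v\<close> at every point of the open set
  \<open>W\<close>, not only at \<open>z\<close>, so this linearity survives the outer
  derivative.\<close>

lemma dd_dd_linear:
  fixes l :: "'a::euclidean_space \<Rightarrow> 'b::real_normed_vector"
  assumes "smooth_on W l" "open W" "z \<in> W"
  shows "linear (\<lambda>v. dd (\<lambda>x. dd l x v) z h)"
proof -
  have *: "((\<lambda>x. dd l x v) has_derivative dd (\<lambda>x. dd l x v) z) (at z)" for v
    by (rule smooth_on_open_has_derivative[OF smooth_on_open_frechet[OF assms(1,2)] assms(2,3)])
  note lin = smooth_on_open_linear[OF assms(1,2)]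
  show ?thesis
  proof
    fix v w
    have "((\<lambda>x. dd l x (v + w)) has_derivative (\<lambda>h. dd (\<lambda>x. dd l x v) z h + dd (\<lambda>x. dd l x w) z h)) (at z)"
      by (rule has_derivative_transform_within_open[OF has_derivative_add[OF * *] assms(2,3)])
        (simp add: linear_add[OF lin])
    then show "dd (\<lambda>x. dd l x (v + w)) z h = dd (\<lambda>x. dd l x v) z h + dd (\<lambda>x. dd l x w) z h"
      by (rule dd_eqI)
  next
    fix r v
    have "((\<lambda>x. dd l x (r *\<^sub>R v)) has_derivative (\<lambda>h. r *\<^sub>R dd (\<lambda>x. dd l x v) z h)) (at z)"
      by (rule has_derivative_transform_within_open[OF has_derivative_scaleR_right[OF *] assms(2,3)])
        (simp add: linear_scale[OF lin])
    then show "dd (\<lambda>x. dd l x (r *\<^sub>R v)) z h = r *\<^sub>R dd (\<lambda>x. dd l x v) z h"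
      by (rule dd_eqI)
  qed
qed

section \<open>Partial derivatives along coordinate lines and their symmetry\<close>

lemma has_vector_derivative_section_fst:
  assumes "(f has_derivative D) (at (s, t) within S)" "\<And>r. r \<in> R \<Longrightarrow> (r, t) \<in> S"
  shows "((\<lambda>r. f (r, t)) has_vector_derivative D (1, 0)) (at s within R)"
proof -
  have "((\<lambda>r. (r, t)) has_derivative (\<lambda>h. (h, 0))) (at s within R)"
    by (rule has_derivative_Pair[OF has_derivative_ident has_derivative_const])
  moreover have "(f has_derivative D) (at (s, t) within (\<lambda>r. (r, t)) ` R)"
    using assms by (auto intro: has_derivative_subset)
  ultimately have "((\<lambda>r. f (r, t)) has_derivative (\<lambda>h. D (h, 0))) (at s within R)"
    by (rule has_derivative_in_compose)
  moreover have "D (h, 0) = h *\<^sub>R D (1, 0)" for h :: real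
    using linear_scale[OF has_derivative_linear[OF assms(1)], of h "(1, 0)"] by simp
  then have "(\<lambda>h. D (h, 0)) = (\<lambda>h. h *\<^sub>R D (1, 0))" ..
  ultimately show ?thesis by (simp only: has_vector_derivative_def)
qed

lemma has_vector_derivative_section_snd:
  assumes "(f has_derivative D) (at (s, t) within S)" "\<And>r. r \<in> R \<Longrightarrow> (s, r) \<in> S"
  shows "((\<lambda>r. f (s, r)) has_vector_derivative D (0, 1)) (at t within R)"
proof -
  have "((\<lambda>r. (s, r)) has_derivative (\<lambda>h. (0, h))) (at t within R)"
    by (rule has_derivative_Pair[OF has_derivative_const has_derivative_ident])
  moreover have "(f has_derivative D) (at (s, t) within (\<lambda>r. (s, r)) ` R)"
    using assms by (auto intro: has_derivative_subset)
  ultimately have "((\<lambda>r. f (s, r)) has_derivative (\<lambda>h. D (0, h))) (at t within R)"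
    by (rule has_derivative_in_compose)
  moreover have "D (0, h) = h *\<^sub>R D (0, 1)" for h :: real
    using linear_scale[OF has_derivative_linear[OF assms(1)], of h "(0, 1)"] by simp
  then have "(\<lambda>h. D (0, h)) = (\<lambda>h. h *\<^sub>R D (0, 1))" ..
  ultimately show ?thesis by (simp only: has_vector_derivative_def)
qed

text \<open>Symmetry by integration: \<open>G (s, t') - G (s, a)\<close> is the integral of
  \<open>Gt\<close>. Differentiating under the integral sign in s writes the increment of
  \<open>Gs\<close> as an integral of \<open>Gst\<close>, and the fundamental theorem in t' shows
  that \<open>Gst\<close> is the t-derivative of \<open>Gs\<close>.\<close>

lemma mixed_partials:
  fixes G :: "real \<times> real \<Rightarrow> 'b::euclidean_space"
  assumes G: "smooth_on Q G" "open Q" and z: "(s, t) \<in> Q"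
  shows "dd (\<lambda>z. dd G z (0, 1)) (s, t) (1, 0) = dd (\<lambda>z. dd G z (1, 0)) (s, t) (0, 1)"
proof -
  obtain A B where AB: "open A" "open B" "s \<in> A" "t \<in> B" "A \<times> B \<subseteq> Q"
    by (rule open_prod_elim[OF G(2) z]) auto
  \<comment> \<open>A closed box around \<open>(s, t)\<close> inside \<open>Q\<close>: integrals in
    t run over a compact interval, and s is interior to \<open>R\<close>, so that derivatives within
    \<open>R\<close> are ordinary ones.\<close>
  obtain d where d: "d > 0" "cball s d \<subseteq> A" using AB open_contains_cball by metis
  obtain e where e: "e > 0" "cball t e \<subseteq> B" using AB open_contains_cball by metis
  define a where "a = t - e"
  define b where "b = t + e"
  define R where "R = cball s d"
  have sub: "(s', t') \<in> Q" if "s' \<in> R" "t' \<in> {a..b}" for s' t'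
  proof -
    have "s' \<in> A" "t' \<in> B"
      using that d(2) e(2) by (auto simp: R_def a_def b_def cball_eq_atLeastAtMost)
    then show ?thesis using AB(5) by blast
  qed
  define Gs where "Gs = (\<lambda>z. dd G z (1, 0))"
  define Gt where "Gt = (\<lambda>z. dd G z (0, 1))"
  define Gst where "Gst = (\<lambda>z. dd Gt z (1, 0))"
  have sm: "smooth_on Q Gs" "smooth_on Q Gt" "smooth_on Q Gst"
    unfolding Gs_def Gt_def Gst_def by (intro smooth_on_open_frechet G)+
  have Gt_s: "((\<lambda>r. Gt (r, t')) has_vector_derivative Gst (s', t')) (at s' within R)"
    if "(s', t') \<in> Q" for s' t' R unfolding Gst_def
    by (rule has_vector_derivative_at_within[OF has_vector_derivative_section_fst[OF
      smooth_on_open_has_derivative[OF sm(2) G(2) that]]]) simp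
  have G_s: "((\<lambda>r. G (r, t')) has_vector_derivative Gs (s', t')) (at s' within R)"
    if "(s', t') \<in> Q" for s' t' R unfolding Gs_def
    by (rule has_vector_derivative_at_within[OF has_vector_derivative_section_fst[OF
      smooth_on_open_has_derivative[OF G that]]]) simp
  have G_t: "((\<lambda>r. G (s', r)) has_vector_derivative Gt (s', t')) (at t' within R)"
    if "(s', t') \<in> Q" for s' t' R unfolding Gt_def
    by (rule has_vector_derivative_at_within[OF has_vector_derivative_section_snd[OF
      smooth_on_open_has_derivative[OF G that]]]) simp
  have cont: "continuous_on {a..b} (\<lambda>t'. F (s', t'))" if "s' \<in> R" "smooth_on Q F" for F :: "_ \<Rightarrow> 'b" and s'
    by (rule continuous_on_compose2[OF smooth_on_continuous[OF that(2)] continuous_on_Pair[OF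
      continuous_on_const continuous_on_id]]) (use sub[OF that(1)] in auto)
  have FTC: "((\<lambda>\<tau>. Gt (s', \<tau>)) has_integral G (s', t') - G (s', a)) {a..t'}"
    if "s' \<in> R" "t' \<in> {a..b}" for s' t'
  proof (rule fundamental_theorem_of_calculus)
    fix \<tau> assume "\<tau> \<in> {a..t'}"
    then have "(s', \<tau>) \<in> Q" using that by (intro sub) auto
    then show "((\<lambda>r. G (s', r)) has_vector_derivative Gt (s', \<tau>)) (at \<tau> within {a..t'})"
      by (rule G_t)
  qed (use that in simp)
  have sR: "s \<in> R" using d by (simp add: R_def)
  have eq: "Gs (s, t') - Gs (s, a) = integral {a..t'} (\<lambda>\<tau>. Gst (s, \<tau>))" if t': "t' \<in> {a..b}" for t'
  proof -
    have "((\<lambda>r. integral (cbox a t') (\<lambda>\<tau>. Gt (r, \<tau>))) has_vector_derivative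
        integral (cbox a t') (\<lambda>\<tau>. Gst (s, \<tau>))) (at s within R)"
    proof (rule leibniz_rule_vector_derivative)
      fix r \<tau> assume "r \<in> R" "\<tau> \<in> cbox a t'"
      then show "((\<lambda>x. Gt (x, \<tau>)) has_vector_derivative Gst (r, \<tau>)) (at r within R)"
        using sub t' by (intro Gt_s) auto
    next
      fix r assume "r \<in> R"
      then show "(\<lambda>\<tau>. Gt (r, \<tau>)) integrable_on cbox a t'"
        using FTC t' by (auto simp: integrable_on_def)
    next
      show "continuous_on (R \<times> cbox a t') (\<lambda>(x, t). Gst (x, t))"
        using sub t' by (auto simp: split_beta intro!: continuous_on_subset[OF smooth_on_continuous[OF sm(3)]])
    qed (use d in \<open>auto simp: sR R_def\<close>)
    then have "((\<lambda>r. G (r, t') - G (r, a)) has_vector_derivative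
        integral (cbox a t') (\<lambda>\<tau>. Gst (s, \<tau>))) (at s within R)"
      by (rule has_vector_derivative_transform[OF sR, rotated])
        (use integral_unique[OF FTC[OF _ t']] in simp)
    moreover have "((\<lambda>r. G (r, t') - G (r, a)) has_vector_derivative Gs (s, t') - Gs (s, a)) (at s within R)"
      using sub[OF sR] t' by (intro has_vector_derivative_diff G_s) auto
    moreover have "at s within R = at s"
      by (rule at_within_interior) (use d in \<open>simp add: R_def interior_cball\<close>)
    ultimately show ?thesis by (simp only: cbox_interval) (rule vector_derivative_unique_at)
  qed
  have tab: "t \<in> {a..b}"
    using e by (auto simp: a_def b_def)
  have int: "at t within {a..b} = at t"
    by (rule at_within_interior) (use e in \<open>simp add: a_def b_def\<close>)
  have "((\<lambda>t'. integral {a..t'} (\<lambda>\<tau>. Gst (s, \<tau>))) has_vector_derivative Gst (s, t)) (at t within {a..b})"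
    by (rule integral_has_vector_derivative[OF cont[OF sR sm(3)] tab])
  then have "((\<lambda>t'. Gs (s, t') - Gs (s, a)) has_vector_derivative Gst (s, t)) (at t within {a..b})"
    by (rule has_vector_derivative_transform[OF tab, rotated]) (rule eq)
  then have 1: "((\<lambda>t'. Gs (s, t') - Gs (s, a)) has_vector_derivative Gst (s, t)) (at t)"
    by (simp only: int)
  have "((\<lambda>t'. Gs (s, t')) has_vector_derivative dd Gs (s, t) (0, 1)) (at t within Q')"
    if "\<And>r. r \<in> Q' \<Longrightarrow> (s, r) \<in> UNIV" for Q'
    by (rule has_vector_derivative_section_snd[OF smooth_on_open_has_derivative[OF sm(1) G(2) z] that])
  from has_vector_derivative_diff[OF this[of UNIV, OF UNIV_I] has_vector_derivative_const]
  have "((\<lambda>t'. Gs (s, t') - Gs (s, a)) has_vector_derivative dd Gs (s, t) (0, 1)) (at t)"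
    by simp
  with 1 have "Gst (s, t) = dd Gs (s, t) (0, 1)"
    by (rule vector_derivative_unique_at)
  then show ?thesis by (simp add: Gst_def Gt_def Gs_def)
qed

section \<open>Euler's relations for functions homogeneous on the fibres\<close>

lemma homogeneous_dd:
  fixes f :: "'e::euclidean_space \<times> 'e \<Rightarrow> real"
  assumes f: "smooth_on W f" "open W" and W: "\<And>x y r. (x, y) \<in> W \<Longrightarrow> r > 0 \<Longrightarrow> (x, r *\<^sub>R y) \<in> W"
    and hom: "\<And>x y r. (x, y) \<in> W \<Longrightarrow> r > 0 \<Longrightarrow> f (x, r *\<^sub>R y) = r ^ k * f (x, y)"
    and z: "(x, y) \<in> W" and r: "r > 0"
  shows "dd f (x, r *\<^sub>R y) (u, r *\<^sub>R w) = r ^ k * dd f (x, y) (u, w)"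
proof -
  \<comment> \<open>Fibre dilation scales the vertical part of the direction together with the
    point, so the exponent k stays. For a vertical direction, linearity takes out one factor r and
    lowers the degree by one; this is how degree 2 of \<open>l\<close> becomes 1 for the momentum
    and 0 for the Hessian.\<close>
  have "((\<lambda>z. (fst z, r *\<^sub>R snd z)) has_derivative (\<lambda>h. (fst h, r *\<^sub>R snd h))) (at (x, y))"
    by (auto intro!: derivative_eq_intros)
  then have "((\<lambda>z. f (fst z, r *\<^sub>R snd z)) has_derivative (\<lambda>h. dd f (x, r *\<^sub>R y) (fst h, r *\<^sub>R snd h))) (at (x, y))"
    by (rule has_derivative_compose) (use smooth_on_open_has_derivative[OF f W[OF z r]] in simp)
  moreover have "((\<lambda>z. f (fst z, r *\<^sub>R snd z)) has_derivative (\<lambda>h. r ^ k * dd f (x, y) h)) (at (x, y))"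
    by (rule has_derivative_transform_within_open[OF has_derivative_mult_right[OF
      smooth_on_open_has_derivative[OF f z]] f(2) z]) (use hom r in auto)
  ultimately have "(\<lambda>h. dd f (x, r *\<^sub>R y) (fst h, r *\<^sub>R snd h)) = (\<lambda>h. r ^ k * dd f (x, y) h)"
    by (rule has_derivative_unique)
  then show ?thesis by (metis fst_conv snd_conv)
qed

lemma homogeneous_euler:
  fixes f :: "'e::euclidean_space \<times> 'e \<Rightarrow> real"
  assumes f: "smooth_on W f" "open W"
    and hom: "\<And>x y r. (x, y) \<in> W \<Longrightarrow> r > 0 \<Longrightarrow> f (x, r *\<^sub>R y) = r ^ k * f (x, y)"
    and z: "(x, y) \<in> W"
  shows "dd f (x, y) (0, y) = k * f (x, y)"
proof -
  have "((\<lambda>r. (x, r *\<^sub>R y)) has_derivative (\<lambda>h. (0, h *\<^sub>R y))) (at 1)"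
    by (auto intro!: derivative_eq_intros)
  then have "((\<lambda>r. f (x, r *\<^sub>R y)) has_derivative (\<lambda>h. dd f (x, y) (0, h *\<^sub>R y))) (at 1)"
    by (rule has_derivative_compose) (use smooth_on_open_has_derivative[OF f z] in simp)
  moreover have "((\<lambda>r. r ^ k * f (x, y)) has_derivative (\<lambda>h::real. k * h * f (x, y))) (at 1)"
    by (auto intro!: derivative_eq_intros)
  then have "((\<lambda>r. f (x, r *\<^sub>R y)) has_derivative (\<lambda>h::real. k * h * f (x, y))) (at 1)"
    by (rule has_derivative_transform_within_open[where s = "{0<..}"]) (use hom z in auto)
  ultimately have "(\<lambda>h::real. dd f (x, y) (0, h *\<^sub>R y)) = (\<lambda>h::real. k * h * f (x, y))"
    by (rule has_derivative_unique)
  from fun_cong[OF this, of 1] show ?thesis by simp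
qed

text \<open>The fundamental tensor in coordinates; \<open>u\<close> belongs to the outer derivative,
  in accordance with the order of the two \<open>deriv\<close> in
  \<open>fundamental_tensor\<close>.\<close>

definition vertical_hessian :: "('e::euclidean_space \<times> 'e \<Rightarrow> real) \<Rightarrow> 'e \<times> 'e \<Rightarrow> 'e \<Rightarrow> 'e \<Rightarrow> real" where
  "vertical_hessian l z u w = 1/2 * dd (\<lambda>z. dd l z (0, w)) z (0, u)"

locale quadratic_lagrangian =
  fixes W :: "('e::euclidean_space \<times> 'e) set" and l :: "'e \<times> 'e \<Rightarrow> real"
  assumes smooth: "smooth_on W l" and op: "open W"
    and cone: "(x, y) \<in> W \<Longrightarrow> r > 0 \<Longrightarrow> (x, r *\<^sub>R y) \<in> W"
    and homogeneous: "(x, y) \<in> W \<Longrightarrow> r > 0 \<Longrightarrow> l (x, r *\<^sub>R y) = r\<^sup>2 * l (x, y)"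
begin

text \<open>The exponent is written \<open>r ^ 1\<close> to match the homogeneity premise of
  \<open>homogeneous_dd\<close> and \<open>homogeneous_euler\<close>, which are applied to the
  momentum in turn.\<close>

lemma momentum_homogeneous:
  assumes "(x, y) \<in> W" "r > 0"
  shows "dd l (x, r *\<^sub>R y) (0, w) = r ^ 1 * dd l (x, y) (0, w)"
proof -
  have "dd l (x, r *\<^sub>R y) (0, r *\<^sub>R w) = r ^ 2 * dd l (x, y) (0, w)"
    by (rule homogeneous_dd[OF smooth op cone homogeneous assms])
  moreover have "dd l (x, r *\<^sub>R y) (0, r *\<^sub>R w) = r * dd l (x, r *\<^sub>R y) (0, w)"
    using linear_scale[OF smooth_on_open_linear[OF smooth op cone[OF assms]], of r "(0, w)"] by simp
  ultimately show ?thesis using assms by (simp add: power2_eq_square)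
qed

lemma momentum_self: "(x, y) \<in> W \<Longrightarrow> dd l (x, y) (0, y) = 2 * l (x, y)"
  using homogeneous_euler[OF smooth op homogeneous] by simp

lemma momentum_smooth: "smooth_on W (\<lambda>z. dd l z v)"
  by (rule smooth_on_open_frechet[OF smooth op])

text \<open>Degree 0 means constant along rays, which is what makes the Cartan tensor vanish in the
  direction of the reference vector.\<close>

lemma hessian_homogeneous:
  assumes "(x, y) \<in> W" "r > 0"
  shows "vertical_hessian l (x, r *\<^sub>R y) u w = vertical_hessian l (x, y) u w"
proof -
  let ?m = "\<lambda>z. dd l z (0, w)"
  have "dd ?m (x, r *\<^sub>R y) (0, r *\<^sub>R u) = r ^ 1 * dd ?m (x, y) (0, u)"
    by (rule homogeneous_dd[OF momentum_smooth op cone momentum_homogeneous assms])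
  moreover have "dd ?m (x, r *\<^sub>R y) (0, r *\<^sub>R u) = r * dd ?m (x, r *\<^sub>R y) (0, u)"
    using linear_scale[OF smooth_on_open_linear[OF momentum_smooth op cone[OF assms]], of _ r "(0, u)"] by simp
  ultimately show ?thesis using assms by (simp add: vertical_hessian_def)
qed

lemma hessian_self_left:
  "(x, y) \<in> W \<Longrightarrow> vertical_hessian l (x, y) y w = 1/2 * dd l (x, y) (0, w)"
  using homogeneous_euler[OF momentum_smooth op momentum_homogeneous] by (simp add: vertical_hessian_def)

text \<open>With \<open>y\<close> as the inner direction, Euler's relation for the momentum does not
  apply directly. Instead \<open>dd l z (0, snd z) = 2 * l z\<close> is differentiated; the motion
  of the direction \<open>snd z\<close> contributes one of the two copies of the momentum on the
  right, and half of the other remains.\<close>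

lemma hessian_self_right:
  assumes z: "(x, y) \<in> W"
  shows "vertical_hessian l (x, y) u y = 1/2 * dd l (x, y) (0, u)"
proof -
  have "((\<lambda>z. dd l z (0, snd z)) has_derivative
      (\<lambda>h. dd (\<lambda>z. dd l z (0, y)) (x, y) h + dd l (x, y) (0, snd h))) (at (x, y) within W)"
    using dd_moving[OF smooth op z, of "\<lambda>z. z" "\<lambda>h. h" "\<lambda>z. (0, snd z)" "\<lambda>h. (0, snd h)"]
    by (simp add: has_derivative_Pair has_derivative_snd)
  then have "((\<lambda>z. dd l z (0, snd z)) has_derivative
      (\<lambda>h. dd (\<lambda>z. dd l z (0, y)) (x, y) h + dd l (x, y) (0, snd h))) (at (x, y))"
    using at_within_open[OF z op] by simp
  moreover have "((\<lambda>z. dd l z (0, snd z)) has_derivative (\<lambda>h. 2 * dd l (x, y) h)) (at (x, y))"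
    by (rule has_derivative_transform_within_open[OF has_derivative_mult_right[OF
      smooth_on_open_has_derivative[OF smooth op z]] op z]) (use momentum_self in auto)
  ultimately have "(\<lambda>h. dd (\<lambda>z. dd l z (0, y)) (x, y) h + dd l (x, y) (0, snd h)) = (\<lambda>h. 2 * dd l (x, y) h)"
    by (rule has_derivative_unique)
  from fun_cong[OF this, of "(0, u)"] show ?thesis by (simp add: vertical_hessian_def)
qed

lemma hessian_linear_left: "z \<in> W \<Longrightarrow> linear (\<lambda>u. vertical_hessian l z u w)"
  unfolding vertical_hessian_def
  using linear_compose[OF _ smooth_on_open_linear[OF momentum_smooth op], of "\<lambda>u. (0, u)" z "(0, w)"]
  by (auto simp: o_def linear_iff algebra_simps)

lemma hessian_linear_right: "z \<in> W \<Longrightarrow> linear (\<lambda>w. vertical_hessian l z u w)"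
  unfolding vertical_hessian_def
  using linear_compose[OF _ dd_dd_linear[OF smooth op], of "\<lambda>u. (0, u)" z "(0, u)"]
  by (auto simp: o_def linear_iff algebra_simps)

end

text \<open>For the Lagrangian \<open>1/2 * l - f\<close> at position \<open>x\<close>, velocity
  \<open>y\<close> and acceleration \<open>a\<close>: the time derivative of the momentum minus the
  position derivative of the Lagrangian, paired with \<open>w\<close>. The potential enters the
  Lagrangian negatively, hence the plus sign of \<open>dd f\<close>.\<close>

definition euler_lagrange ::
  "('e::euclidean_space \<times> 'e \<Rightarrow> real) \<Rightarrow> ('e \<Rightarrow> real) \<Rightarrow> 'e \<Rightarrow> 'e \<Rightarrow> 'e \<Rightarrow> 'e \<Rightarrow> real" where
  "euler_lagrange l f x y a w =
     1/2 * dd (\<lambda>z. dd l z (0, w)) (x, y) (y, a) - 1/2 * dd l (x, y) (w, 0) + dd f x w"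

text \<open>The integration by parts of the first variation formula, before integrating. The
  s-derivative of the Lagrangian contains the vertical derivative along the s-derivative of the
  velocity, the t-derivative of the momentum contains it along the t-derivative of the variation
  field; \<open>mixed_partials\<close> identifies the two, and what remains is the Euler-Lagrange
  covector.\<close>

lemma momentum_derivative:
  fixes G :: "real \<times> real \<Rightarrow> 'e::euclidean_space"
  assumes l: "smooth_on W l" "open W" and f: "smooth_on V f" "open V"
    and G: "smooth_on Q G" "open Q" and sub: "G ` Q \<subseteq> V" "(\<lambda>z. (G z, dd G z (0, 1))) ` Q \<subseteq> W"
    and z: "(s, t) \<in> Q"
  defines "\<Phi> \<equiv> \<lambda>z. 1/2 * l (G z, dd G z (0, 1)) - f (G z)"
  shows "((\<lambda>t. 1/2 * dd l (G (s, t), dd G (s, t) (0, 1)) (0, dd G (s, t) (1, 0)))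
     has_vector_derivative dd \<Phi> (s, t) (1, 0) +
       euler_lagrange l f (G (s, t)) (dd G (s, t) (0, 1)) (dd (\<lambda>z. dd G z (0, 1)) (s, t) (0, 1))
          (dd G (s, t) (1, 0))) (at t)"
proof -
  let ?Gt = "\<lambda>z. dd G z (0, 1)" and ?Gs = "\<lambda>z. dd G z (1, 0)" and ?z = "(s, t)"
  have dG: "(G has_derivative dd G ?z) (at ?z)"
    by (rule smooth_on_open_has_derivative[OF G z])
  have dGt: "(?Gt has_derivative dd ?Gt ?z) (at ?z)" and dGs: "(?Gs has_derivative dd ?Gs ?z) (at ?z)"
    by (rule smooth_on_open_has_derivative[OF smooth_on_open_frechet[OF G] G(2) z])+
  have W: "(G ?z, ?Gt ?z) \<in> W" and V: "G ?z \<in> V" using sub z by auto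
  have pair: "((\<lambda>z. (G z, ?Gt z)) has_derivative (\<lambda>h. (dd G ?z h, dd ?Gt ?z h))) (at ?z)"
    by (intro has_derivative_Pair dG dGt)
  have "(\<Phi> has_derivative (\<lambda>h. 1/2 * dd l (G ?z, ?Gt ?z) (dd G ?z h, dd ?Gt ?z h) - dd f (G ?z) (dd G ?z h))) (at ?z)"
    unfolding \<Phi>_def
    by (intro has_derivative_diff has_derivative_mult_right
      has_derivative_compose[OF pair smooth_on_open_has_derivative[OF l W]]
      has_derivative_compose[OF dG smooth_on_open_has_derivative[OF f V]])
  then have Phi: "dd \<Phi> ?z (1, 0) = 1/2 * dd l (G ?z, ?Gt ?z) (?Gs ?z, dd ?Gt ?z (1, 0)) - dd f (G ?z) (?Gs ?z)"
    by (rule dd_eqI)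
  have "((\<lambda>z. 1/2 * dd l (G z, ?Gt z) (0, ?Gs z)) has_derivative
     (\<lambda>h. 1/2 * (dd (\<lambda>x. dd l x (0, ?Gs ?z)) (G ?z, ?Gt ?z) (dd G ?z h, dd ?Gt ?z h)
        + dd l (G ?z, ?Gt ?z) (0, dd ?Gs ?z h)))) (at ?z within Q)"
    by (intro has_derivative_mult_right dd_moving[OF l z sub(2)] has_derivative_Pair
      has_derivative_const has_derivative_at_withinI[OF dGs] has_derivative_at_withinI[OF pair])
  then have "((\<lambda>z. 1/2 * dd l (G z, ?Gt z) (0, ?Gs z)) has_derivative
     (\<lambda>h. 1/2 * (dd (\<lambda>x. dd l x (0, ?Gs ?z)) (G ?z, ?Gt ?z) (dd G ?z h, dd ?Gt ?z h)
        + dd l (G ?z, ?Gt ?z) (0, dd ?Gs ?z h)))) (at ?z)"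
    using at_within_open[OF z G(2)] by simp
  from has_vector_derivative_section_snd[OF this, of UNIV]
  have "((\<lambda>t. 1/2 * dd l (G (s, t), ?Gt (s, t)) (0, ?Gs (s, t))) has_vector_derivative
     1/2 * (dd (\<lambda>x. dd l x (0, ?Gs ?z)) (G ?z, ?Gt ?z) (?Gt ?z, dd ?Gt ?z (0, 1))
        + dd l (G ?z, ?Gt ?z) (0, dd ?Gs ?z (0, 1)))) (at t)"
    by simp
  moreover have "dd l (G ?z, ?Gt ?z) (?Gs ?z, dd ?Gt ?z (1, 0)) =
      dd l (G ?z, ?Gt ?z) (?Gs ?z, 0) + dd l (G ?z, ?Gt ?z) (0, dd ?Gt ?z (1, 0))"
    using linear_add[OF smooth_on_open_linear[OF l W], of "(?Gs ?z, 0)" "(0, dd ?Gt ?z (1, 0))"] by simp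
  ultimately show ?thesis
    using mixed_partials[OF G z] by (simp add: Phi euler_lagrange_def algebra_simps)
qed

section \<open>Tangent vectors in charts\<close>

abbreviation cinv :: "('a, 'e) chart \<Rightarrow> 'e \<Rightarrow> 'a" where
  "cinv c \<equiv> inv_into (fst c) (snd c)"

lemma fst_tadd [simp]: "fst (v +\<^sub>T w) = fst v"
  and snd_tadd [simp]: "snd (v +\<^sub>T w) c = snd v c + snd w c"
  and fst_tscale [simp]: "fst (r *\<^sub>T v) = fst v"
  and snd_tscale [simp]: "snd (r *\<^sub>T v) c = r *\<^sub>R snd v c"
  and snd_tzero [simp]: "snd (tzero p) c = 0"
  by (simp_all add: tadd_def tscale_def tzero_def)

lemma fst_coord_field [simp]: "fst (coord_field A c e p) = p"
  by (simp add: coord_field_def)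

locale smooth_atlas =
  fixes T :: "'a topology" and A :: "('a, 'e::euclidean_space) chart set"
  assumes manifold: "smooth_manifold T A"
begin

lemma chart_open: "c \<in> A \<Longrightarrow> openin T (fst c)"
  and chart_image_open: "c \<in> A \<Longrightarrow> open (snd c ` fst c)"
  and chart_homeomorphic: "c \<in> A \<Longrightarrow>
    homeomorphic_map (subtopology T (fst c)) (top_of_set (snd c ` fst c)) (snd c)"
  and transition_smooth: "c \<in> A \<Longrightarrow> d \<in> A \<Longrightarrow> smooth_on (snd c ` (fst c \<inter> fst d)) (transition c d)"
  and points_eq: "points A = topspace T"
  using manifold by (auto simp: smooth_manifold_def points_def)

lemma chart_subset: "c \<in> A \<Longrightarrow> fst c \<subseteq> topspace T"
  using chart_open openin_subset by blast

lemma chart_inj: "c \<in> A \<Longrightarrow> inj_on (snd c) (fst c)"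
  using homeomorphic_imp_injective_map[OF chart_homeomorphic] chart_subset
  by (metis topspace_subtopology_subset)

lemma cinv_chart: "c \<in> A \<Longrightarrow> p \<in> fst c \<Longrightarrow> cinv c (snd c p) = p"
  using chart_inj by (simp add: inv_into_f_f)

lemma chart_cinv: "x \<in> snd c ` fst c \<Longrightarrow> snd c (cinv c x) = x"
  by (rule f_inv_into_f)

lemma cinv_in: "x \<in> snd c ` fst c \<Longrightarrow> cinv c x \<in> fst c"
  by (rule inv_into_into)

lemma openin_chart_image:
  assumes "c \<in> A" "openin T W"
  shows "open (snd c ` (W \<inter> fst c))"
proof -
  have "openin (subtopology T (fst c)) (W \<inter> fst c)"
    using assms by (auto simp: openin_subtopology)
  then have "openin (top_of_set (snd c ` fst c)) (snd c ` (W \<inter> fst c))"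
    using homeomorphic_imp_open_map[OF chart_homeomorphic[OF assms(1)]] by (auto simp: open_map_def)
  then show ?thesis using chart_image_open[OF assms(1)] openin_open_trans by blast
qed

lemma openin_chart_preimage:
  assumes "c \<in> A" "open V"
  shows "openin T {p \<in> fst c. snd c p \<in> V}"
proof -
  have "continuous_map (subtopology T (fst c)) euclidean (snd c)"
    using homeomorphic_imp_continuous_map[OF chart_homeomorphic[OF assms(1)]]
    by (simp add: continuous_map_in_subtopology)
  then have "openin (subtopology T (fst c)) {p \<in> topspace (subtopology T (fst c)). snd c p \<in> V}"
    using assms(2) openin_continuous_map_preimage by fastforce
  then have "openin (subtopology T (fst c)) {p \<in> fst c. snd c p \<in> V}"
    using chart_subset[OF assms(1)] topspace_subtopology_subset by metis
  then show ?thesis using chart_open[OF assms(1)] openin_trans_full by blast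
qed

lemma openin_imp_atlas_open: "openin T W \<Longrightarrow> atlas_open A W"
  using openin_chart_image openin_subset unfolding atlas_open_def points_eq by blast

lemma overlap_open: "c \<in> A \<Longrightarrow> d \<in> A \<Longrightarrow> open (snd c ` (fst c \<inter> fst d))"
  using openin_chart_image[of c "fst d"] chart_open by (simp add: Int_commute)

lemma transition_apply: "c \<in> A \<Longrightarrow> p \<in> fst c \<Longrightarrow> transition c d (snd c p) = snd d p"
  by (simp add: transition_def cinv_chart)

lemma transition_derivative:
  assumes "c \<in> A" "d \<in> A" "p \<in> fst c" "p \<in> fst d"
  shows "(transition c d has_derivative dd (transition c d) (snd c p)) (at (snd c p))"
  using assms by (intro smooth_on_open_has_derivative[OF transition_smooth overlap_open]) auto

lemma transition_self:
  assumes "c \<in> A" "p \<in> fst c"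
  shows "dd (transition c c) (snd c p) e = e"
proof -
  have "(transition c c has_derivative (\<lambda>h. h)) (at (snd c p))"
    by (rule has_derivative_transform_within_open[OF has_derivative_ident chart_image_open[OF assms(1)]])
      (use assms transition_apply[OF assms(1), of _ c] in auto)
  then show ?thesis by (rule dd_eqI)
qed

lemma transition_chain:
  assumes A: "c \<in> A" "d \<in> A" "b \<in> A" and p: "p \<in> fst c" "p \<in> fst d" "p \<in> fst b"
  shows "dd (transition c b) (snd c p) e = dd (transition d b) (snd d p) (dd (transition c d) (snd c p) e)"
proof -
  have "((\<lambda>x. transition d b (transition c d x)) has_derivative
      (\<lambda>h. dd (transition d b) (snd d p) (dd (transition c d) (snd c p) h))) (at (snd c p))"
    by (rule has_derivative_compose[OF transition_derivative[OF A(1,2) p(1,2)]])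
      (use transition_derivative[OF A(2,3) p(2,3)] transition_apply[OF A(1) p(1)] in simp)
  then have "(transition c b has_derivative
      (\<lambda>h. dd (transition d b) (snd d p) (dd (transition c d) (snd c p) h))) (at (snd c p))"
    by (rule has_derivative_transform_within_open[OF _ overlap_open[OF A(1,2)]])
      (use p A transition_apply[OF A(1), of _ b] transition_apply[OF A(1), of _ d]
        transition_apply[OF A(2), of _ b] in auto)
  then show ?thesis by (rule dd_eqI)
qed

lemma coord_field_component: "c \<in> A \<Longrightarrow> p \<in> fst c \<Longrightarrow> snd (coord_field A c e p) c = e"
  by (simp add: coord_field_def transition_self)

lemma tangentI:
  assumes "fst v = p" "\<And>c. \<not> (c \<in> A \<and> p \<in> fst c) \<Longrightarrow> snd v c = 0"
    "\<And>c d. c \<in> A \<Longrightarrow> d \<in> A \<Longrightarrow> p \<in> fst c \<Longrightarrow> p \<in> fst d \<Longrightarrow>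
        snd v d = dd (transition c d) (snd c p) (snd v c)"
  shows "v \<in> tangent_space A p"
  using assms unfolding tangent_space_def by blast

lemma tangent_fst: "v \<in> tangent_space A p \<Longrightarrow> fst v = p"
  and tangent_outside: "v \<in> tangent_space A p \<Longrightarrow> \<not> (c \<in> A \<and> p \<in> fst c) \<Longrightarrow> snd v c = 0"
  and tangent_transition: "v \<in> tangent_space A p \<Longrightarrow> c \<in> A \<Longrightarrow> d \<in> A \<Longrightarrow>
    p \<in> fst c \<Longrightarrow> p \<in> fst d \<Longrightarrow> snd v d = dd (transition c d) (snd c p) (snd v c)"
  unfolding tangent_space_def by blast+

lemma coord_field_tangent:
  assumes "c \<in> A" "p \<in> fst c"
  shows "coord_field A c e p \<in> tangent_space A p"
proof (rule tangentI)
  show "snd (coord_field A c e p) b = dd (transition d b) (snd d p) (snd (coord_field A c e p) d)"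
    if "d \<in> A" "b \<in> A" "p \<in> fst d" "p \<in> fst b" for d b
    using transition_chain[OF assms(1) that(1,2) assms(2) that(3,4)] that by (simp add: coord_field_def)
qed (auto simp: coord_field_def)

text \<open>One component determines all others through the transition maps. Every vector is thus a
  value of a coordinate field, which reduces statements on tangent vectors to a single
  chart.\<close>

lemma tangent_eq_coord_field:
  assumes "v \<in> tangent_space A p" "c \<in> A" "p \<in> fst c"
  shows "v = coord_field A c (snd v c) p"
proof (rule prod_eqI)
  show "snd v = snd (coord_field A c (snd v c) p)"
  proof
    fix d show "snd v d = snd (coord_field A c (snd v c) p) d"
      using tangent_transition[OF assms(1,2) _ assms(3), of d] tangent_outside[OF assms(1), of d]
      by (simp add: coord_field_def)
  qed
qed (use tangent_fst[OF assms(1)] in simp)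

lemma tangent_eqI:
  assumes "v \<in> tangent_space A p" "w \<in> tangent_space A p" "c \<in> A" "p \<in> fst c" "snd v c = snd w c"
  shows "v = w"
  using tangent_eq_coord_field[OF assms(1,3,4)] tangent_eq_coord_field[OF assms(2,3,4)] assms(5) by simp

lemma transition_linear:
  assumes "c \<in> A" "d \<in> A" "p \<in> fst c" "p \<in> fst d"
  shows "linear (dd (transition c d) (snd c p))"
  using transition_derivative[OF assms] by (rule has_derivative_linear)

lemma tadd_tangent:
  "v \<in> tangent_space A p \<Longrightarrow> w \<in> tangent_space A p \<Longrightarrow> v +\<^sub>T w \<in> tangent_space A p"
  by (rule tangentI)
    (simp_all add: linear_add[OF transition_linear] tangent_fst tangent_outside
      flip: tangent_transition[of v p] tangent_transition[of w p])

lemma tscale_tangent: "v \<in> tangent_space A p \<Longrightarrow> r *\<^sub>T v \<in> tangent_space A p"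
  by (rule tangentI)
    (simp_all add: linear_scale[OF transition_linear] tangent_fst tangent_outside
      flip: tangent_transition[of v p])

lemma tangent_chart_domain: "v \<in> fst (tangent_chart A c) \<longleftrightarrow> fst v \<in> fst c \<and> v \<in> tangent_space A (fst v)"
  using tangent_fst by (fastforce simp: tangent_chart_def)

lemma snd_tangent_chart: "snd (tangent_chart A c) v = (snd c (fst v), snd v c)"
  by (simp add: tangent_chart_def)

text \<open>Smoothness on the tangent bundle is defined through this inverse. Recognising it as a
  coordinate field is what allows \<open>L\<close> and \<open>U\<close> to be expressed by
  coordinate fields in a chart.\<close>

lemma inv_tangent_chart:
  assumes c: "c \<in> A" and x: "x \<in> snd c ` fst c"
  shows "inv_into (fst (tangent_chart A c)) (snd (tangent_chart A c)) (x, y) = coord_field A c y (cinv c x)"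
proof (rule inv_into_f_eq)
  show "inj_on (snd (tangent_chart A c)) (fst (tangent_chart A c))"
  proof (rule inj_onI)
    fix v w assume *: "v \<in> fst (tangent_chart A c)" "w \<in> fst (tangent_chart A c)"
      "snd (tangent_chart A c) v = snd (tangent_chart A c) w"
    then have "fst v = fst w"
      using cinv_chart[OF c] by (metis snd_tangent_chart fst_conv tangent_chart_domain)
    then show "v = w" using * c by (auto simp: tangent_chart_domain snd_tangent_chart intro: tangent_eqI)
  qed
  show "coord_field A c y (cinv c x) \<in> fst (tangent_chart A c)"
    using cinv_in[OF x] c by (simp add: tangent_chart_domain coord_field_tangent)
  show "snd (tangent_chart A c) (coord_field A c y (cinv c x)) = (x, y)"
    using cinv_in[OF x] c x by (simp add: snd_tangent_chart coord_field_component chart_cinv)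
qed

text \<open>\<open>differential\<close> computes in a chart picked by \<open>SOME\<close>; the chain
  rule for the transition map, together with the transformation of \<open>w\<close>, carries the
  value to any chart around the point.\<close>

lemma differential_chart:
  assumes c: "c \<in> A" "p \<in> fst c" and w: "w \<in> tangent_space A p"
    and f: "((f \<circ> cinv c) has_derivative D) (at (snd c p))"
  shows "differential A f w = D (snd w c)"
proof -
  define d where "d = (SOME c. c \<in> A \<and> fst w \<in> fst c)"
  have fw: "fst w = p" using w by (rule tangent_fst)
  have d: "d \<in> A" "p \<in> fst d"
    using someI[of "\<lambda>c. c \<in> A \<and> fst w \<in> fst c" c] c fw by (auto simp: d_def)
  have "((\<lambda>x. (f \<circ> cinv c) (transition d c x)) has_derivative
      (\<lambda>h. D (dd (transition d c) (snd d p) h))) (at (snd d p))"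
    by (rule has_derivative_compose[OF transition_derivative[OF d(1) c(1) d(2) c(2)]])
      (use f transition_apply[OF d] in \<open>simp add: o_def\<close>)
  then have "((f \<circ> cinv d) has_derivative (\<lambda>h. D (dd (transition d c) (snd d p) h))) (at (snd d p))"
    by (rule has_derivative_transform_within_open[OF _ overlap_open[OF d(1) c(1)]])
      (use d c transition_apply[OF d(1), of _ c] cinv_chart[OF c(1)] cinv_chart[OF d(1)] in auto)
  then have "differential A f w = D (dd (transition d c) (snd d p) (snd w d))"
    using dd_eqI by (simp add: differential_def d_def[symmetric] Let_def flip: fw)
  then show ?thesis using tangent_transition[OF w d(1) c(1) d(2) c(2)] by simp
qed

section \<open>Coordinate fields and velocities as tangent vectors\<close>

lemma coord_field_vector_field:
  assumes c: "c \<in> A" and W: "openin T W" "W \<subseteq> fst c"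
  shows "coord_field A c e \<in> vector_fields A W"
proof -
  let ?F = "coord_field A c e"
  have "open (snd c' ` D) \<and> smooth_on (snd c' ` D) (snd d' \<circ> ?F \<circ> cinv c')"
    if c': "c' \<in> A" and d': "d' \<in> tangent_atlas A" and D: "D = W \<inter> fst c' \<inter> ?F -` fst d'" for c' d' D
  proof -
    obtain d where d: "d \<in> A" "d' = tangent_chart A d" using d' by (auto simp: tangent_atlas_def)
    have "?F q \<in> fst d' \<longleftrightarrow> q \<in> fst d" if "q \<in> W" for q
      using W(2) coord_field_tangent[OF c, of q] that by (auto simp: d(2) tangent_chart_domain)
    then have D': "D = W \<inter> fst d \<inter> fst c'" unfolding D by blast
    have op: "open (snd c' ` D)"
      unfolding D' by (intro openin_chart_image c' openin_Int W(1) chart_open d)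
    note th = thick_open[OF op]
    \<comment> \<open>Three charts meet here: \<open>c\<close> defines the field, \<open>c'\<close>
      gives the coordinates of the base point, \<open>d\<close> those of the value. The component is
      the derivative of the transition from \<open>c\<close> to \<open>d\<close>, to be taken at the
      coordinates in \<open>c\<close>, hence the inner \<open>transition c' c\<close>.\<close>
    have "smooth_on (snd c' ` D) (\<lambda>x. (transition c' d x, dd (transition c d) (transition c' c x) e))"
    proof (rule smooth_on_Pair[OF th])
      show "smooth_on (snd c' ` D) (transition c' d)"
        by (rule smooth_on_subset[OF transition_smooth[OF c' d(1)] th]) (auto simp: D')
      show "smooth_on (snd c' ` D) (\<lambda>x. dd (transition c d) (transition c' c x) e)"
      proof (rule smooth_on_compose[OF th, where f = "transition c' c"])
        show "smooth_on (snd c' ` D) (transition c' c)"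
          by (rule smooth_on_subset[OF transition_smooth[OF c' c] th]) (use D' W in auto)
        show "smooth_on (snd c ` (fst c \<inter> fst d)) (\<lambda>x. dd (transition c d) x e)"
          by (rule smooth_on_open_frechet[OF transition_smooth overlap_open]) (use c d in auto)
      qed (use D' W transition_apply[OF c', of _ c] in auto)
    qed
    moreover have "(transition c' d x, dd (transition c d) (transition c' c x) e) = (snd d' \<circ> ?F \<circ> cinv c') x"
      if "x \<in> snd c' ` D" for x
      using that D' W(2) c' c d
      by (auto simp: transition_apply cinv_chart snd_tangent_chart) (auto simp: coord_field_def)
    ultimately show ?thesis using op smooth_on_cong by (metis (no_types, lifting))
  qed
  moreover have "?F ` W \<subseteq> points (tangent_atlas A)"
    using W(2) c coord_field_tangent[OF c]
    by (auto simp: points_def tangent_atlas_def tangent_chart_domain intro!: bexI[of _ c])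
  ultimately show ?thesis
    using W coord_field_tangent[OF c] by (auto simp: vector_fields_def smooth_map_def Let_def)
qed

text \<open>One statement for curves and for variations: on an interval with h = 1 it yields
  velocities, on a strip with h = (1, 0) variation fields.\<close>

lemma curve_velocity_tangent:
  assumes \<gamma>: "smooth_into A S \<Gamma>" and S: "thick S" and z: "z \<in> S"
  shows "(\<Gamma> z, \<lambda>c. if c \<in> A \<and> \<Gamma> z \<in> fst c then frechet_derivative (snd c \<circ> \<Gamma>) (at z within S) h else 0)
    \<in> tangent_space A (\<Gamma> z)"
proof -
  have "frechet_derivative (snd d \<circ> \<Gamma>) (at z within S) h =
      dd (transition c d) (snd c (\<Gamma> z)) (frechet_derivative (snd c \<circ> \<Gamma>) (at z within S) h)"
    if cd: "c \<in> A" "d \<in> A" "\<Gamma> z \<in> fst c" "\<Gamma> z \<in> fst d" for c d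
  proof -
    define Q where "Q = S \<inter> \<Gamma> -` fst c"
    have Q: "openin (top_of_set S) Q" "smooth_on Q (snd c \<circ> \<Gamma>)"
      using \<gamma> cd by (auto simp: smooth_into_def Let_def Q_def)
    have zQ: "z \<in> Q" using z cd by (simp add: Q_def)
    have Qd: "openin (top_of_set S) (S \<inter> \<Gamma> -` fst d)"
      using \<gamma> cd by (auto simp: smooth_into_def Let_def)
    have 1: "(snd c \<circ> \<Gamma> has_derivative frechet_derivative (snd c \<circ> \<Gamma>) (at z within S)) (at z within S)"
      using smooth_on_has_derivative[OF Q(2) zQ] at_within_openin[OF Q(1) zQ] by simp
    have "((\<lambda>x. transition c d ((snd c \<circ> \<Gamma>) x)) has_derivative (\<lambda>h. dd (transition c d) (snd c (\<Gamma> z))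
      (frechet_derivative (snd c \<circ> \<Gamma>) (at z within S) h))) (at z within S)"
      by (rule has_derivative_compose[OF 1]) (use transition_derivative[OF cd] in simp)
    \<comment> \<open>The transition map expresses \<open>snd d\<close> only while \<Gamma> stays in
      the domain of \<open>c\<close>. Passing to the relatively open \<open>Q\<close> and back
      leaves the filter of the derivative unchanged.\<close>
    then have "((\<lambda>x. transition c d ((snd c \<circ> \<Gamma>) x)) has_derivative (\<lambda>h. dd (transition c d) (snd c (\<Gamma> z))
      (frechet_derivative (snd c \<circ> \<Gamma>) (at z within S) h))) (at z within Q)"
      using at_within_openin[OF Q(1) zQ] by simp
    then have "(snd d \<circ> \<Gamma> has_derivative (\<lambda>h. dd (transition c d) (snd c (\<Gamma> z))
      (frechet_derivative (snd c \<circ> \<Gamma>) (at z within S) h))) (at z within Q)"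
      by (rule has_derivative_transform[OF zQ, rotated]) (use transition_apply cd Q_def in auto)
    then have "(snd d \<circ> \<Gamma> has_derivative (\<lambda>h. dd (transition c d) (snd c (\<Gamma> z))
      (frechet_derivative (snd c \<circ> \<Gamma>) (at z within S) h))) (at z within S)"
      using at_within_openin[OF Q(1) zQ] by simp
    from thick_frechet[OF S z this] show ?thesis by simp
  qed
  note trans = this
  show ?thesis
  proof (rule tangentI, goal_cases)
    case (3 c d)
    then show ?case using trans[OF 3] by (simp only: snd_conv simp_thms if_True)
  qed auto
qed

lemma smooth_into_chart:
  assumes c: "c \<in> A" and S: "thick S" and f: "smooth_on S f" "f ` S \<subseteq> snd c ` fst c"
  shows "smooth_into A S (\<lambda>z. cinv c (f z))"
proof -
  have "openin (top_of_set S) Q \<and> smooth_on Q (snd d \<circ> (\<lambda>z. cinv c (f z)))"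
    if d: "d \<in> A" and Q: "Q = S \<inter> (\<lambda>z. cinv c (f z)) -` fst d" for d Q
  proof -
    have "Q = S \<inter> f -` (snd c ` (fst c \<inter> fst d))"
      using f(2) cinv_chart[OF c] by (fastforce simp: Q)
    then have op: "openin (top_of_set S) Q"
      using smooth_on_continuous[OF f(1)] overlap_open[OF c d] continuous_openin_preimage_gen by metis
    have th: "thick Q" by (rule thick_openin[OF S op])
    have "smooth_on Q (\<lambda>z. transition c d (f z))"
    proof (rule smooth_on_compose[OF th _ transition_smooth[OF c d]])
      show "smooth_on Q f" by (rule smooth_on_subset[OF f(1) th]) (auto simp: Q)
      show "f ` Q \<subseteq> snd c ` (fst c \<inter> fst d)"
        using f(2) cinv_chart[OF c] by (fastforce simp: Q)
    qed
    then show ?thesis using op by (simp add: transition_def o_def)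
  qed
  moreover have "cinv c (f z) \<in> points A" if "z \<in> S" for z
    using f(2) that c cinv_in[of "f z" c] by (auto simp: points_def)
  ultimately show ?thesis by (auto simp: smooth_into_def Let_def)
qed

end

section \<open>Pseudo-Finsler metrics in charts\<close>

lemma has_real_derivative_line:
  fixes f :: "'a::real_normed_vector \<Rightarrow> real"
  assumes "(f has_derivative D) (at z)"
  shows "((\<lambda>s. f (z + s *\<^sub>R h)) has_real_derivative D h) (at 0)"
proof -
  have "((\<lambda>s. z + s *\<^sub>R h) has_derivative (\<lambda>s. s *\<^sub>R h)) (at 0)"
    by (auto intro!: derivative_eq_intros)
  then have "((\<lambda>s. f (z + s *\<^sub>R h)) has_derivative (\<lambda>s. D (s *\<^sub>R h))) (at 0)"
    by (rule has_derivative_compose) (use assms in simp)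
  then show ?thesis
    by (simp add: has_field_derivative_def linear_scale[OF has_derivative_linear[OF assms]] mult_commute_abs)
qed

section \<open>Vector fields and functions constant on an open set\<close>

context smooth_atlas
begin

lemma vector_field_tangent: "X \<in> vector_fields A W \<Longrightarrow> p \<in> W \<Longrightarrow> X p \<in> tangent_space A p"
  by (simp add: vector_fields_def)

lemma vector_fields_cong:
  assumes X: "X \<in> vector_fields A W" and eq: "\<And>q. q \<in> W \<Longrightarrow> X q = Y q"
  shows "Y \<in> vector_fields A W"
proof -
  have "open (snd c ` D) \<and> smooth_on (snd c ` D) (snd d \<circ> Y \<circ> cinv c)"
    if c: "c \<in> A" "d \<in> tangent_atlas A" and D: "D = W \<inter> fst c \<inter> Y -` fst d" for c d D
  proof -
    have "D = W \<inter> fst c \<inter> X -` fst d" using eq D by auto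
    then have "open (snd c ` D)" "smooth_on (snd c ` D) (snd d \<circ> X \<circ> cinv c)"
      using X c by (auto simp: vector_fields_def smooth_map_def Let_def)
    moreover have "(snd d \<circ> X \<circ> cinv c) x = (snd d \<circ> Y \<circ> cinv c) x" if "x \<in> snd c ` D" for x
      using that eq cinv_chart[OF c(1)] by (auto simp: D)
    ultimately show ?thesis using smooth_on_cong by (metis (no_types, lifting))
  qed
  then show ?thesis using X eq by (auto simp: vector_fields_def smooth_map_def Let_def)
qed

text \<open>Constancy is asked on \<open>W\<close> only, so that the indicator function of
  \<open>W\<close> qualifies as well as a global constant.\<close>

lemma locally_constant:
  assumes W: "openin T W" and f: "\<And>q. q \<in> W \<Longrightarrow> f q = r"
  shows "smooth_fun A W f" "p \<in> W \<Longrightarrow> w \<in> tangent_space A p \<Longrightarrow> differential A f w = 0"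
proof -
  have eq: "(f \<circ> cinv c) x = r" if "c \<in> A" "x \<in> snd c ` (W \<inter> fst c)" for c x
    using that cinv_chart[OF that(1)] f by auto
  show "smooth_fun A W f"
    unfolding smooth_fun_def
  proof
    fix c assume c: "c \<in> A"
    have "smooth_on (snd c ` (W \<inter> fst c)) (\<lambda>x. r)"
      by (rule smooth_on_const[OF thick_open[OF openin_chart_image[OF c W]]])
    then show "smooth_on (snd c ` (W \<inter> fst c)) (f \<circ> cinv c)"
      using smooth_on_cong[of "snd c ` (W \<inter> fst c)" "f \<circ> cinv c" "\<lambda>x. r"] eq[OF c] by blast
  qed
  assume p: "p \<in> W" and w: "w \<in> tangent_space A p"
  obtain c where c: "c \<in> A" "p \<in> fst c"
    using p W openin_subset points_eq unfolding points_def by blast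
  have "((f \<circ> cinv c) has_derivative (\<lambda>h. 0)) (at (snd c p))"
    by (rule has_derivative_transform_within_open[OF has_derivative_const openin_chart_image[OF c(1) W]])
      (use p c(2) eq[OF c(1)] in auto)
  then show "differential A f w = 0" by (rule differential_chart[OF c w])
qed

section \<open>Locality and bilinearity of linear connections\<close>

context
  fixes W D
  assumes W: "openin T W" and D: "linear_connection A W D"
begin

lemma connection_closed:
  "X \<in> vector_fields A W \<Longrightarrow> Y \<in> vector_fields A W \<Longrightarrow> D X Y \<in> vector_fields A W"
  using D by (simp add: linear_connection_def)

lemma connection_tangent:
  "X \<in> vector_fields A W \<Longrightarrow> Y \<in> vector_fields A W \<Longrightarrow> p \<in> W \<Longrightarrow> D X Y p \<in> tangent_space A p"
  using connection_closed vector_field_tangent by blast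

lemma connection_leibniz:
  assumes "X \<in> vector_fields A W" "Y \<in> vector_fields A W" "smooth_fun A W f" "p \<in> W"
  shows "D (\<lambda>q. f q *\<^sub>T X q) Y p = f p *\<^sub>T D X Y p"
    "D X (\<lambda>q. f q *\<^sub>T Y q) p = differential A f (X p) *\<^sub>T Y p +\<^sub>T f p *\<^sub>T D X Y p"
  using D assms unfolding linear_connection_def by blast+

lemma connection_add:
  assumes "X \<in> vector_fields A W" "Y \<in> vector_fields A W" "Z \<in> vector_fields A W" "p \<in> W"
  shows "D (\<lambda>q. X q +\<^sub>T Z q) Y p = D X Y p +\<^sub>T D Z Y p"
    "D X (\<lambda>q. Y q +\<^sub>T Z q) p = D X Y p +\<^sub>T D X Z p"
  using D assms unfolding linear_connection_def by blast+

lemma connection_scale_left: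
  assumes X: "X \<in> vector_fields A W" "Y \<in> vector_fields A W" and f: "\<And>q. q \<in> W \<Longrightarrow> f q = r" and p: "p \<in> W"
  shows "D (\<lambda>q. f q *\<^sub>T X q) Y p = r *\<^sub>T D X Y p"
  using connection_leibniz(1)[OF X locally_constant(1)[OF W f] p] f[OF p] by simp

lemma connection_scale_right:
  assumes X: "X \<in> vector_fields A W" "Y \<in> vector_fields A W" and f: "\<And>q. q \<in> W \<Longrightarrow> f q = r" and p: "p \<in> W"
  shows "D X (\<lambda>q. f q *\<^sub>T Y q) p = r *\<^sub>T D X Y p"
proof -
  have "D X (\<lambda>q. f q *\<^sub>T Y q) p = differential A f (X p) *\<^sub>T Y p +\<^sub>T f p *\<^sub>T D X Y p"
    by (rule connection_leibniz(2)[OF X locally_constant(1)[OF W f] p])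
  also have "differential A f (X p) = 0"
    by (rule locally_constant(2)[OF W f p vector_field_tangent[OF X(1) p]])
  finally show ?thesis
    using tangent_fst[OF vector_field_tangent[OF X(2) p]] tangent_fst[OF connection_tangent[OF X p]] f[OF p]
    by (simp add: tadd_def tscale_def)
qed

text \<open>Fields that agree on \<open>W\<close> may differ outside, where \<open>D\<close> could see them; multiplying by the
  indicator function of \<open>W\<close> removes the difference.\<close>

lemma connection_local:
  assumes X: "X \<in> vector_fields A W" "X' \<in> vector_fields A W" and Y: "Y \<in> vector_fields A W" "Y' \<in> vector_fields A W"
    and XX: "\<And>q. q \<in> W \<Longrightarrow> X q = X' q" "\<And>q. fst (X q) = fst (X' q)"
    and YY: "\<And>q. q \<in> W \<Longrightarrow> Y q = Y' q" "\<And>q. fst (Y q) = fst (Y' q)" and p: "p \<in> W"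
  shows "D X Y p = D X' Y' p"
proof -
  define f where "f = (\<lambda>q. if q \<in> W then 1 else 0 :: real)"
  have f: "f q = 1" if "q \<in> W" for q using that by (simp add: f_def)
  have eq: "(\<lambda>q. f q *\<^sub>T X q) = (\<lambda>q. f q *\<^sub>T X' q)" "(\<lambda>q. f q *\<^sub>T Y q) = (\<lambda>q. f q *\<^sub>T Y' q)"
    using XX YY by (auto simp: f_def tscale_def fun_eq_iff)
  have one: "1 *\<^sub>T v = v" for v :: "('a, 'e) tangent" by (simp add: tscale_def)
  have "D X Y p = D X (\<lambda>q. f q *\<^sub>T Y q) p"
    using connection_scale_right[OF X(1) Y(1) f p] by (simp add: one)
  also have "\<dots> = D X Y' p"
    unfolding eq using connection_scale_right[OF X(1) Y(2) f p] by (simp add: one)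
  also have "\<dots> = D (\<lambda>q. f q *\<^sub>T X q) Y' p"
    using connection_scale_left[OF X(1) Y(2) f p] by (simp add: one)
  also have "\<dots> = D X' Y' p"
    unfolding eq using connection_scale_left[OF X(2) Y(2) f p] by (simp add: one)
  finally show ?thesis .
qed

lemma coord_field_add:
  assumes "c \<in> A" "p \<in> fst c"
  shows "coord_field A c (a + b) p = coord_field A c a p +\<^sub>T coord_field A c b p"
  using assms by (intro tangent_eqI[of _ p _ c]) (auto intro!: coord_field_tangent tadd_tangent simp: coord_field_component)

lemma coord_field_scale:
  assumes "c \<in> A" "p \<in> fst c"
  shows "coord_field A c (r *\<^sub>R a) p = r *\<^sub>T coord_field A c a p"
  using assms by (intro tangent_eqI[of _ p _ c]) (auto intro!: coord_field_tangent tscale_tangent simp: coord_field_component)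

text \<open>Outside the chart a coordinate field is built from meaningless derivatives of transition
  maps, which need not be linear in the coefficient vector. The linear relations between the fields
  are known on \<open>W\<close> only, and \<open>connection_local\<close> makes this sufficient.
  With constant factors the Leibniz rule turns into homogeneity in the second argument.\<close>

lemma connection_coord_bilinear:
  assumes c: "c \<in> A" "W \<subseteq> fst c" and p: "p \<in> W"
  shows "bilinear (\<lambda>a b. snd (D (coord_field A c a) (coord_field A c b) p) c)"
proof -
  note vf = coord_field_vector_field[OF c(1) W c(2)]
  have add: "coord_field A c (a + b) q = coord_field A c a q +\<^sub>T coord_field A c b q" if "q \<in> W" for a b q
    using coord_field_add c that by blast
  have sc: "coord_field A c (r *\<^sub>R a) q = r *\<^sub>T coord_field A c a q" if "q \<in> W" for r a q
    using coord_field_scale c that by blast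
  have vf_add: "(\<lambda>q. coord_field A c a q +\<^sub>T coord_field A c b q) \<in> vector_fields A W" for a b
    by (rule vector_fields_cong[OF vf add])
  have vf_sc: "(\<lambda>q. r *\<^sub>T coord_field A c a q) \<in> vector_fields A W" for r a
    by (rule vector_fields_cong[OF vf sc])
  have 1: "D (coord_field A c (a + b)) (coord_field A c e) p =
      D (coord_field A c a) (coord_field A c e) p +\<^sub>T D (coord_field A c b) (coord_field A c e) p" for a b e
  proof -
    have "D (coord_field A c (a + b)) (coord_field A c e) p =
        D (\<lambda>q. coord_field A c a q +\<^sub>T coord_field A c b q) (coord_field A c e) p"
      by (rule connection_local[OF vf vf_add vf vf add _ _ _ p]) simp_all
    then show ?thesis using connection_add(1)[OF vf vf vf p] by simp
  qed
  have 2: "D (coord_field A c e) (coord_field A c (a + b)) p =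
      D (coord_field A c e) (coord_field A c a) p +\<^sub>T D (coord_field A c e) (coord_field A c b) p" for a b e
  proof -
    have "D (coord_field A c e) (coord_field A c (a + b)) p =
        D (coord_field A c e) (\<lambda>q. coord_field A c a q +\<^sub>T coord_field A c b q) p"
      by (rule connection_local[OF vf vf vf vf_add _ _ add _ p]) simp_all
    then show ?thesis using connection_add(2)[OF vf vf vf p] by simp
  qed
  have 3: "D (coord_field A c (r *\<^sub>R a)) (coord_field A c e) p =
      r *\<^sub>T D (coord_field A c a) (coord_field A c e) p" for r a e
  proof -
    have "D (coord_field A c (r *\<^sub>R a)) (coord_field A c e) p =
        D (\<lambda>q. r *\<^sub>T coord_field A c a q) (coord_field A c e) p"
      by (rule connection_local[OF vf vf_sc vf vf sc _ _ _ p]) simp_all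
    then show ?thesis using connection_scale_left[OF vf vf _ p, of "\<lambda>_. r"] by simp
  qed
  have 4: "D (coord_field A c e) (coord_field A c (r *\<^sub>R a)) p =
      r *\<^sub>T D (coord_field A c e) (coord_field A c a) p" for r a e
  proof -
    have "D (coord_field A c e) (coord_field A c (r *\<^sub>R a)) p =
        D (coord_field A c e) (\<lambda>q. r *\<^sub>T coord_field A c a q) p"
      by (rule connection_local[OF vf vf vf vf_sc _ _ sc _ p]) simp_all
    then show ?thesis using connection_scale_right[OF vf vf _ p, of "\<lambda>_. r"] by simp
  qed
  show ?thesis
    by (simp add: bilinear_def linear_iff 1 2 3 4)
qed

end

end

locale finsler = smooth_atlas T A
  for T :: "'a topology" and A :: "('a, 'e::euclidean_space) chart set" +
  fixes U :: "('a, 'e) tangent set" and L :: "('a, 'e) tangent \<Rightarrow> real"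
  assumes finsler: "conic_pseudo_finsler A U L"
begin

text \<open>The image of \<open>U\<close> under the tangent chart, written through the inverse chart
  so that membership unfolds to a statement on one vector; \<open>chart_cone_eq\<close> provides the
  other description.\<close>

definition chart_cone :: "('a, 'e) chart \<Rightarrow> ('e \<times> 'e) set" where
  "chart_cone c = {z. fst z \<in> snd c ` fst c \<and> coord_field A c (snd z) (cinv c (fst z)) \<in> U}"

definition lag :: "('a, 'e) chart \<Rightarrow> 'e \<times> 'e \<Rightarrow> real" where
  "lag c z = L (coord_field A c (snd z) (cinv c (fst z)))"

lemma domain_tangent: "v \<in> U \<Longrightarrow> v \<in> tangent_space A (fst v)"
  and domain_points: "v \<in> U \<Longrightarrow> \<exists>c\<in>A. fst v \<in> fst c"
proof -
  assume "v \<in> U"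
  then have "v \<in> points (tangent_atlas A)"
    using finsler unfolding conic_pseudo_finsler_def conic_domain_def atlas_open_def by blast
  then have "v \<in> tangent_space A (fst v) \<and> (\<exists>c\<in>A. fst v \<in> fst c)"
    by (simp only: points_def tangent_atlas_def UN_simps UN_iff tangent_chart_domain) blast
  then show "v \<in> tangent_space A (fst v)" "\<exists>c\<in>A. fst v \<in> fst c" by blast+
qed

lemma chart_cone_eq:
  assumes "c \<in> A"
  shows "chart_cone c = snd (tangent_chart A c) ` (U \<inter> fst (tangent_chart A c))"
proof
  show "chart_cone c \<subseteq> snd (tangent_chart A c) ` (U \<inter> fst (tangent_chart A c))"
  proof
    fix z assume z: "z \<in> chart_cone c"
    let ?v = "coord_field A c (snd z) (cinv c (fst z))"
    have "?v \<in> U \<inter> fst (tangent_chart A c)"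
      using z assms cinv_in[of "fst z" c] by (auto simp: chart_cone_def tangent_chart_domain coord_field_tangent)
    moreover have "snd (tangent_chart A c) ?v = z"
      using z assms cinv_in[of "fst z" c] chart_cinv[of "fst z" c]
      by (auto simp: chart_cone_def snd_tangent_chart coord_field_component)
    ultimately show "z \<in> snd (tangent_chart A c) ` (U \<inter> fst (tangent_chart A c))"
      by (metis image_eqI)
  qed
  show "snd (tangent_chart A c) ` (U \<inter> fst (tangent_chart A c)) \<subseteq> chart_cone c"
  proof
    fix z assume "z \<in> snd (tangent_chart A c) ` (U \<inter> fst (tangent_chart A c))"
    then obtain v where v: "v \<in> U" "fst v \<in> fst c" "v \<in> tangent_space A (fst v)" "z = (snd c (fst v), snd v c)"
      by (auto simp: tangent_chart_domain snd_tangent_chart)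
    then show "z \<in> chart_cone c"
      using tangent_eq_coord_field[OF v(3) assms v(2)] cinv_chart[OF assms v(2)] by (auto simp: chart_cone_def)
  qed
qed

lemma chart_cone_open: "c \<in> A \<Longrightarrow> open (chart_cone c)"
  using finsler
  by (auto simp: chart_cone_eq conic_pseudo_finsler_def conic_domain_def atlas_open_def tangent_atlas_def)

lemma lag_smooth:
  assumes c: "c \<in> A"
  shows "smooth_on (chart_cone c) (lag c)"
proof -
  have "smooth_on (chart_cone c) (L \<circ> inv_into (fst (tangent_chart A c)) (snd (tangent_chart A c)))"
    using finsler c by (auto simp: chart_cone_eq conic_pseudo_finsler_def smooth_fun_def tangent_atlas_def)
  moreover have "(L \<circ> inv_into (fst (tangent_chart A c)) (snd (tangent_chart A c))) z = lag c z"
    if "z \<in> chart_cone c" for z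
    using that inv_tangent_chart[OF c, of "fst z" "snd z"] by (simp add: lag_def chart_cone_def)
  ultimately show ?thesis using smooth_on_cong by (metis (no_types, lifting))
qed

lemma quadratic_lagrangian_lag:
  assumes c: "c \<in> A"
  shows "quadratic_lagrangian (chart_cone c) (lag c)"
proof
  fix x y :: 'e and r :: real
  assume z: "(x, y) \<in> chart_cone c" and r: "r > 0"
  have eq: "coord_field A c (r *\<^sub>R y) (cinv c x) = r *\<^sub>T coord_field A c y (cinv c x)"
    using z cinv_in[of x c] c by (auto simp: chart_cone_def intro!: tangent_eqI[of _ "cinv c x" _ c]
      coord_field_tangent tscale_tangent simp: coord_field_component)
  have v: "coord_field A c y (cinv c x) \<in> U" using z by (simp add: chart_cone_def)
  show "(x, r *\<^sub>R y) \<in> chart_cone c"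
    using z r v finsler by (simp add: chart_cone_def eq conic_pseudo_finsler_def conic_domain_def)
  show "lag c (x, r *\<^sub>R y) = r\<^sup>2 * lag c (x, y)"
    using r v finsler by (simp add: lag_def eq conic_pseudo_finsler_def)
qed (use lag_smooth chart_cone_open c in auto)

lemma chart_cone_vector: "v \<in> U \<Longrightarrow> c \<in> A \<Longrightarrow> fst v \<in> fst c \<Longrightarrow> (snd c (fst v), snd v c) \<in> chart_cone c"
  by (auto simp: chart_cone_eq tangent_chart_domain snd_tangent_chart domain_tangent intro!: image_eqI[of _ _ v])

lemma lag_vector:
  "v \<in> tangent_space A (fst v) \<Longrightarrow> c \<in> A \<Longrightarrow> fst v \<in> fst c \<Longrightarrow> L v = lag c (snd c (fst v), snd v c)"
  using tangent_eq_coord_field[of v "fst v" c] cinv_chart by (simp add: lag_def)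

lemma momentum_chart:
  assumes v: "v \<in> tangent_space A (fst v)" and c: "c \<in> A" "fst v \<in> fst c"
    and t: "(snd c (fst v), snd v c) \<in> chart_cone c" and w: "w \<in> tangent_space A (fst v)"
  shows "((\<lambda>s. L (v +\<^sub>T s *\<^sub>T w)) has_real_derivative dd (lag c) (snd c (fst v), snd v c) (0, snd w c)) (at 0)"
proof -
  have "L (v +\<^sub>T s *\<^sub>T w) = lag c ((snd c (fst v), snd v c) + s *\<^sub>R (0, snd w c))" for s
    using lag_vector[of "v +\<^sub>T s *\<^sub>T w" c] c v w by (simp add: tadd_tangent tscale_tangent)
  then show ?thesis
    using has_real_derivative_line[OF smooth_on_open_has_derivative[OF lag_smooth chart_cone_open t],
        of "(0, snd w c)"] c by simp
qed

lemma fundamental_tensor_chart: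
  assumes v: "v \<in> tangent_space A (fst v)" and c: "c \<in> A" "fst v \<in> fst c"
    and t: "(snd c (fst v), snd v c) \<in> chart_cone c"
    and u: "u \<in> tangent_space A (fst v)" and w: "w \<in> tangent_space A (fst v)"
  shows "fundamental_tensor L v u w =
    vertical_hessian (lag c) (snd c (fst v), snd v c) (snd u c) (snd w c)"
proof -
  let ?z = "\<lambda>s. (snd c (fst v), snd v c) + s *\<^sub>R (0, snd u c)"
  let ?m = "\<lambda>z. dd (lag c) z (0, snd w c)"
  \<comment> \<open>The inner \<open>deriv\<close> has to be known for all s near 0 before the outer
    one can be taken; openness of the cone supplies these s.\<close>
  have "\<forall>\<^sub>F s in nhds 0. ?z s \<in> chart_cone c"
  proof -
    have "(?z \<longlongrightarrow> ?z 0) (nhds 0)" by (intro tendsto_intros filterlim_ident)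
    then show ?thesis using topological_tendstoD[OF _ chart_cone_open[OF c(1)]] t by simp
  qed
  then have "\<forall>\<^sub>F s in nhds 0. deriv (\<lambda>r. L (v +\<^sub>T s *\<^sub>T u +\<^sub>T r *\<^sub>T w)) 0 = ?m (?z s)"
  proof (rule eventually_mono)
    fix s assume "?z s \<in> chart_cone c"
    then show "deriv (\<lambda>r. L (v +\<^sub>T s *\<^sub>T u +\<^sub>T r *\<^sub>T w)) 0 = ?m (?z s)"
      using DERIV_imp_deriv[OF momentum_chart[of "v +\<^sub>T s *\<^sub>T u" c w]] v u w c
      by (simp add: tadd_tangent tscale_tangent)
  qed
  then have "deriv (\<lambda>s. deriv (\<lambda>r. L (v +\<^sub>T s *\<^sub>T u +\<^sub>T r *\<^sub>T w)) 0) 0 = deriv (\<lambda>s. ?m (?z s)) 0"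
    by (rule deriv_cong_ev) simp
  also have "\<dots> = dd ?m (snd c (fst v), snd v c) (0, snd u c)"
    by (intro DERIV_imp_deriv has_real_derivative_line smooth_on_open_has_derivative[OF _ chart_cone_open t]
      smooth_on_open_frechet lag_smooth chart_cone_open c)
  finally show ?thesis by (simp add: fundamental_tensor_def vertical_hessian_def)
qed

text \<open>Along \<open>v\<close> the reference vector moves on its own ray,
  \<open>v + s v = (1 + s) v\<close>, which stays in the cone for s > -1; there the fundamental
  tensor is constant.\<close>

lemma cartan_self:
  assumes v: "v \<in> U" and u: "u \<in> tangent_space A (fst v)" and w: "w \<in> tangent_space A (fst v)"
  shows "cartan_tensor L v v u w = 0"
proof -
  obtain c where c: "c \<in> A" "fst v \<in> fst c" using domain_points[OF v] by blast
  interpret quadratic_lagrangian "chart_cone c" "lag c" by (rule quadratic_lagrangian_lag[OF c(1)])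
  note vt = domain_tangent[OF v]
  note t = chart_cone_vector[OF v c]
  have "fundamental_tensor L (v +\<^sub>T s *\<^sub>T v) u w = fundamental_tensor L v u w" if "s > -1" for s
  proof -
    have s: "snd v c + s *\<^sub>R snd v c = (1 + s) *\<^sub>R snd v c" by (simp add: scaleR_add_left)
    have t': "(snd c (fst v), (1 + s) *\<^sub>R snd v c) \<in> chart_cone c" using cone[OF t] that by simp
    show ?thesis
      using fundamental_tensor_chart[of "v +\<^sub>T s *\<^sub>T v" c u w] fundamental_tensor_chart[OF vt c t u w]
        vt c u w s t' hessian_homogeneous[OF t, of "1 + s"] that
      by (simp add: tadd_tangent tscale_tangent)
  qed
  moreover have "\<forall>\<^sub>F s in nhds (0::real). s \<in> {-1<..}"
    by (rule eventually_nhds_in_open) auto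
  ultimately have "\<forall>\<^sub>F s in nhds 0. fundamental_tensor L (v +\<^sub>T s *\<^sub>T v) u w = fundamental_tensor L v u w"
    by (auto elim: eventually_mono)
  then have "deriv (\<lambda>s. fundamental_tensor L (v +\<^sub>T s *\<^sub>T v) u w) 0 = deriv (\<lambda>s. fundamental_tensor L v u w) 0"
    by (rule deriv_cong_ev) simp
  then show ?thesis by (simp add: cartan_tensor_def)
qed

lemma hessian_nondegenerate:
  assumes v: "v \<in> U" and c: "c \<in> A" "fst v \<in> fst c"
    and a: "\<And>b. vertical_hessian (lag c) (snd c (fst v), snd v c) a b = 0"
  shows "a = 0"
proof -
  let ?u = "coord_field A c a (fst v)"
  have u: "?u \<in> tangent_space A (fst v)" by (rule coord_field_tangent[OF c])
  have "fundamental_tensor L v ?u w = 0" if "w \<in> tangent_space A (fst v)" for w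
    using fundamental_tensor_chart[OF domain_tangent[OF v] c chart_cone_vector[OF v c] u that] a by (simp add: coord_field_component c)
  then have "?u = tzero (fst v)"
    using finsler v u unfolding conic_pseudo_finsler_def by blast
  then have "snd ?u c = 0" by simp
  then show ?thesis by (simp add: coord_field_component c)
qed

end

section \<open>The Chern connection in charts\<close>

locale chern = finsler T A U L
  for T :: "'a topology" and A :: "('a, 'e::euclidean_space) chart set" and U L +
  fixes nab :: "('a, 'e) connection"
  assumes chern: "chern_connection A U L nab"
begin

text \<open>The Christoffel symbols as an index-free bilinear form on the model space;
  \<open>z\<close> holds the point and the reference vector.\<close>

definition gam :: "('a, 'e) chart \<Rightarrow> 'e \<times> 'e \<Rightarrow> 'e \<Rightarrow> 'e \<Rightarrow> 'e" where
  "gam c z a b = snd (nab (coord_field A c (snd z) (cinv c (fst z)))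
     (coord_field A c a) (coord_field A c b)) c"

text \<open>The connection axioms require a reference field with values in \<open>U\<close> on its
  whole domain. This is the largest part of the chart on which the field with constant coefficients
  \<open>y\<close> satisfies that.\<close>

definition slice :: "('a, 'e) chart \<Rightarrow> 'e \<Rightarrow> 'a set" where
  "slice c y = {q \<in> fst c. snd c q \<in> {x. (x, y) \<in> chart_cone c}}"

lemma slice_open: "c \<in> A \<Longrightarrow> openin T (slice c y)"
  unfolding slice_def
proof (rule openin_chart_preimage)
  assume c: "c \<in> A"
  have "open ((\<lambda>x. (x, y)) -` chart_cone c)"
    by (intro open_vimage chart_cone_open[OF c] continuous_intros)
  then show "open {x. (x, y) \<in> chart_cone c}" by (simp add: vimage_def)
qed

lemma slice_vector:
  assumes "c \<in> A" "q \<in> slice c y"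
  shows "coord_field A c y q \<in> U"
  using assms(2) cinv_chart[OF assms(1), of q] by (simp add: slice_def chart_cone_def)

lemma slice_connection:
  assumes c: "c \<in> A"
  shows "linear_connection A (slice c y) (\<lambda>X Y p. nab (coord_field A c y p) X Y)"
proof -
  have "coord_field A c y \<in> vector_fields A (slice c y)"
    by (rule coord_field_vector_field[OF c slice_open[OF c]]) (auto simp: slice_def)
  moreover have "coord_field A c y ` slice c y \<subseteq> U" using slice_vector[OF c] by blast
  ultimately show ?thesis
    using chern openin_imp_atlas_open[OF slice_open[OF c]]
    unfolding chern_connection_def anisotropic_connection_def by blast
qed

lemma slice_point:
  assumes "c \<in> A" "(x, y) \<in> chart_cone c"
  shows "cinv c x \<in> slice c y" "cinv c x \<in> fst c" "snd c (cinv c x) = x"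
  using assms cinv_in[of x c] chart_cinv[of x c] by (auto simp: slice_def chart_cone_def)

lemma gam_bilinear:
  assumes c: "c \<in> A" and z: "(x, y) \<in> chart_cone c"
  shows "bilinear (gam c (x, y))"
  using connection_coord_bilinear[OF slice_open[OF c] slice_connection[OF c] c _ slice_point(1)[OF c z]]
  by (simp add: gam_def[abs_def] slice_def)

text \<open>Fields with constant coefficients commute: both terms of the bracket differentiate
  constants.\<close>

lemma gam_symmetric:
  assumes c: "c \<in> A" and z: "(x, y) \<in> chart_cone c"
  shows "gam c (x, y) a b = gam c (x, y) b a"
proof -
  let ?p = "cinv c x"
  note sp = slice_point[OF c z]
  let ?v = "coord_field A c y ?p"
  have const: "dd (field_rep c (coord_field A c e)) x h = 0" for e h
  proof -
    have "(field_rep c (coord_field A c e) has_derivative (\<lambda>h. 0)) (at x)"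
      by (rule has_derivative_transform_within_open[OF has_derivative_const[of e] chart_image_open[OF c]])
        (use z cinv_chart[OF c] coord_field_component[OF c] in \<open>auto simp: field_rep_def chart_cone_def\<close>)
    then show ?thesis by (rule dd_eqI)
  qed
  have v: "?v \<in> U" by (rule slice_vector[OF c sp(1)])
  have vf: "coord_field A c e \<in> vector_fields A (slice c y)" for e
    by (rule coord_field_vector_field[OF c slice_open[OF c]]) (auto simp: slice_def)
  have "nab ?v (coord_field A c a) (coord_field A c b) +\<^sub>T (-1) *\<^sub>T nab ?v (coord_field A c b) (coord_field A c a)
      = lie_bracket A (coord_field A c a) (coord_field A c b) (fst ?v)"
    using chern openin_imp_atlas_open[OF slice_open[OF c]] vf v sp(1)
    unfolding chern_connection_def torsion_free_def fst_coord_field by (metis fst_coord_field)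
  from arg_cong[OF this, of "\<lambda>w. snd w c"] show ?thesis
    using c sp by (simp add: lie_bracket_def const gam_def)
qed

text \<open>Write G for \<open>gam c (x, y)\<close> and H for the Hessian. Compatibility
  differentiated along V on the pair (V, Z) gives H(G(y, y), w) + H(y, G(y, w)); along Z on the pair
  (V, V) it gives H(G(w, y), y) + H(y, G(w, y)), which is twice the unwanted term H(y, G(y, w)).
  Half of the second relation is subtracted from the first. In both, V is the first argument of the
  Cartan tensor.\<close>

lemma gam_spray:
  assumes c: "c \<in> A" and z: "(x, y) \<in> chart_cone c"
  shows "vertical_hessian (lag c) (x, y) (gam c (x, y) y y) w =
    1/2 * dd (\<lambda>z. dd (lag c) z (0, w)) (x, y) (y, 0) - 1/2 * dd (lag c) (x, y) (w, 0)"
proof -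
  interpret quadratic_lagrangian "chart_cone c" "lag c" by (rule quadratic_lagrangian_lag[OF c])
  let ?p = "cinv c x"
  let ?H = "vertical_hessian (lag c) (x, y)"
  define V where "V = coord_field A c y"
  define Z where "Z = coord_field A c w"
  note sp = slice_point[OF c z]
  have Vc: "snd (V q) c = y" and Zc: "snd (Z q) c = w" and tan: "V q \<in> tangent_space A q" "Z q \<in> tangent_space A q"
    if "q \<in> fst c" for q
    using coord_field_component[OF c that] coord_field_tangent[OF c that] by (auto simp: V_def Z_def)
  have fstV [simp]: "fst (V q) = q" for q by (simp add: V_def)
  have vf: "V \<in> vector_fields A (slice c y)" "Z \<in> vector_fields A (slice c y)"
    unfolding V_def Z_def
    by (rule coord_field_vector_field[OF c slice_open[OF c]], simp add: slice_def subset_iff)+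
  have VU: "V ` slice c y \<subseteq> U" "V ?p \<in> U" using slice_vector[OF c] sp by (auto simp: V_def)
  have nabt: "nab (V ?p) X Y \<in> tangent_space A ?p"
    if "X \<in> vector_fields A (slice c y)" "Y \<in> vector_fields A (slice c y)" for X Y
    using connection_tangent[OF slice_open[OF c] slice_connection[OF c] that sp(1)] by (simp add: V_def)
  have g: "fundamental_tensor L (V q) a b = vertical_hessian (lag c) (snd c q, y) (snd a c) (snd b c)"
    if q: "q \<in> slice c y" and ab: "a \<in> tangent_space A q" "b \<in> tangent_space A q" for q a b
  proof -
    have qc: "q \<in> fst c" "(snd c q, y) \<in> chart_cone c" using q by (auto simp: slice_def)
    then show ?thesis
      using fundamental_tensor_chart[of "V q" c a b] tan[OF qc(1)] ab c by (simp add: Vc)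
  qed
  have comp: "differential A (\<lambda>q. fundamental_tensor L (V q) (Y q) (Y' q)) (X ?p) =
      fundamental_tensor L (V ?p) (nab (V ?p) X Y) (Y' ?p) + fundamental_tensor L (V ?p) (Y ?p) (nab (V ?p) X Y')
       + 2 * cartan_tensor L (V ?p) (Y ?p) (Y' ?p) (nab (V ?p) X V)"
    if "X \<in> vector_fields A (slice c y)" "Y \<in> vector_fields A (slice c y)" "Y' \<in> vector_fields A (slice c y)" for X Y Y'
    using chern openin_imp_atlas_open[OF slice_open[OF c]] vf(1) VU(1) that sp(1)
    unfolding chern_connection_def metric_compatible_def by blast
  have op: "open {x. (x, y) \<in> chart_cone c}"
  proof -
    have "open ((\<lambda>x. (x, y)) -` chart_cone c)" by (intro open_vimage op continuous_intros)
    then show ?thesis by (simp add: vimage_def)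
  qed
  have inslice: "cinv c x' \<in> slice c y" "snd c (cinv c x') = x'" "cinv c x' \<in> fst c" if "(x', y) \<in> chart_cone c" for x'
    using slice_point[OF c that] by auto
  have pair: "((\<lambda>x. (x, y)) has_derivative (\<lambda>h. (h, 0))) (at x)"
    by (rule has_derivative_Pair[OF has_derivative_ident has_derivative_const])

  \<comment> \<open>Euler's relations make the differentiated functions explicit: g(V, Z) is half
    the momentum in direction \<open>w\<close>, and g(V, V) is \<open>lag c\<close> itself. As
    \<open>y\<close> is fixed on the slice, only horizontal derivatives appear.\<close>
  have d1: "differential A (\<lambda>q. fundamental_tensor L (V q) (V q) (Z q)) (V ?p) =
      1/2 * dd (\<lambda>z. dd (lag c) z (0, w)) (x, y) (y, 0)"
  proof -
    have "((\<lambda>x'. 1/2 * dd (lag c) (x', y) (0, w)) has_derivative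
        (\<lambda>h. 1/2 * dd (\<lambda>z. dd (lag c) z (0, w)) (x, y) (h, 0))) (at x)"
      by (intro has_derivative_mult_right has_derivative_compose[OF pair
        smooth_on_open_has_derivative[OF momentum_smooth chart_cone_open[OF c] z]])
    then have "(((\<lambda>q. fundamental_tensor L (V q) (V q) (Z q)) \<circ> cinv c) has_derivative
        (\<lambda>h. 1/2 * dd (\<lambda>z. dd (lag c) z (0, w)) (x, y) (h, 0))) (at (snd c ?p))"
      unfolding sp(3)
      by (rule has_derivative_transform_within_open[OF _ op])
        (use z inslice in \<open>auto simp: g tan Vc Zc hessian_self_left\<close>)
    from differential_chart[OF c sp(2) tan(1)[OF sp(2)] this] show ?thesis by (simp add: Vc sp)
  qed
  have d2: "differential A (\<lambda>q. fundamental_tensor L (V q) (V q) (V q)) (Z ?p) = dd (lag c) (x, y) (w, 0)"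
  proof -
    have "((\<lambda>x'. lag c (x', y)) has_derivative (\<lambda>h. dd (lag c) (x, y) (h, 0))) (at x)"
      by (rule has_derivative_compose[OF pair smooth_on_open_has_derivative[OF smooth chart_cone_open[OF c] z]])
    then have "(((\<lambda>q. fundamental_tensor L (V q) (V q) (V q)) \<circ> cinv c) has_derivative
        (\<lambda>h. dd (lag c) (x, y) (h, 0))) (at (snd c ?p))"
      unfolding sp(3)
      by (rule has_derivative_transform_within_open[OF _ op])
        (use z inslice in \<open>auto simp: g tan Vc hessian_self_left momentum_self\<close>)
    from differential_chart[OF c sp(2) tan(2)[OF sp(2)] this] show ?thesis by (simp add: Zc sp)
  qed
  have gam: "snd (nab (V ?p) (coord_field A c a) (coord_field A c b)) c = gam c (x, y) a b" for a b
    by (simp add: gam_def V_def)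
  have c0: "cartan_tensor L (V ?p) (V ?p) a b = 0"
    if "a \<in> tangent_space A ?p" "b \<in> tangent_space A ?p" for a b
    using cartan_self[OF VU(2)] that by simp
  have e1: "1/2 * dd (\<lambda>z. dd (lag c) z (0, w)) (x, y) (y, 0) =
      ?H (gam c (x, y) y y) w + ?H y (gam c (x, y) y w)"
    using comp[OF vf(1) vf(1) vf(2)] nabt[OF vf(1) vf(1)] nabt[OF vf(1) vf(2)] tan[OF sp(2)] sp
      gam[of y y] gam[of y w]
    by (simp add: d1 g c0 Vc Zc flip: V_def Z_def)
  have e2: "dd (lag c) (x, y) (w, 0) = ?H (gam c (x, y) w y) y + ?H y (gam c (x, y) w y)"
    using comp[OF vf(2) vf(1) vf(1)] nabt[OF vf(2) vf(1)] tan[OF sp(2)] sp nabt[OF vf(1) vf(1)]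
      gam[of w y]
    by (simp add: d2 g c0 Vc Zc flip: V_def Z_def)
  \<comment> \<open>Symmetry of the Hessian when one argument is \<open>y\<close>: either order
    gives half the momentum.\<close>
  have "?H (gam c (x, y) w y) y = ?H y (gam c (x, y) w y)"
    using z by (simp add: hessian_self_left hessian_self_right)
  then show ?thesis using e1 e2 gam_symmetric[OF c z, of y w] by (simp add: field_simps)
qed

end

context finsler
begin

section \<open>The gradient of the potential\<close>

context
  fixes \<phi> :: "'a \<Rightarrow> real"
  assumes \<phi>: "smooth_fun A (points A) \<phi>"
begin

lemma potential_smooth: "c \<in> A \<Longrightarrow> smooth_on (snd c ` fst c) (\<phi> \<circ> cinv c)"
proof -
  assume c: "c \<in> A"
  then have "points A \<inter> fst c = fst c" by (auto simp: points_def)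
  then show ?thesis using \<phi> c by (auto simp: smooth_fun_def dest: bspec[of _ _ c])
qed

lemma differential_potential:
  assumes "c \<in> A" "p \<in> fst c" "w \<in> tangent_space A p"
  shows "differential A \<phi> w = dd (\<phi> \<circ> cinv c) (snd c p) (snd w c)"
  by (rule differential_chart[OF assms])
    (rule smooth_on_open_has_derivative[OF potential_smooth chart_image_open], use assms in auto)

text \<open>In finite dimension nondegeneracy is enough: \<open>h\<close> collects the values of the
  form on the basis into a vector, is injective, hence surjective, and a preimage of the vector of
  \<open>f\<close> represents \<open>f\<close>.\<close>

lemma hessian_riesz:
  assumes v: "v \<in> U" and c: "c \<in> A" "fst v \<in> fst c" and f: "linear f"
  obtains a where "\<And>w. vertical_hessian (lag c) (snd c (fst v), snd v c) a w = f w"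
proof -
  interpret quadratic_lagrangian "chart_cone c" "lag c" by (rule quadratic_lagrangian_lag[OF c(1)])
  let ?H = "vertical_hessian (lag c) (snd c (fst v), snd v c)"
  note z = chart_cone_vector[OF v c]
  note left = hessian_linear_left[OF z] and right = hessian_linear_right[OF z]
  define h where "h = (\<lambda>a. \<Sum>b\<in>Basis. ?H a b *\<^sub>R b)"
  have hb: "h a \<bullet> b = ?H a b" if "b \<in> Basis" for a b
    using that by (simp add: h_def inner_sum_left inner_Basis if_distrib cong: if_cong)
  have H: "?H a w = (\<Sum>b\<in>Basis. (w \<bullet> b) *\<^sub>R ?H a b)" for a w
    by (rule frechet_sum_Basis[OF right])
  have lin: "linear h"
    using linear_add[OF left] linear_scale[OF left]
    by (simp add: linear_iff h_def scaleR_add_left sum.distrib scaleR_sum_right)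
  have "inj h"
  proof (rule linear_injective_0[OF lin, THEN iffD2], intro allI impI)
    fix a assume "h a = 0"
    then have "?H a b = 0" if "b \<in> Basis" for b using hb[OF that, of a] by simp
    then have "?H a w = 0" for w by (simp add: H[of a w])
    then show "a = 0" by (rule hessian_nondegenerate[OF v c])
  qed
  then obtain a where a: "h a = (\<Sum>b\<in>Basis. f b *\<^sub>R b)"
    using linear_injective_imp_surjective[OF lin] by (metis surjD)
  have "?H a b = f b" if "b \<in> Basis" for b
    using hb[OF that, of a] that by (simp add: a inner_sum_left inner_Basis if_distrib cong: if_cong)
  then have "?H a w = f w" for w
    by (simp add: H[of a w] frechet_sum_Basis[OF f, of w])
  then show ?thesis by (rule that)
qed

text \<open>The description by \<open>THE\<close> is justified by \<open>hessian_riesz\<close> for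
  existence and by nondegeneracy for uniqueness.\<close>

lemma gradient_chart:
  assumes v: "v \<in> U" and c: "c \<in> A" "fst v \<in> fst c"
  shows "vertical_hessian (lag c) (snd c (fst v), snd v c) (snd (anisotropic_gradient A L \<phi> v) c) w =
      dd (\<phi> \<circ> cinv c) (snd c (fst v)) w"
    and "anisotropic_gradient A L \<phi> v \<in> tangent_space A (fst v)"
proof -
  interpret quadratic_lagrangian "chart_cone c" "lag c" by (rule quadratic_lagrangian_lag[OF c(1)])
  let ?p = "fst v"
  let ?H = "vertical_hessian (lag c) (snd c ?p, snd v c)"
  note z = chart_cone_vector[OF v c]
  have "linear (dd (\<phi> \<circ> cinv c) (snd c ?p))"
    by (rule smooth_on_open_linear[OF potential_smooth chart_image_open]) (use c in auto)
  then obtain a where a: "\<And>w. ?H a w = dd (\<phi> \<circ> cinv c) (snd c ?p) w"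
    using hessian_riesz[OF v c] by blast
  define u where "u = coord_field A c a ?p"
  have g: "fundamental_tensor L v u' w' = ?H (snd u' c) (snd w' c)"
    if "u' \<in> tangent_space A ?p" "w' \<in> tangent_space A ?p" for u' w'
    by (rule fundamental_tensor_chart[OF domain_tangent[OF v] c z that])
  have u: "u \<in> tangent_space A ?p" "snd u c = a"
    using c by (auto simp: u_def coord_field_tangent coord_field_component)
  have "anisotropic_gradient A L \<phi> v = u"
    unfolding anisotropic_gradient_def
  proof (rule the_equality)
    show "u \<in> tangent_space A ?p \<and> (\<forall>w\<in>tangent_space A ?p. fundamental_tensor L v u w = differential A \<phi> w)"
      using u by (auto simp: g a differential_potential[OF c])
  next
    fix u' assume u': "u' \<in> tangent_space A ?p \<and>
      (\<forall>w\<in>tangent_space A ?p. fundamental_tensor L v u' w = differential A \<phi> w)"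
    have "?H (snd u' c - a) b = 0" for b
    proof -
      have "coord_field A c b ?p \<in> tangent_space A ?p" by (rule coord_field_tangent[OF c])
      then have "?H (snd u' c) b = dd (\<phi> \<circ> cinv c) (snd c ?p) b"
        using u' g[of u' "coord_field A c b ?p"] differential_potential[OF c]
        by (simp add: coord_field_component[OF c])
      then show ?thesis by (simp add: linear_diff[OF hessian_linear_left[OF z]] a)
    qed
    then have "snd u' c - a = 0" by (rule hessian_nondegenerate[OF v c])
    then show "u' = u" using u' u c by (intro tangent_eqI[of _ ?p _ c]) auto
  qed
  then show "?H (snd (anisotropic_gradient A L \<phi> v) c) w = dd (\<phi> \<circ> cinv c) (snd c (fst v)) w"
    "anisotropic_gradient A L \<phi> v \<in> tangent_space A (fst v)"
    using u a by auto
qed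

end

end

section \<open>Curves and motions\<close>

lemma smooth_on_dd:
  fixes l :: "'a::euclidean_space \<Rightarrow> 'b::real_normed_vector" and p q :: "'c::euclidean_space \<Rightarrow> 'a"
  assumes l: "smooth_on W l" "open W" and S: "thick S" "p ` S \<subseteq> W" and pq: "smooth_on S p" "smooth_on S q"
  shows "smooth_on S (\<lambda>z. dd l (p z) (q z))"
proof -
  have "smooth_on S (\<lambda>z. \<Sum>b\<in>Basis. (q z \<bullet> b) *\<^sub>R dd l (p z) b)"
    unfolding smooth_on_def
  proof (intro allI Ck_on_sum S(1) finite_Basis)
    fix k and b :: 'a
    have "smooth_on S (\<lambda>z. (q z \<bullet> b) *\<^sub>R dd l (p z) b)"
      by (intro smooth_on_bilinear[OF bounded_bilinear_scaleR S(1)]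
        smooth_on_bounded_linear[OF bounded_linear_inner_left S(1) pq(2)]
        smooth_on_compose[OF S(1) pq(1) smooth_on_open_frechet[OF l] S(2)])
    then show "Ck_on k S (\<lambda>z. (q z \<bullet> b) *\<^sub>R dd l (p z) b)" by (simp add: smooth_on_def)
  qed
  then show ?thesis
    using frechet_sum_Basis[OF smooth_on_open_linear[OF l]] S(2)
    by (subst smooth_on_cong[where g = "\<lambda>z. \<Sum>b\<in>Basis. (q z \<bullet> b) *\<^sub>R dd l (p z) b"]) auto
qed

lemma smooth_on_real_derivative:
  fixes f :: "real \<Rightarrow> 'b::real_normed_vector"
  assumes I: "thick I" and Q: "openin (top_of_set I) Q" and f: "smooth_on Q f" and t: "t \<in> Q"
  shows "(f has_vector_derivative vector_derivative f (at t within I)) (at t within I)"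
    and "vector_derivative f (at t within I) = frechet_derivative f (at t within Q) 1"
proof -
  have tI: "t \<in> I" using Q t openin_imp_subset by blast
  let ?D = "frechet_derivative f (at t within Q)"
  have D: "(f has_derivative ?D) (at t within I)"
    using smooth_on_has_derivative[OF f t] at_within_openin[OF Q t] by simp
  moreover have "?D = (\<lambda>h. h *\<^sub>R ?D 1)"
  proof
    show "?D h = h *\<^sub>R ?D 1" for h
      using linear_scale[OF has_derivative_linear[OF D], of h 1] by simp
  qed
  ultimately have "(f has_vector_derivative ?D 1) (at t within I)"
    by (simp only: has_vector_derivative_def)
  moreover from this show "vector_derivative f (at t within I) = ?D 1"
    by (rule vector_derivative_within[OF thick_not_bot[OF I tI]])
  ultimately show "(f has_vector_derivative vector_derivative f (at t within I)) (at t within I)" by simp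
qed

text \<open>The second derivative in one fixed chart, not a tangent vector by itself.
  \<open>velocity\<close> has component 0 where the curve is outside the chart, but at a time inside
  it the derivative sees nearby times only.\<close>

definition acceleration ::
  "('a, 'e::real_normed_vector) chart set \<Rightarrow> real set \<Rightarrow> (real \<Rightarrow> 'a) \<Rightarrow> ('a, 'e) chart \<Rightarrow> real \<Rightarrow> 'e" where
  "acceleration A I \<gamma> c t = vector_derivative (\<lambda>s. snd (velocity A I \<gamma> s) c) (at t within I)"

section \<open>Velocity and acceleration of a curve in a chart\<close>

context smooth_atlas
begin

context
  fixes I :: "real set" and \<gamma> c
  assumes I: "thick I" and \<gamma>: "smooth_into A I \<gamma>" and c: "c \<in> A"
begin

lemma curve_domain: "openin (top_of_set I) (I \<inter> \<gamma> -` fst c)" "thick (I \<inter> \<gamma> -` fst c)"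
  and curve_smooth: "smooth_on (I \<inter> \<gamma> -` fst c) (snd c \<circ> \<gamma>)"
  using \<gamma> c thick_openin[OF I] by (auto simp: smooth_into_def Let_def)

lemma velocity_derivative:
  assumes "t \<in> I" "\<gamma> t \<in> fst c"
  shows "((snd c \<circ> \<gamma>) has_vector_derivative snd (velocity A I \<gamma> t) c) (at t within I)"
  using smooth_on_real_derivative(1)[OF I curve_domain(1) curve_smooth, of t] assms c by (simp add: velocity_def)

lemma velocity_smooth: "smooth_on (I \<inter> \<gamma> -` fst c) (\<lambda>t. snd (velocity A I \<gamma> t) c)"
proof -
  have "snd (velocity A I \<gamma> t) c = frechet_derivative (snd c \<circ> \<gamma>) (at t within (I \<inter> \<gamma> -` fst c)) 1"
    if "t \<in> I \<inter> \<gamma> -` fst c" for t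
    using smooth_on_real_derivative(2)[OF I curve_domain(1) curve_smooth that] that c by (simp add: velocity_def)
  then show ?thesis using smooth_on_frechet[OF curve_smooth, of 1] smooth_on_cong by (metis (no_types, lifting))
qed

lemma acceleration_derivative:
  assumes "t \<in> I" "\<gamma> t \<in> fst c"
  shows "((\<lambda>t. snd (velocity A I \<gamma> t) c) has_vector_derivative acceleration A I \<gamma> c t) (at t within I)"
  using smooth_on_real_derivative(1)[OF I curve_domain(1) velocity_smooth, of t] assms by (simp add: acceleration_def)

lemma acceleration_smooth: "smooth_on (I \<inter> \<gamma> -` fst c) (acceleration A I \<gamma> c)"
proof -
  have "acceleration A I \<gamma> c t =
      frechet_derivative (\<lambda>t. snd (velocity A I \<gamma> t) c) (at t within (I \<inter> \<gamma> -` fst c)) 1"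
    if "t \<in> I \<inter> \<gamma> -` fst c" for t
    using smooth_on_real_derivative(2)[OF I curve_domain(1) velocity_smooth that] by (simp add: acceleration_def)
  then show ?thesis using smooth_on_frechet[OF velocity_smooth, of 1] smooth_on_cong by (metis (no_types, lifting))
qed

end

end

definition (in finsler) curve_euler_lagrange ::
  "('a \<Rightarrow> real) \<Rightarrow> real set \<Rightarrow> (real \<Rightarrow> 'a) \<Rightarrow> ('a, 'e) chart \<Rightarrow> real \<Rightarrow> 'e \<Rightarrow> real" where
  "curve_euler_lagrange \<phi> I \<gamma> c t = euler_lagrange (lag c) (\<phi> \<circ> cinv c) (snd c (\<gamma> t))
     (snd (velocity A I \<gamma> t) c) (acceleration A I \<gamma> c t)"

lemma (in finsler) euler_lagrange_continuous:
  assumes \<phi>: "smooth_fun A (points A) \<phi>" and \<gamma>: "admissible_curve A U I \<gamma>" and c: "c \<in> A"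
  shows "continuous_on (I \<inter> \<gamma> -` fst c) (\<lambda>t. curve_euler_lagrange \<phi> I \<gamma> c t w)"
proof -
  have I: "thick I" and sm: "smooth_into A I \<gamma>" and vU: "\<And>t. t \<in> I \<Longrightarrow> velocity A I \<gamma> t \<in> U"
    using \<gamma> thick_interval by (auto simp: admissible_curve_def)
  let ?Q = "I \<inter> \<gamma> -` fst c" and ?x = "snd c \<circ> \<gamma>" and ?y = "\<lambda>t. snd (velocity A I \<gamma> t) c"
  note th = curve_domain(2)[OF I sm c]
  have sub: "(\<lambda>t. (?x t, ?y t)) ` ?Q \<subseteq> chart_cone c" "?x ` ?Q \<subseteq> snd c ` fst c"
    using chart_cone_vector[OF vU c] by (auto simp: velocity_def)
  have x: "smooth_on ?Q ?x" and y: "smooth_on ?Q ?y"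
    by (rule curve_smooth[OF I sm c] velocity_smooth[OF I sm c])+
  have xy: "smooth_on ?Q (\<lambda>t. (?x t, ?y t))" by (rule smooth_on_Pair[OF th x y])
  have "smooth_on ?Q (\<lambda>t. dd (\<lambda>z. dd (lag c) z (0, w)) (?x t, ?y t) (?y t, acceleration A I \<gamma> c t))"
    by (rule smooth_on_dd[OF smooth_on_open_frechet[OF lag_smooth chart_cone_open] chart_cone_open th sub(1) xy
      smooth_on_Pair[OF th y acceleration_smooth[OF I sm c]]]) (rule c)+
  moreover have "smooth_on ?Q (\<lambda>t. dd (lag c) (?x t, ?y t) (w, 0))"
    by (rule smooth_on_dd[OF lag_smooth chart_cone_open th sub(1) xy smooth_on_const[OF th]]) (rule c)+
  moreover have "smooth_on ?Q (\<lambda>t. dd (\<phi> \<circ> cinv c) (?x t) w)"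
    by (rule smooth_on_dd[OF potential_smooth[OF \<phi>] chart_image_open th sub(2) x smooth_on_const[OF th]]) (rule c)+
  ultimately show ?thesis
    unfolding curve_euler_lagrange_def euler_lagrange_def
    by (auto intro!: continuous_intros dest!: smooth_on_continuous simp: o_def)
qed

section \<open>The equation of motion in a chart\<close>

context chern
begin

lemma cov_deriv_chart:
  assumes \<gamma>: "admissible_curve A U I \<gamma>" and c: "c \<in> A" and t: "t \<in> I" "\<gamma> t \<in> fst c"
  shows "snd (cov_deriv A nab I \<gamma> (velocity A I \<gamma>) t) c = acceleration A I \<gamma> c t +
    gam c (snd c (\<gamma> t), snd (velocity A I \<gamma> t) c) (snd (velocity A I \<gamma> t) c) (snd (velocity A I \<gamma> t) c)"
proof -
  have I: "thick I" and sm: "smooth_into A I \<gamma>" and vU: "velocity A I \<gamma> t \<in> U"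
    using \<gamma> t thick_interval by (auto simp: admissible_curve_def)
  let ?v = "velocity A I \<gamma> t"
  define x where "x = snd c (\<gamma> t)"
  define y where "y = snd ?v c"
  have fv: "fst ?v = \<gamma> t" by (simp add: velocity_def)
  have z: "(x, y) \<in> chart_cone c" using chart_cone_vector[OF vU c] t fv by (simp add: x_def y_def)
  have v: "coord_field A c y (cinv c x) = ?v"
    using tangent_eq_coord_field[OF domain_tangent[OF vU] c] fv t(2) cinv_chart[OF c t(2)] by (simp add: x_def y_def)
  have chr: "christoffel A nab c ?v k i j = gam c (x, y) i j \<bullet> k" for i j k
    by (simp add: christoffel_def gam_def v)
  note nb = thick_not_bot[OF I t(1)]
  have d1: "vector_derivative (\<lambda>s. snd c (\<gamma> s) \<bullet> i) (at t within I) = y \<bullet> i" for i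
    using bounded_linear.has_vector_derivative[OF bounded_linear_inner_left velocity_derivative[OF I sm c t]]
    by (intro vector_derivative_within[OF nb]) (simp add: y_def o_def)
  have d2: "vector_derivative (\<lambda>s. snd (velocity A I \<gamma> s) c \<bullet> k) (at t within I) = acceleration A I \<gamma> c t \<bullet> k" for k
    by (intro vector_derivative_within[OF nb]
      bounded_linear.has_vector_derivative[OF bounded_linear_inner_left acceleration_derivative[OF I sm c t]])
  \<comment> \<open>Bilinearity turns the double sum over basis indices in \<open>cov_deriv\<close>
    into \<open>gam\<close> evaluated at the velocity.\<close>
  have "gam c (x, y) y y = (\<Sum>i\<in>Basis. \<Sum>j\<in>Basis. ((y \<bullet> i) * (y \<bullet> j)) *\<^sub>R gam c (x, y) i j)"
  proof -
    have "gam c (x, y) (\<Sum>i\<in>Basis. (y \<bullet> i) *\<^sub>R i) (\<Sum>j\<in>Basis. (y \<bullet> j) *\<^sub>R j) =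
      (\<Sum>(i, j)\<in>Basis \<times> Basis. gam c (x, y) ((y \<bullet> i) *\<^sub>R i) ((y \<bullet> j) *\<^sub>R j))"
      by (rule bilinear_sum[OF gam_bilinear[OF c z]])
    also have "\<dots> = (\<Sum>i\<in>Basis. \<Sum>j\<in>Basis. ((y \<bullet> i) * (y \<bullet> j)) *\<^sub>R gam c (x, y) i j)"
      by (simp add: sum.cartesian_product mult.commute bilinear_lmul[OF gam_bilinear[OF c z]] bilinear_rmul[OF gam_bilinear[OF c z]])
    finally show ?thesis by (simp add: euclidean_representation)
  qed
  then have "(\<Sum>i\<in>Basis. \<Sum>j\<in>Basis. christoffel A nab c ?v k i j * (y \<bullet> i) * (y \<bullet> j)) = gam c (x, y) y y \<bullet> k" for k
    by (simp add: chr inner_sum_left algebra_simps)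
  then have "snd (cov_deriv A nab I \<gamma> (velocity A I \<gamma>) t) c =
      (\<Sum>k\<in>Basis. ((acceleration A I \<gamma> c t + gam c (x, y) y y) \<bullet> k) *\<^sub>R k)"
    using c t by (simp add: cov_deriv_def d1 d2 inner_add_left flip: y_def)
  then show ?thesis by (simp only: euclidean_representation flip: x_def y_def)
qed

lemma motion_iff:
  assumes \<phi>: "smooth_fun A (points A) \<phi>" and F: "\<And>v. v \<in> U \<Longrightarrow> F v = (-1) *\<^sub>T anisotropic_gradient A L \<phi> v"
  shows "motion A U nab F I \<gamma> \<longleftrightarrow> admissible_curve A U I \<gamma> \<and>
    (\<forall>t\<in>I. \<forall>c\<in>A. \<gamma> t \<in> fst c \<longrightarrow> (\<forall>w. curve_euler_lagrange \<phi> I \<gamma> c t w = 0))"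
proof (cases "admissible_curve A U I \<gamma>")
  case adm: True
  have "cov_deriv A nab I \<gamma> (velocity A I \<gamma>) t = F (velocity A I \<gamma> t) \<longleftrightarrow>
      (\<forall>c\<in>A. \<gamma> t \<in> fst c \<longrightarrow> (\<forall>w. curve_euler_lagrange \<phi> I \<gamma> c t w = 0))" if t: "t \<in> I" for t
  proof -
    let ?v = "velocity A I \<gamma> t"
    let ?N = "anisotropic_gradient A L \<phi> ?v"
    have vU: "?v \<in> U" using adm t by (simp add: admissible_curve_def)
    have fv: "fst ?v = \<gamma> t" by (simp add: velocity_def)
    have Nt: "?N \<in> tangent_space A (\<gamma> t)"
      using domain_points[OF vU] gradient_chart(2)[OF \<phi> vU] fv by auto
    have "cov_deriv A nab I \<gamma> (velocity A I \<gamma>) t = F ?v \<longleftrightarrow>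
        (\<forall>c. snd (cov_deriv A nab I \<gamma> (velocity A I \<gamma>) t) c = snd (F ?v) c)"
      using tangent_fst[OF Nt] F[OF vU] by (auto simp: prod_eq_iff cov_deriv_def fun_eq_iff)
    also have "\<dots> \<longleftrightarrow> (\<forall>c. c \<in> A \<and> \<gamma> t \<in> fst c \<longrightarrow>
        snd (cov_deriv A nab I \<gamma> (velocity A I \<gamma>) t) c = - snd ?N c)"
    \<comment> \<open>At charts not containing the point both families are 0 by convention, so
      equality of tangent vectors has content only in the charts around
      \<open>\<gamma> t\<close>.\<close>
    proof (intro iff_allI)
      fix c
      show "snd (cov_deriv A nab I \<gamma> (velocity A I \<gamma>) t) c = snd (F ?v) c \<longleftrightarrow> (c \<in> A \<and> \<gamma> t \<in> fst c \<longrightarrow>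
        snd (cov_deriv A nab I \<gamma> (velocity A I \<gamma>) t) c = - snd ?N c)"
      proof (cases "c \<in> A \<and> \<gamma> t \<in> fst c")
        case False
        then have "snd (cov_deriv A nab I \<gamma> (velocity A I \<gamma>) t) c = 0" "snd (F ?v) c = 0"
          using tangent_outside[OF Nt False] F[OF vU] by (auto simp: cov_deriv_def)
        then show ?thesis using False by auto
      qed (simp add: F[OF vU])
    qed
    also have "\<dots> \<longleftrightarrow> (\<forall>c. c \<in> A \<and> \<gamma> t \<in> fst c \<longrightarrow> (\<forall>w. curve_euler_lagrange \<phi> I \<gamma> c t w = 0))"
    proof (intro iff_allI imp_cong refl)
      fix c assume c: "c \<in> A \<and> \<gamma> t \<in> fst c"
      interpret quadratic_lagrangian "chart_cone c" "lag c" by (rule quadratic_lagrangian_lag) (use c in simp)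
      define x where "x = snd c (\<gamma> t)"
      define y where "y = snd ?v c"
      define a where "a = acceleration A I \<gamma> c t"
      let ?H = "vertical_hessian (lag c) (x, y)"
      have z: "(x, y) \<in> chart_cone c" using chart_cone_vector[OF vU, of c] c fv by (simp add: x_def y_def)
      have N: "?H (snd ?N c) w = dd (\<phi> \<circ> cinv c) x w" for w
        using gradient_chart(1)[OF \<phi> vU, of c w] c fv by (simp add: x_def y_def)
      \<comment> \<open>The covector is affine in the acceleration: the vertical part of the second
        derivative is H(a, w), the horizontal part is the spray term of \<open>gam_spray\<close>,
        and the potential is the pairing with its gradient.\<close>
      have EL: "curve_euler_lagrange \<phi> I \<gamma> c t w = ?H (a + gam c (x, y) y y + snd ?N c) w" for w
      proof -
        have "dd (\<lambda>z. dd (lag c) z (0, w)) (x, y) (y, a) =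
            dd (\<lambda>z. dd (lag c) z (0, w)) (x, y) (y, 0) + dd (\<lambda>z. dd (lag c) z (0, w)) (x, y) (0, a)"
          using linear_add[OF smooth_on_open_linear[OF momentum_smooth op z], of _ "(y, 0)" "(0, a)"] by simp
        then have "1/2 * dd (\<lambda>z. dd (lag c) z (0, w)) (x, y) (y, a) =
            1/2 * dd (\<lambda>z. dd (lag c) z (0, w)) (x, y) (y, 0) + ?H a w"
          by (simp add: vertical_hessian_def)
        then show ?thesis
          using gam_spray[OF _ z, of w] c
          by (simp add: curve_euler_lagrange_def euler_lagrange_def linear_add[OF hessian_linear_left[OF z]] N
            flip: x_def y_def a_def)
      qed
      have "(\<forall>w. curve_euler_lagrange \<phi> I \<gamma> c t w = 0) \<longleftrightarrow> a + gam c (x, y) y y + snd ?N c = 0"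
      proof
        assume "\<forall>w. curve_euler_lagrange \<phi> I \<gamma> c t w = 0"
        then show "a + gam c (x, y) y y + snd ?N c = 0"
          using hessian_nondegenerate[OF vU, of c] c fv EL by (simp add: x_def y_def)
      qed (simp add: EL linear_0[OF hessian_linear_left[OF z]])
      moreover have "snd (cov_deriv A nab I \<gamma> (velocity A I \<gamma>) t) c = a + gam c (x, y) y y"
        using cov_deriv_chart[OF adm _ t] c by (simp add: x_def y_def a_def)
      ultimately show "(snd (cov_deriv A nab I \<gamma> (velocity A I \<gamma>) t) c = - snd ?N c) \<longleftrightarrow>
          (\<forall>w. curve_euler_lagrange \<phi> I \<gamma> c t w = 0)"
        by (simp add: eq_neg_iff_add_eq_0)
    qed
    finally show ?thesis by blast
  qed
  then show ?thesis using adm by (simp add: motion_def)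
qed (simp add: motion_def)

end

section \<open>First variation of the action\<close>

context finsler
begin

context
  fixes \<phi> I \<gamma> a b \<epsilon> \<Gamma> S K \<Phi>
  assumes \<phi>: "smooth_fun A (points A) \<phi>" and adm: "admissible_curve A U I \<gamma>"
    and ab: "a < b" "{a..b} \<subseteq> I" and var: "fixed_endpoint_variation A U a b \<gamma> \<epsilon> \<Gamma>"
    and S: "S = {-\<epsilon><..<\<epsilon>} \<times> {a..b}"
    and K: "K = (\<lambda>v. 1/2 * L v - \<phi> (fst v))"
    and \<Phi>: "\<Phi> = (\<lambda>z. K (velocity A {a..b} (\<lambda>t. \<Gamma> (fst z, t)) (snd z)))"
begin

lemma eps: "\<epsilon> > 0"
  and smooth_variation: "smooth_into A S \<Gamma>"
  and variation_0: "t \<in> {a..b} \<Longrightarrow> \<Gamma> (0, t) = \<gamma> t"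
  and variation_ends: "s \<in> {-\<epsilon><..<\<epsilon>} \<Longrightarrow> \<Gamma> (s, a) = \<gamma> a" "s \<in> {-\<epsilon><..<\<epsilon>} \<Longrightarrow> \<Gamma> (s, b) = \<gamma> b"
  and variation_U: "(s, t) \<in> S \<Longrightarrow> velocity A {a..b} (\<lambda>t. \<Gamma> (s, t)) t \<in> U"
  using var by (auto simp: fixed_endpoint_variation_def admissible_curve_def S)

lemma variation_thick: "thick S"
  using ab eps unfolding S by (intro thick_Times thick_Icc thick_open) auto

text \<open>The partial derivatives of the variation in the chart \<open>c\<close>: direction (0, 1)
  gives velocities, (1, 0) the variation field. They are taken within the strip and hence are
  one-sided in time at \<open>a\<close> and \<open>b\<close>.\<close>

definition vpart :: "real \<times> real \<Rightarrow> ('a, 'e) chart \<Rightarrow> real \<times> real \<Rightarrow> 'e" where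
  "vpart h c z = frechet_derivative (snd c \<circ> \<Gamma>) (at z within S) h"

lemma variation_domain: "c \<in> A \<Longrightarrow> openin (top_of_set S) (S \<inter> \<Gamma> -` fst c)"
  and variation_chart_smooth: "c \<in> A \<Longrightarrow> smooth_on (S \<inter> \<Gamma> -` fst c) (snd c \<circ> \<Gamma>)"
  using smooth_variation by (auto simp: smooth_into_def Let_def)

lemma variation_domain_thick: "c \<in> A \<Longrightarrow> thick (S \<inter> \<Gamma> -` fst c)"
  by (rule thick_openin[OF variation_thick variation_domain])

lemma variation_derivative:
  assumes "c \<in> A" "z \<in> S" "\<Gamma> z \<in> fst c"
  shows "((snd c \<circ> \<Gamma>) has_derivative (\<lambda>h. vpart h c z)) (at z within S)"
  using smooth_on_has_derivative[OF variation_chart_smooth[OF assms(1)], of z]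
    at_within_openin[OF variation_domain[OF assms(1)], of z] assms(2,3)
  by (simp add: vpart_def)

lemma vpart_smooth: "c \<in> A \<Longrightarrow> smooth_on (S \<inter> \<Gamma> -` fst c) (vpart h c)"
  using smooth_on_frechet[OF variation_chart_smooth, of c h]
    at_within_openin[OF variation_domain, of c]
    smooth_on_cong[of "S \<inter> \<Gamma> -` fst c" "vpart h c"
      "\<lambda>z. frechet_derivative (snd c \<circ> \<Gamma>) (at z within (S \<inter> \<Gamma> -` fst c)) h"]
  by (simp add: vpart_def)

lemma slice_velocity:
  assumes "c \<in> A" "(s, t) \<in> S" "\<Gamma> (s, t) \<in> fst c"
  shows "snd (velocity A {a..b} (\<lambda>t. \<Gamma> (s, t)) t) c = vpart (0, 1) c (s, t)"
proof -
  have t: "t \<in> {a..b}" using assms(2) by (simp add: S)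
  have "((\<lambda>t. (snd c \<circ> \<Gamma>) (s, t)) has_vector_derivative vpart (0, 1) c (s, t)) (at t within {a..b})"
    by (rule has_vector_derivative_section_snd[OF variation_derivative[OF assms]]) (use assms(2) S in auto)
  then have "vector_derivative (\<lambda>t. (snd c \<circ> \<Gamma>) (s, t)) (at t within {a..b}) = vpart (0, 1) c (s, t)"
    by (rule vector_derivative_within[OF thick_not_bot[OF thick_Icc[OF ab(1)] t]])
  then show ?thesis using assms by (simp add: velocity_def o_def)
qed

lemma variation_chart:
  assumes c: "c \<in> A" and z: "z \<in> S" "\<Gamma> z \<in> fst c"
  shows "(snd c (\<Gamma> z), vpart (0, 1) c z) \<in> chart_cone c" (is ?t)
    and "\<Phi> z = 1/2 * lag c (snd c (\<Gamma> z), vpart (0, 1) c z) - (\<phi> \<circ> cinv c) (snd c (\<Gamma> z))" (is ?p)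
proof -
  obtain s t where st: "z = (s, t)" by (cases z)
  let ?v = "velocity A {a..b} (\<lambda>t. \<Gamma> (s, t)) t"
  have v: "?v \<in> U" using variation_U z st by simp
  have f: "fst ?v = \<Gamma> z" by (simp add: velocity_def st)
  have sv: "snd ?v c = vpart (0, 1) c z" using slice_velocity[OF c] z st by simp
  show ?t using chart_cone_vector[OF v c] f sv z by simp
  show ?p using lag_vector[OF domain_tangent[OF v] c] f sv z cinv_chart[OF c z(2)] by (simp add: \<Phi> K st)
qed

lemma integrand_smooth:
  assumes c: "c \<in> A"
  shows "smooth_on (S \<inter> \<Gamma> -` fst c) \<Phi>"
proof -
  let ?D = "S \<inter> \<Gamma> -` fst c"
  note th = variation_domain_thick[OF c]
  have 1: "smooth_on ?D (\<lambda>z. lag c (snd c (\<Gamma> z), vpart (0, 1) c z))"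
    by (rule smooth_on_compose[OF th _ lag_smooth[OF c]])
      (use variation_chart(1)[OF c] smooth_on_Pair[OF th variation_chart_smooth[OF c] vpart_smooth[OF c]] in
        \<open>auto simp: o_def\<close>)
  have 2: "smooth_on ?D (\<lambda>z. (\<phi> \<circ> cinv c) ((snd c \<circ> \<Gamma>) z))"
    by (rule smooth_on_compose[OF th variation_chart_smooth[OF c] potential_smooth[OF \<phi> c]]) auto
  have "smooth_on ?D (\<lambda>z. 1/2 * lag c (snd c (\<Gamma> z), vpart (0, 1) c z) + (-1) * (\<phi> \<circ> cinv c) ((snd c \<circ> \<Gamma>) z))"
    by (intro smooth_on_add[OF th] smooth_on_bounded_linear[OF bounded_linear_mult_right th] 1 2)
  then show ?thesis
    by (subst smooth_on_cong[where g = "\<lambda>z. 1/2 * lag c (snd c (\<Gamma> z), vpart (0, 1) c z)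
      + (-1) * (\<phi> \<circ> cinv c) ((snd c \<circ> \<Gamma>) z)"]) (auto simp: variation_chart(2)[OF c])
qed

lemma variation_covered: "z \<in> S \<Longrightarrow> \<exists>c\<in>A. \<Gamma> z \<in> fst c"
  using smooth_variation unfolding smooth_into_def points_def by blast

lemma integrand_derivative:
  assumes "z \<in> S"
  shows "(\<Phi> has_derivative frechet_derivative \<Phi> (at z within S)) (at z within S)"
proof -
  obtain c where c: "c \<in> A" "z \<in> S \<inter> \<Gamma> -` fst c" using variation_covered assms by blast
  show ?thesis
    using smooth_on_has_derivative[OF integrand_smooth[OF c(1)] c(2)]
    unfolding at_within_openin[OF variation_domain[OF c(1)] c(2)] .
qed

text \<open>Since \<Phi> is defined without charts, smoothness on the relatively open chart pieces
  is enough: the derivative within a piece is the derivative within \<open>S\<close>, and continuity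
  is local.\<close>

lemma integrand_derivative_continuous:
  "continuous_on S (\<lambda>z. frechet_derivative \<Phi> (at z within S) h)"
  unfolding continuous_on_eq_continuous_within
proof
  fix z assume z: "z \<in> S"
  obtain c where c: "c \<in> A" and zc: "z \<in> S \<inter> \<Gamma> -` fst c" using variation_covered z by blast
  let ?D = "S \<inter> \<Gamma> -` fst c"
  have eq: "at y within ?D = at y within S" if "y \<in> ?D" for y
    by (rule at_within_openin[OF variation_domain[OF c] that])
  have "continuous_on ?D (\<lambda>z. frechet_derivative \<Phi> (at z within ?D) h)"
    by (rule smooth_on_continuous[OF smooth_on_frechet[OF integrand_smooth[OF c]]])
  then have "continuous_on ?D (\<lambda>z. frechet_derivative \<Phi> (at z within S) h)"
    using continuous_on_cong[of ?D ?D "\<lambda>z. frechet_derivative \<Phi> (at z within ?D) h"] eq by (metis (no_types, lifting))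
  then have "continuous (at z within ?D) (\<lambda>z. frechet_derivative \<Phi> (at z within S) h)"
    using zc continuous_on_eq_continuous_within by blast
  then show "continuous (at z within S) (\<lambda>z. frechet_derivative \<Phi> (at z within S) h)"
    unfolding eq[OF zc] .
qed

lemma action_derivative:
  shows "((\<lambda>s. action A K a b (\<lambda>t. \<Gamma> (s, t))) has_real_derivative
      integral {a..b} (\<lambda>t. frechet_derivative \<Phi> (at (0, t) within S) (1, 0))) (at 0)"
    and "(\<lambda>t. frechet_derivative \<Phi> (at (0, t) within S) (1, 0)) integrable_on {a..b}"
proof -
  let ?J = "{-\<epsilon><..<\<epsilon>}"
  have dc: "continuous_on S (\<lambda>z. frechet_derivative \<Phi> (at z within S) (1, 0))"
    by (rule integrand_derivative_continuous)
  have pc: "continuous_on S \<Phi>"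
    unfolding continuous_on_eq_continuous_within
    using integrand_derivative has_derivative_continuous by blast
  have sec: "continuous_on {a..b} (\<lambda>t. f (s, t))" if "s \<in> ?J" "continuous_on S f" for f :: "_ \<Rightarrow> real" and s
    by (rule continuous_on_compose2[OF that(2) continuous_on_Pair[OF continuous_on_const continuous_on_id]])
      (use that S in auto)
  have 0: "0 \<in> ?J" using eps by simp
  have "((\<lambda>s. integral (cbox a b) (\<lambda>t. \<Phi> (s, t))) has_field_derivative
      integral (cbox a b) (\<lambda>t. frechet_derivative \<Phi> (at (0, t) within S) (1, 0))) (at 0 within ?J)"
  proof (rule leibniz_rule_field_derivative[OF _ _ _ 0, where f = "\<lambda>s t. \<Phi> (s, t)" and
      fx = "\<lambda>s t. frechet_derivative \<Phi> (at (s, t) within S) (1, 0)"])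
    fix s t assume st: "s \<in> ?J" "t \<in> cbox a b"
    have "((\<lambda>s. \<Phi> (s, t)) has_vector_derivative frechet_derivative \<Phi> (at (s, t) within S) (1, 0)) (at s within ?J)"
      by (rule has_vector_derivative_section_fst[OF integrand_derivative]) (use st S in auto)
    then show "((\<lambda>s. \<Phi> (s, t)) has_field_derivative frechet_derivative \<Phi> (at (s, t) within S) (1, 0)) (at s within ?J)"
      by (simp add: has_real_derivative_iff_has_vector_derivative)
  next
    fix s assume "s \<in> ?J"
    then show "(\<lambda>t. \<Phi> (s, t)) integrable_on cbox a b"
      using sec[OF _ pc] by (simp add: integrable_continuous_interval)
  next
    show "continuous_on (?J \<times> cbox a b) (\<lambda>(s, t). frechet_derivative \<Phi> (at (s, t) within S) (1, 0))"
      using dc by (simp add: S case_prod_unfold)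
  qed simp
  moreover have "at 0 within ?J = at 0" by (rule at_within_open[OF 0]) simp
  ultimately show "((\<lambda>s. action A K a b (\<lambda>t. \<Gamma> (s, t))) has_real_derivative
      integral {a..b} (\<lambda>t. frechet_derivative \<Phi> (at (0, t) within S) (1, 0))) (at 0)"
    by (simp add: action_def \<Phi>)
  show "(\<lambda>t. frechet_derivative \<Phi> (at (0, t) within S) (1, 0)) integrable_on {a..b}"
    by (rule integrable_continuous_interval[OF sec[OF 0 dc]])
qed

section \<open>The momentum of the variation field along the curve\<close>

definition variation_field :: "real \<Rightarrow> ('a, 'e) tangent" where
  "variation_field t = (\<Gamma> (0, t), \<lambda>c. if c \<in> A \<and> \<Gamma> (0, t) \<in> fst c then vpart (1, 0) c (0, t) else 0)"

text \<open>Written without charts, the momentum of the variation field is defined on all of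
  \<open>[a, b]\<close>, so that no subdivision of the curve into chart domains is needed.\<close>

definition momentum :: "real \<Rightarrow> real" where
  "momentum t = 1/2 * deriv (\<lambda>r. L (velocity A {a..b} (\<lambda>t. \<Gamma> (0, t)) t +\<^sub>T r *\<^sub>T variation_field t)) 0"

lemma zero_slice: "t \<in> {a..b} \<Longrightarrow> (0, t) \<in> S"
  using eps by (simp add: S)

lemma momentum_variation:
  assumes c: "c \<in> A" and t: "t \<in> {a..b}" "\<Gamma> (0, t) \<in> fst c"
  shows "momentum t = 1/2 * dd (lag c) (snd c (\<Gamma> (0, t)), vpart (0, 1) c (0, t)) (0, vpart (1, 0) c (0, t))"
proof -
  let ?v = "velocity A {a..b} (\<lambda>t. \<Gamma> (0, t)) t"
  note z = zero_slice[OF t(1)]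
  have v: "?v \<in> U" using variation_U[OF z] .
  have f: "fst ?v = \<Gamma> (0, t)" by (simp add: velocity_def)
  have xi: "variation_field t \<in> tangent_space A (fst ?v)"
    using curve_velocity_tangent[OF smooth_variation variation_thick z, of "(1, 0)"]
    unfolding variation_field_def vpart_def f .
  have "((\<lambda>s. L (?v +\<^sub>T s *\<^sub>T variation_field t)) has_real_derivative
      dd (lag c) (snd c (fst ?v), snd ?v c) (0, snd (variation_field t) c)) (at 0)"
    by (rule momentum_chart[OF domain_tangent[OF v] c _ chart_cone_vector[OF v c] xi]) (use t f in auto)
  then show ?thesis
    using c t f by (simp add: momentum_def DERIV_imp_deriv slice_velocity[OF c z] variation_field_def)
qed

text \<open>Continuity up to the endpoints is what the fundamental theorem needs in addition to a
  derivative at interior times.\<close>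

lemma momentum_continuous: "continuous_on {a..b} momentum"
  unfolding continuous_on_eq_continuous_within
proof
  fix t assume t: "t \<in> {a..b}"
  obtain c where c: "c \<in> A" "\<Gamma> (0, t) \<in> fst c" using variation_covered zero_slice[OF t] by blast
  let ?D = "S \<inter> \<Gamma> -` fst c"
  note th = variation_domain_thick[OF c(1)]
  define P where "P = (\<lambda>z. dd (lag c) (snd c (\<Gamma> z), vpart (0, 1) c z) (0, vpart (1, 0) c z))"
  have "smooth_on ?D P"
    unfolding P_def
    by (rule smooth_on_dd[OF lag_smooth[OF c(1)] chart_cone_open[OF c(1)] th _
      smooth_on_Pair[OF th _ vpart_smooth[OF c(1)]] smooth_on_Pair[OF th smooth_on_const[OF th] vpart_smooth[OF c(1)]]])
      (use variation_chart(1)[OF c(1)] variation_chart_smooth[OF c(1)] in \<open>auto simp: o_def\<close>)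
  then have cont: "continuous_on ?D P" by (rule smooth_on_continuous)
  define R where "R = {a..b} \<inter> (\<lambda>t. (0, t)) -` ?D"
  have R: "openin (top_of_set {a..b}) R"
  proof -
    obtain O' where O': "open O'" "?D = S \<inter> O'" using variation_domain[OF c(1)] by (auto simp: openin_open)
    have "R = {a..b} \<inter> (\<lambda>t. (0, t)) -` O'" using O' zero_slice by (auto simp: R_def)
    moreover have "open ((\<lambda>t::real. (0::real, t)) -` O')"
      by (intro open_vimage O' continuous_intros)
    ultimately show ?thesis by (auto simp: openin_open)
  qed
  have tR: "t \<in> R" using t c zero_slice by (simp add: R_def)
  have "continuous_on R (\<lambda>t. 1/2 * P (0, t))"
    by (intro continuous_on_mult_left continuous_on_compose2[OF cont
      continuous_on_Pair[OF continuous_on_const continuous_on_id]]) (auto simp: R_def)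
  then have "continuous_on R momentum"
    using continuous_on_cong[of R R "\<lambda>t. 1/2 * P (0, t)" momentum] momentum_variation[OF c(1)]
    by (auto simp: R_def P_def)
  then have "continuous (at t within R) momentum"
    using tR continuous_on_eq_continuous_within by blast
  then show "continuous (at t within {a..b}) momentum"
    unfolding at_within_openin[OF R tR] .
qed

text \<open>At the end times \<Gamma> does not depend on s, so the variation field vanishes there
  and the boundary terms disappear.\<close>

lemma momentum_ends: "momentum a = 0" "momentum b = 0"
proof -
  have "momentum t = 0" if t: "t \<in> {a..b}" and const: "\<And>s. s \<in> {-\<epsilon><..<\<epsilon>} \<Longrightarrow> \<Gamma> (s, t) = \<gamma> t" for t
  proof -
    obtain c where c: "c \<in> A" "\<Gamma> (0, t) \<in> fst c" using variation_covered zero_slice[OF t] by blast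
    have 0: "0 \<in> {-\<epsilon><..<\<epsilon>}" using eps by simp
    have "((\<lambda>s. (snd c \<circ> \<Gamma>) (s, t)) has_vector_derivative vpart (1, 0) c (0, t)) (at 0 within {-\<epsilon><..<\<epsilon>})"
      by (rule has_vector_derivative_section_fst[OF variation_derivative[OF c(1) zero_slice[OF t] c(2)]])
        (use t S in auto)
    moreover have "((\<lambda>s. (snd c \<circ> \<Gamma>) (s, t)) has_vector_derivative 0) (at 0 within {-\<epsilon><..<\<epsilon>})"
      by (rule has_vector_derivative_transform[OF 0 _ has_vector_derivative_const[of "snd c (\<gamma> t)"]])
        (use const in auto)
    moreover have "at 0 within {-\<epsilon><..<\<epsilon>} \<noteq> bot"
      by (rule thick_not_bot[OF thick_open 0]) simp
    ultimately have "vpart (1, 0) c (0, t) = 0"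
      using vector_derivative_unique_within by blast
    then show ?thesis
      using momentum_variation[OF c(1) t c(2)]
        linear_0[OF smooth_on_open_linear[OF lag_smooth chart_cone_open variation_chart(1)[OF c(1) zero_slice[OF t] c(2)]]] c(1)
      by (simp add: zero_prod_def)
  qed
  then show "momentum a = 0" "momentum b = 0"
    using variation_ends ab by auto
qed

text \<open>For interior times the point \<open>(0, t)\<close> has an open neighbourhood
  \<open>Q\<close> in the plane that \<Gamma> maps into the chart. This makes
  \<open>momentum_derivative\<close>, and with it the symmetry of second derivatives,
  available.\<close>

lemma momentum_variation_derivative:
  assumes c: "c \<in> A" and t: "t \<in> {a<..<b}" "\<gamma> t \<in> fst c"
  shows "(momentum has_vector_derivative frechet_derivative \<Phi> (at (0, t) within S) (1, 0) +
    curve_euler_lagrange \<phi> I \<gamma> c t (vpart (1, 0) c (0, t))) (at t)"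
proof -
  let ?B = "{-\<epsilon><..<\<epsilon>} \<times> {a<..<b}"
  define Q where "Q = ?B \<inter> \<Gamma> -` fst c"
  have tab: "t \<in> {a..b}" using t by simp
  have I: "thick I" and sm: "smooth_into A I \<gamma>"
    using adm thick_interval by (auto simp: admissible_curve_def)
  have B: "open ?B" "?B \<subseteq> S" by (auto simp: S intro: open_Times)
  have Q: "open Q"
  proof -
    obtain O' where O': "open O'" "S \<inter> \<Gamma> -` fst c = S \<inter> O'"
      using variation_domain[OF c] by (auto simp: openin_open)
    have "Q = ?B \<inter> O'" using O'(2) B(2) unfolding Q_def by blast
    then show ?thesis using B(1) O'(1) by auto
  qed
  have QS: "Q \<subseteq> S \<inter> \<Gamma> -` fst c" using B unfolding Q_def by blast
  have z: "(0, t) \<in> Q" using t eps variation_0[OF tab] by (simp add: Q_def)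
  have at: "at z within S = at z" if "z \<in> Q" for z
  proof (rule at_within_interior)
    show "z \<in> interior S" using that Q QS by (meson interiorI le_infE)
  qed
  let ?G = "snd c \<circ> \<Gamma>"
  have vp: "dd ?G z h = vpart h c z" if "z \<in> Q" for z h
    unfolding vpart_def at[OF that] ..
  have G: "smooth_on Q ?G"
    by (rule smooth_on_subset[OF variation_chart_smooth[OF c] thick_open[OF Q] QS])
  have sub: "?G ` Q \<subseteq> snd c ` fst c" "(\<lambda>z. (?G z, dd ?G z (0, 1))) ` Q \<subseteq> chart_cone c"
    using variation_chart(1)[OF c] QS by (auto simp: vp subset_iff)
  note md = momentum_derivative[OF lag_smooth[OF c] chart_cone_open[OF c] potential_smooth[OF \<phi> c]
    chart_image_open[OF c] G Q sub z]
  define \<Psi> where "\<Psi> = (\<lambda>z. 1/2 * lag c (?G z, dd ?G z (0, 1)) - (\<phi> \<circ> cinv c) (?G z))"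
  have Psi: "\<Psi> z = \<Phi> z" if "z \<in> Q" for z
  proof -
    have "z \<in> S" "\<Gamma> z \<in> fst c" using that QS by auto
    then show ?thesis using variation_chart(2)[OF c, of z] that by (simp add: \<Psi>_def vp)
  qed
  have dPsi: "dd \<Psi> (0, t) h = frechet_derivative \<Phi> (at (0, t) within S) h" for h
  proof -
    have "(\<Phi> has_derivative frechet_derivative \<Phi> (at (0, t) within S)) (at (0, t))"
      using integrand_derivative[OF zero_slice[OF tab]] unfolding at[OF z] .
    then have "(\<Psi> has_derivative frechet_derivative \<Phi> (at (0, t) within S)) (at (0, t))"
      by (rule has_derivative_transform_within_open[OF _ Q z]) (simp add: Psi)
    then show ?thesis by (rule dd_eqI)
  qed
  define R where "R = {t'. (0, t') \<in> Q}"
  have R: "open R" "t \<in> R" "R \<subseteq> {a<..<b}"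
  proof -
    have "open ((\<lambda>t'. (0, t')) -` Q)" by (intro open_vimage Q continuous_intros)
    then show "open R" by (simp add: R_def vimage_def)
  qed (use z in \<open>auto simp: R_def Q_def\<close>)
  \<comment> \<open>Velocities of \<gamma> are taken within \<open>I\<close>, those of the variation
    within \<open>{a..b}\<close>. At interior times both are ordinary derivatives, so velocity and
    acceleration of \<gamma> are the time derivatives of \<Gamma> at s = 0.\<close>
  have RI: "t' \<in> I" "\<gamma> t' \<in> fst c" "at t' within I = at t'" "\<Gamma> (0, t') = \<gamma> t'" if t': "t' \<in> R" for t'
  proof -
    have tt: "t' \<in> {a..b}" using that R by auto
    show "t' \<in> I" using tt ab by blast
    show "\<Gamma> (0, t') = \<gamma> t'" by (rule variation_0[OF tt])
    then show "\<gamma> t' \<in> fst c" using t' by (auto simp: R_def Q_def)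
    show "at t' within I = at t'"
    proof (rule at_within_interior)
      have "{a<..<b} \<subseteq> I" using ab by auto
      then show "t' \<in> interior I" using t' R(3) by (meson interiorI open_greaterThanLessThan subsetD)
    qed
  qed
  have vel: "snd (velocity A I \<gamma> t') c = vpart (0, 1) c (0, t')" if t': "t' \<in> R" for t'
  proof -
    have tQ: "(0, t') \<in> Q" using t' by (simp add: R_def)
    have "((\<lambda>r. ?G (0, r)) has_vector_derivative dd ?G (0, t') (0, 1)) (at t')"
      by (rule has_vector_derivative_section_snd[OF smooth_on_open_has_derivative[OF G Q tQ]]) simp
    moreover have "((snd c \<circ> \<gamma>) has_vector_derivative snd (velocity A I \<gamma> t') c) (at t')"
      using velocity_derivative[OF I sm c RI(1,2)[OF t']] unfolding RI(3)[OF t'] .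
    then have "((\<lambda>r. ?G (0, r)) has_vector_derivative snd (velocity A I \<gamma> t') c) (at t')"
      by (rule has_vector_derivative_transform_within_open[OF _ R(1) t']) (simp add: RI(4))
    ultimately have "dd ?G (0, t') (0, 1) = snd (velocity A I \<gamma> t') c" by (rule vector_derivative_unique_at)
    then show ?thesis using vp[OF tQ] by simp
  qed
  have acc: "acceleration A I \<gamma> c t = dd (\<lambda>z. dd ?G z (0, 1)) (0, t) (0, 1)"
  proof -
    have "((\<lambda>r. dd ?G (0, r) (0, 1)) has_vector_derivative dd (\<lambda>z. dd ?G z (0, 1)) (0, t) (0, 1)) (at t)"
      by (rule has_vector_derivative_section_snd[OF
        smooth_on_open_has_derivative[OF smooth_on_open_frechet[OF G Q] Q z]]) simp
    moreover have "((\<lambda>t. snd (velocity A I \<gamma> t) c) has_vector_derivative acceleration A I \<gamma> c t) (at t)"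
      using acceleration_derivative[OF I sm c RI(1,2)[OF R(2)]] unfolding RI(3)[OF R(2)] .
    then have "((\<lambda>r. dd ?G (0, r) (0, 1)) has_vector_derivative acceleration A I \<gamma> c t) (at t)"
      by (rule has_vector_derivative_transform_within_open[OF _ R(1,2)]) (simp add: vel vp R_def)
    ultimately show ?thesis using vector_derivative_unique_at by blast
  qed
  have "curve_euler_lagrange \<phi> I \<gamma> c t (vpart (1, 0) c (0, t)) =
      euler_lagrange (lag c) (\<phi> \<circ> cinv c) (?G (0, t)) (dd ?G (0, t) (0, 1))
        (dd (\<lambda>z. dd ?G z (0, 1)) (0, t) (0, 1)) (dd ?G (0, t) (1, 0))"
    using vel[OF R(2)] RI(4)[OF R(2)] by (simp add: curve_euler_lagrange_def acc vp[OF z])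
  note EL = this
  have "((\<lambda>t. 1/2 * dd (lag c) (?G (0, t), dd ?G (0, t) (0, 1)) (0, dd ?G (0, t) (1, 0)))
     has_vector_derivative frechet_derivative \<Phi> (at (0, t) within S) (1, 0) +
       curve_euler_lagrange \<phi> I \<gamma> c t (vpart (1, 0) c (0, t))) (at t)"
    unfolding EL using md unfolding \<Psi>_def[symmetric] dPsi .
  then show ?thesis
  proof (rule has_vector_derivative_transform_within_open[OF _ R(1,2)])
    fix t' assume t': "t' \<in> R"
    then have tQ: "(0, t') \<in> Q" and "t' \<in> {a..b}" using R(3) by (auto simp: R_def)
    then show "1/2 * dd (lag c) (?G (0, t'), dd ?G (0, t') (0, 1)) (0, dd ?G (0, t') (1, 0)) = momentum t'"
      using momentum_variation[OF c \<open>t' \<in> {a..b}\<close>] RI(2,4)[OF t'] by (simp add: vp[OF tQ])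
  qed
qed

text \<open>The momentum vanishes at both ends, so the integrals of the s-derivative of \<Phi> and
  of \<open>e\<close> add up to 0; hence the minus sign. The chart used for \<open>e t\<close> may
  change with \<open>t\<close>: the momentum has no chart in it, so the derivative formula at each
  time can be read in any chart around the point.\<close>

lemma first_variation_aux:
  assumes e: "\<And>t. t \<in> {a<..<b} \<Longrightarrow> \<exists>c\<in>A. \<gamma> t \<in> fst c \<and>
      e t = curve_euler_lagrange \<phi> I \<gamma> c t (frechet_derivative (snd c \<circ> \<Gamma>) (at (0, t) within S) (1, 0))"
  shows "\<exists>D. ((\<lambda>s. action A K a b (\<lambda>t. \<Gamma> (s, t))) has_real_derivative D) (at 0) \<and>
    (e has_integral - D) {a..b}"
proof -
  let ?d = "\<lambda>t. frechet_derivative \<Phi> (at (0, t) within S) (1, 0)"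
  have "((\<lambda>t. ?d t + e t) has_integral momentum b - momentum a) {a..b}"
  proof (rule fundamental_theorem_of_calculus_interior[OF _ momentum_continuous])
    fix t assume t: "t \<in> {a<..<b}"
    then obtain c where "c \<in> A" "\<gamma> t \<in> fst c" "e t = curve_euler_lagrange \<phi> I \<gamma> c t (vpart (1, 0) c (0, t))"
      using e unfolding vpart_def by blast
    then show "(momentum has_vector_derivative ?d t + e t) (at t)"
      using momentum_variation_derivative[OF _ t] by simp
  qed (use ab in simp)
  then have "((\<lambda>t. ?d t + e t - ?d t) has_integral (momentum b - momentum a) - integral {a..b} ?d) {a..b}"
    by (rule has_integral_diff[OF _ integrable_integral[OF action_derivative(2)]])
  then have "(e has_integral - integral {a..b} ?d) {a..b}"
    by (simp add: momentum_ends)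
  then show ?thesis using action_derivative(1) by blast
qed

end

lemma first_variation:
  assumes "smooth_fun A (points A) \<phi>" "admissible_curve A U I \<gamma>" "a < b" "{a..b} \<subseteq> I"
    "fixed_endpoint_variation A U a b \<gamma> \<epsilon> \<Gamma>"
    and "\<And>t. t \<in> {a<..<b} \<Longrightarrow> \<exists>c\<in>A. \<gamma> t \<in> fst c \<and>
      e t = curve_euler_lagrange \<phi> I \<gamma> c t
        (frechet_derivative (snd c \<circ> \<Gamma>) (at (0, t) within {-\<epsilon><..<\<epsilon>} \<times> {a..b}) (1, 0))"
  shows "\<exists>D. ((\<lambda>s. action A (\<lambda>v. 1/2 * L v - \<phi> (fst v)) a b (\<lambda>t. \<Gamma> (s, t))) has_real_derivative D) (at 0) \<and>
    (e has_integral - D) {a..b}"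
  by (rule first_variation_aux[OF assms(1-5) refl refl refl assms(6)])

end

section \<open>Geodesics\<close>

context smooth_atlas
begin

lemma velocity_tangent:
  assumes I: "thick I" and \<gamma>: "smooth_into A I \<gamma>" and t: "t \<in> I"
  shows "velocity A I \<gamma> t \<in> tangent_space A (\<gamma> t)"
proof -
  have "vector_derivative (snd c \<circ> \<gamma>) (at t within I) = frechet_derivative (snd c \<circ> \<gamma>) (at t within I) 1"
    if "c \<in> A" "\<gamma> t \<in> fst c" for c
  proof -
    have tQ: "t \<in> I \<inter> \<gamma> -` fst c" using t that by simp
    show ?thesis
      using smooth_on_real_derivative(2)[OF I curve_domain(1)[OF I \<gamma> that(1)] curve_smooth[OF I \<gamma> that(1)] tQ]
      unfolding at_within_openin[OF curve_domain(1)[OF I \<gamma> that(1)] tQ] .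
  qed
  then have "velocity A I \<gamma> t = (\<gamma> t, \<lambda>c. if c \<in> A \<and> \<gamma> t \<in> fst c
      then frechet_derivative (snd c \<circ> \<gamma>) (at t within I) 1 else 0)"
    by (auto simp: velocity_def fun_eq_iff)
  then show ?thesis using curve_velocity_tangent[OF \<gamma> I t, of 1] by simp
qed

end

context finsler
begin

lemma chart_cone_imp_domain:
  assumes "v \<in> tangent_space A p" "c \<in> A" "p \<in> fst c" "(snd c p, snd v c) \<in> chart_cone c"
  shows "v \<in> U"
  using assms(4) tangent_eq_coord_field[OF assms(1-3)] cinv_chart[OF assms(2,3)] by (simp add: chart_cone_def)

text \<open>By Euler's relation the derivative of \<open>1/2 * L\<close> along \<open>v\<close> is
  \<open>L v\<close>, while the potential is constant on fibres and only changes sign when the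
  Lagrangian is subtracted.\<close>

lemma energy_eq:
  assumes v: "v \<in> U"
  shows "energy (\<lambda>v. 1/2 * L v - \<phi> (fst v)) v = 1/2 * L v + \<phi> (fst v)"
proof -
  obtain c where c: "c \<in> A" "fst v \<in> fst c" using domain_points[OF v] by blast
  interpret quadratic_lagrangian "chart_cone c" "lag c" by (rule quadratic_lagrangian_lag[OF c(1)])
  note t = domain_tangent[OF v] and z = chart_cone_vector[OF v c]
  have "((\<lambda>s. L (v +\<^sub>T s *\<^sub>T v)) has_real_derivative 2 * L v) (at 0)"
    using momentum_chart[OF t c z t] momentum_self[OF z] lag_vector[OF t c] by simp
  then have "((\<lambda>s. 1/2 * L (v +\<^sub>T s *\<^sub>T v) - \<phi> (fst v)) has_real_derivative 1/2 * (2 * L v) - 0) (at 0)"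
    by (intro DERIV_diff DERIV_cmult DERIV_const)
  then have "deriv (\<lambda>s. 1/2 * L (v +\<^sub>T s *\<^sub>T v) - \<phi> (fst v)) 0 = L v"
    using DERIV_imp_deriv by fastforce
  then show ?thesis by (simp add: energy_def)
qed

text \<open>Takes the scalar weight \<open>(t - a) * (b - t)\<close> of a coordinate variation out
  of the covector.\<close>

lemma curve_euler_lagrange_scale:
  assumes \<phi>: "smooth_fun A (points A) \<phi>" and adm: "admissible_curve A U I \<gamma>"
    and c: "c \<in> A" and t: "t \<in> I" "\<gamma> t \<in> fst c"
  shows "curve_euler_lagrange \<phi> I \<gamma> c t (r *\<^sub>R w) = r * curve_euler_lagrange \<phi> I \<gamma> c t w"
proof -
  have vU: "velocity A I \<gamma> t \<in> U" and f: "fst (velocity A I \<gamma> t) = \<gamma> t"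
    using adm t by (auto simp: admissible_curve_def velocity_def)
  have z: "(snd c (\<gamma> t), snd (velocity A I \<gamma> t) c) \<in> chart_cone c"
    using chart_cone_vector[OF vU c] t f by simp
  have x: "snd c (\<gamma> t) \<in> snd c ` fst c" using t by simp
  have "dd (\<lambda>x. dd (lag c) x (0, r *\<^sub>R w)) (snd c (\<gamma> t), snd (velocity A I \<gamma> t) c) h =
      r * dd (\<lambda>x. dd (lag c) x (0, w)) (snd c (\<gamma> t), snd (velocity A I \<gamma> t) c) h" for h
    using linear_scale[OF dd_dd_linear[OF lag_smooth[OF c] chart_cone_open[OF c] z, where h = h], of r "(0, w)"]
    by simp
  then show ?thesis
    using linear_scale[OF smooth_on_open_linear[OF lag_smooth[OF c] chart_cone_open[OF c] z], of r "(w, 0)"]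
      linear_scale[OF smooth_on_open_linear[OF potential_smooth[OF \<phi> c] chart_image_open[OF c] x], of r w]
    by (simp add: curve_euler_lagrange_def euler_lagrange_def algebra_simps)
qed

text \<open>Within one chart and a short interval, adding \<open>s (t - a) (b - t) w\<close> to the coordinates
  is a variation with fixed endpoints; no bump function is needed.\<close>

lemma coordinate_variation:
  assumes adm: "admissible_curve A U I \<gamma>" and ab: "a < b" "{a..b} \<subseteq> I"
    and c: "c \<in> A" and \<gamma>c: "\<gamma> ` {a..b} \<subseteq> fst c"
  obtains \<epsilon> \<Gamma> where "fixed_endpoint_variation A U a b \<gamma> \<epsilon> \<Gamma>"
    and "\<And>t. t \<in> {a..b} \<Longrightarrow>
      frechet_derivative (snd c \<circ> \<Gamma>) (at (0, t) within {-\<epsilon><..<\<epsilon>} \<times> {a..b}) (1, 0) = ((t - a) * (b - t)) *\<^sub>R w"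
proof -
  have I: "thick I" and sm: "smooth_into A I \<gamma>" and vU: "\<And>t. t \<in> I \<Longrightarrow> velocity A I \<gamma> t \<in> U"
    using adm thick_interval by (auto simp: admissible_curve_def)
  define x where "x = snd c \<circ> \<gamma>"
  define y where "y = (\<lambda>t. snd (velocity A I \<gamma> t) c)"
  define \<beta> where "\<beta> = (\<lambda>t. (t - a) * (b - t))"
  define \<beta>' where "\<beta>' = (\<lambda>t. a + b - 2 * t)"
  have tI: "t \<in> I" "\<gamma> t \<in> fst c" if "t \<in> {a..b}" for t using that ab \<gamma>c by auto
  note thab = thick_Icc[OF ab(1)]
  have sub: "{a..b} \<subseteq> I \<inter> \<gamma> -` fst c" using tI by auto
  have xs: "smooth_on {a..b} x"
    unfolding x_def by (rule smooth_on_subset[OF curve_smooth[OF I sm c] thab sub])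
  have ys: "smooth_on {a..b} y"
    unfolding y_def by (rule smooth_on_subset[OF velocity_smooth[OF I sm c] thab sub])
  have dx: "(x has_vector_derivative y t) (at t within {a..b})" if "t \<in> {a..b}" for t
    using velocity_derivative[OF I sm c tI[OF that]] has_vector_derivative_within_subset ab(2)
    unfolding x_def y_def by blast
  have xy: "(x t, y t) \<in> chart_cone c" if "t \<in> {a..b}" for t
    using chart_cone_vector[OF vU c, of t] tI[OF that] by (simp add: x_def y_def velocity_def)
  \<comment> \<open>The lifted curve \<open>(x, y)\<close> over \<open>{a..b}\<close> is compact, so
    a tube of uniform radius r around it lies in the cone. The variation moves position and velocity
    by s times \<open>(\<beta> t *\<^sub>R w, \<beta>' t *\<^sub>R w)\<close>, whose norm is at most
    M; with \<epsilon> = r / M every varied curve stays admissible.\<close>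
  obtain r where r: "r > 0" "(\<Union>z\<in>(\<lambda>t. (x t, y t)) ` {a..b}. ball z r) \<subseteq> chart_cone c"
  proof (rule compact_subset_open_imp_ball_epsilon_subset)
    show "compact ((\<lambda>t. (x t, y t)) ` {a..b})"
      by (intro compact_continuous_image continuous_on_Pair smooth_on_continuous xs ys compact_Icc)
  qed (use xy chart_cone_open[OF c] in auto)
  have "bounded ((\<lambda>t. (\<beta> t *\<^sub>R w, \<beta>' t *\<^sub>R w)) ` {a..b})"
    unfolding \<beta>_def \<beta>'_def by (intro compact_imp_bounded compact_continuous_image continuous_intros compact_Icc)
  then obtain M where M: "M > 0" "\<And>t. t \<in> {a..b} \<Longrightarrow> norm (\<beta> t *\<^sub>R w, \<beta>' t *\<^sub>R w) \<le> M"
    unfolding bounded_pos by auto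
  define \<epsilon> where "\<epsilon> = r / M"
  have eps: "\<epsilon> > 0" using r M by (simp add: \<epsilon>_def)
  have chart_cone: "(x t + (s * \<beta> t) *\<^sub>R w, y t + (s * \<beta>' t) *\<^sub>R w) \<in> chart_cone c"
    if s: "s \<in> {-\<epsilon><..<\<epsilon>}" and t: "t \<in> {a..b}" for s t
  proof -
    let ?h = "(\<beta> t *\<^sub>R w, \<beta>' t *\<^sub>R w)"
    have eq: "(x t + (s * \<beta> t) *\<^sub>R w, y t + (s * \<beta>' t) *\<^sub>R w) = (x t, y t) + s *\<^sub>R ?h" by simp
    have "norm (s *\<^sub>R ?h) \<le> \<bar>s\<bar> * M" using mult_left_mono[OF M(2)[OF t] abs_ge_zero] by (simp only: norm_scaleR)
    also have "\<dots> < \<epsilon> * M" using s M by (intro mult_strict_right_mono) auto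
    also have "\<dots> = r" using M by (simp add: \<epsilon>_def)
    finally have "dist ((x t, y t) + s *\<^sub>R ?h) (x t, y t) < r"
      by (simp only: dist_norm add_diff_cancel_left')
    then have "(x t, y t) + s *\<^sub>R ?h \<in> ball (x t, y t) r" by (simp only: mem_ball dist_commute)
    then show ?thesis unfolding eq using r(2) t by blast
  qed
  let ?S = "{-\<epsilon><..<\<epsilon>} \<times> {a..b}"
  define f where "f = (\<lambda>z. x (snd z) + (fst z * \<beta> (snd z)) *\<^sub>R w)"
  define \<Gamma> where "\<Gamma> = (\<lambda>z. cinv c (f z))"
  have thS: "thick ?S" by (rule thick_Times[OF thick_open thab]) simp
  have fimg: "f z \<in> snd c ` fst c" if "z \<in> ?S" for z
    using chart_cone[of "fst z" "snd z"] that by (auto simp: f_def chart_cone_def)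
  have fs: "smooth_on ?S f"
  proof -
    have 1: "smooth_on ?S (\<lambda>z. x (snd z))"
      by (rule smooth_on_affine_comp[OF has_derivative_snd[OF has_derivative_ident] thS _ xs]) auto
    have lin: "smooth_on ?S fst" "smooth_on ?S snd"
      by (rule smooth_on_linear[OF bounded_linear_fst thS] smooth_on_linear[OF bounded_linear_snd thS])+
    have "smooth_on ?S (\<lambda>z. fst z * ((snd z + - a) * (b + (-1) * snd z)))"
      by (intro smooth_on_bilinear[OF bounded_bilinear_mult thS] smooth_on_add[OF thS] lin
        smooth_on_const[OF thS])
    then have "smooth_on ?S (\<lambda>z. (fst z * \<beta> (snd z)) *\<^sub>R w)"
      by (intro smooth_on_bounded_linear[OF bounded_linear_scaleR_left thS]) (simp add: \<beta>_def)
    then show ?thesis unfolding f_def by (rule smooth_on_add[OF thS 1])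
  qed
  have fst_s: "smooth_on {a..b} (\<lambda>t. f (s, t))" if "s \<in> {-\<epsilon><..<\<epsilon>}" for s
    by (rule smooth_on_affine_comp[OF has_derivative_Pair[OF has_derivative_const has_derivative_ident] thab _ fs])
      (use that in auto)
  \<comment> \<open>The condition covers both s = 0 and the two end times, where \<beta> is
    0.\<close>
  have zero: "\<Gamma> (s, t) = \<gamma> t" if "s * \<beta> t = 0" "t \<in> {a..b}" for s t
    using that(1) cinv_chart[OF c tI(2)[OF that(2)]] by (simp only: \<Gamma>_def f_def x_def fst_conv snd_conv) simp
  have "fixed_endpoint_variation A U a b \<gamma> \<epsilon> \<Gamma>"
    unfolding fixed_endpoint_variation_def
  proof (intro conjI ballI)
    show "smooth_into A ?S \<Gamma>"
      unfolding \<Gamma>_def by (rule smooth_into_chart[OF c thS fs]) (use fimg in blast)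
    fix s assume s: "s \<in> {-\<epsilon><..<\<epsilon>}"
    have slice: "smooth_into A {a..b} (\<lambda>t. \<Gamma> (s, t))"
      unfolding \<Gamma>_def by (rule smooth_into_chart[OF c thab fst_s[OF s]]) (use fimg s in auto)
    show "admissible_curve A U {a..b} (\<lambda>t. \<Gamma> (s, t))"
      unfolding admissible_curve_def
    proof (intro conjI ballI slice)
      fix t assume t: "t \<in> {a..b}"
      have img: "f (s, t) \<in> snd c ` fst c" using fimg s t by simp
      have G: "\<Gamma> (s, t) \<in> fst c" "snd c (\<Gamma> (s, t)) = f (s, t)"
        using cinv_in[OF img] chart_cinv[OF img] by (auto simp: \<Gamma>_def)
      have "(\<beta> has_vector_derivative \<beta>' t) (at t within {a..b})"
        unfolding \<beta>_def \<beta>'_def has_real_derivative_iff_has_vector_derivative[symmetric]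
        by (auto intro!: derivative_eq_intros)
      then have "((\<lambda>t. f (s, t)) has_vector_derivative y t + (s * \<beta>' t) *\<^sub>R w) (at t within {a..b})"
        unfolding f_def fst_conv snd_conv
        by (intro has_vector_derivative_add dx t
          bounded_linear.has_vector_derivative[OF bounded_linear_scaleR_left] has_vector_derivative_mult_right)
      then have "((snd c \<circ> (\<lambda>t. \<Gamma> (s, t))) has_vector_derivative y t + (s * \<beta>' t) *\<^sub>R w) (at t within {a..b})"
        by (rule has_vector_derivative_transform[OF t, rotated])
          (use chart_cinv[OF fimg] s in \<open>auto simp: \<Gamma>_def\<close>)
      then have "snd (velocity A {a..b} (\<lambda>t. \<Gamma> (s, t)) t) c = y t + (s * \<beta>' t) *\<^sub>R w"
        using vector_derivative_within[OF thick_not_bot[OF thab t]] c G by (simp add: velocity_def)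
      then show "velocity A {a..b} (\<lambda>t. \<Gamma> (s, t)) t \<in> U"
        using chart_cone_imp_domain[OF velocity_tangent[OF thab slice t] c G(1)] chart_cone[OF s t] G(2)
        by (simp add: f_def)
    qed (use ab in auto)
  qed (use eps zero ab in \<open>auto simp: \<beta>_def\<close>)
  moreover have "frechet_derivative (snd c \<circ> \<Gamma>) (at (0, t) within ?S) (1, 0) = ((t - a) * (b - t)) *\<^sub>R w"
    if t: "t \<in> {a..b}" for t
  proof -
    have z: "(0, t) \<in> ?S" using t eps by simp
    have J: "0 \<in> {-\<epsilon><..<\<epsilon>}" using eps by simp
    have "frechet_derivative (snd c \<circ> \<Gamma>) (at (0, t) within ?S) = frechet_derivative f (at (0, t) within ?S)"
      by (rule frechet_derivative_cong[OF z]) (use chart_cinv[OF fimg] in \<open>auto simp: \<Gamma>_def\<close>)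
    moreover have "((\<lambda>s. f (s, t)) has_vector_derivative frechet_derivative f (at (0, t) within ?S) (1, 0))
        (at 0 within {-\<epsilon><..<\<epsilon>})"
      by (rule has_vector_derivative_section_fst[OF smooth_on_has_derivative[OF fs z]]) (use t in auto)
    moreover have "((\<lambda>s. f (s, t)) has_vector_derivative \<beta> t *\<^sub>R w) (at 0 within {-\<epsilon><..<\<epsilon>})"
      unfolding f_def fst_conv snd_conv by (auto intro!: derivative_eq_intros)
    moreover have "at 0 within {-\<epsilon><..<\<epsilon>} \<noteq> bot"
      by (rule thick_not_bot[OF thick_open J]) simp
    ultimately show ?thesis
      using vector_derivative_unique_within unfolding \<beta>_def by metis
  qed
  ultimately show ?thesis by (rule that)
qed

text \<open>The fundamental lemma of the calculus of variations, localised in a chart: where the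
  covector is nonzero on some \<open>w\<close>, it keeps its sign on a short interval, and a
  variation along \<open>w\<close> with positive weight has a nonzero first variation.\<close>

lemma geodesic_iff:
  assumes \<phi>: "smooth_fun A (points A) \<phi>"
  shows "lagrangian_geodesic A U (\<lambda>v. 1/2 * L v - \<phi> (fst v)) I \<gamma> \<longleftrightarrow> admissible_curve A U I \<gamma> \<and>
    (\<forall>t\<in>I. \<forall>c\<in>A. \<gamma> t \<in> fst c \<longrightarrow> (\<forall>w. curve_euler_lagrange \<phi> I \<gamma> c t w = 0))"
    (is "lagrangian_geodesic A U ?K I \<gamma> \<longleftrightarrow> _ \<and> ?EL")
proof (cases "admissible_curve A U I \<gamma>")
  case adm: True
  have I: "thick I" and sm: "smooth_into A I \<gamma>" and int: "is_interval I"
    using adm thick_interval by (auto simp: admissible_curve_def)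
  have "((\<lambda>s. action A ?K a b (\<lambda>t. \<Gamma> (s, t))) has_real_derivative 0) (at 0)"
    if EL: ?EL and ab: "a < b" "{a..b} \<subseteq> I" and var: "fixed_endpoint_variation A U a b \<gamma> \<epsilon> \<Gamma>" for a b \<epsilon> \<Gamma>
  proof -
    have cov: "\<exists>c\<in>A. \<gamma> t \<in> fst c" if "t \<in> {a<..<b}" for t
    proof -
      have "t \<in> I" using that ab by auto
      then have "\<gamma> t \<in> points A" using sm unfolding smooth_into_def by blast
      then show ?thesis by (simp add: points_def)
    qed
    \<comment> \<open>The covector vanishes in every chart, so any chart around the point serves and
      the integrand \<open>e\<close> can be taken as 0.\<close>
    have "\<exists>c\<in>A. \<gamma> t \<in> fst c \<and> 0 = curve_euler_lagrange \<phi> I \<gamma> c t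
        (frechet_derivative (snd c \<circ> \<Gamma>) (at (0, t) within {-\<epsilon><..<\<epsilon>} \<times> {a..b}) (1, 0))"
      if t: "t \<in> {a<..<b}" for t
    proof -
      have "t \<in> I" using t ab by auto
      then show ?thesis using cov[OF t] EL by metis
    qed
    from first_variation[OF \<phi> adm ab var this] obtain D where
      D: "((\<lambda>s. action A ?K a b (\<lambda>t. \<Gamma> (s, t))) has_real_derivative D) (at 0)"
        "((\<lambda>t. 0::real) has_integral - D) {a..b}" by blast
    have "D = 0" using has_integral_unique[OF D(2) has_integral_0] by simp
    then show ?thesis using D(1) by simp
  qed
  moreover have ?EL if geo: "lagrangian_geodesic A U ?K I \<gamma>"
  proof (intro ballI impI allI)
    fix t0 c w assume t0: "t0 \<in> I" and c: "c \<in> A" and \<gamma>0: "\<gamma> t0 \<in> fst c"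
    let ?E = "\<lambda>t. curve_euler_lagrange \<phi> I \<gamma> c t w"
    let ?Q = "I \<inter> \<gamma> -` fst c"
    show "?E t0 = 0"
    proof (rule ccontr)
      assume nz: "?E t0 \<noteq> 0"
      have cont: "continuous_on ?Q ?E" by (rule euler_lagrange_continuous[OF \<phi> adm c])
      \<comment> \<open>Multiplying by the value at \<open>t0\<close> makes the covector positive
        near \<open>t0\<close>, whatever its sign.\<close>
      have "openin (top_of_set ?Q) (?Q \<inter> (\<lambda>t. ?E t0 * ?E t) -` {0<..})"
        by (rule continuous_openin_preimage_gen) (auto intro!: continuous_intros cont)
      then have "openin (top_of_set I) (?Q \<inter> (\<lambda>t. ?E t0 * ?E t) -` {0<..})"
        using curve_domain(1)[OF I sm c] openin_trans by blast
      moreover have "t0 \<in> ?Q \<inter> (\<lambda>t. ?E t0 * ?E t) -` {0<..}"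
        using t0 \<gamma>0 nz by (auto simp: zero_less_mult_iff linorder_neq_iff)
      ultimately obtain \<delta> where \<delta>: "\<delta> > 0"
        "\<And>t. t \<in> I \<Longrightarrow> dist t t0 < \<delta> \<Longrightarrow> t \<in> ?Q \<inter> (\<lambda>t. ?E t0 * ?E t) -` {0<..}"
        unfolding openin_euclidean_subtopology_iff by blast
      \<comment> \<open>\<open>t0\<close> may be an endpoint of \<open>I\<close>, where only one
        sign of d is possible; \<open>{a..b}\<close> is the interval between \<open>t0\<close> and
        \<open>t0 + d\<close> on either side.\<close>
      obtain d where d: "0 < \<bar>d\<bar>" "\<bar>d\<bar> < \<delta>" "t0 + d *\<^sub>R 1 \<in> I"
        using I t0 \<delta>(1) unfolding thick_def by (metis Basis_real_def singletonI)
      define a where "a = min t0 (t0 + d)"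
      define b where "b = max t0 (t0 + d)"
      have ab: "a < b" using d by (auto simp: a_def b_def)
      have "a \<in> I" "b \<in> I" using d t0 by (auto simp: a_def b_def min_def max_def)
      then have abI: "{a..b} \<subseteq> I" using int unfolding is_interval_1 subset_iff atLeastAtMost_iff by blast
      have near: "t \<in> I" "\<gamma> t \<in> fst c" "?E t0 * ?E t > 0" if "t \<in> {a..b}" for t
      proof -
        have "dist t t0 < \<delta>" using that d by (auto simp: a_def b_def dist_real_def)
        then show "t \<in> I" "\<gamma> t \<in> fst c" "?E t0 * ?E t > 0" using \<delta>(2) abI that by auto
      qed
      obtain \<epsilon> \<Gamma> where var: "fixed_endpoint_variation A U a b \<gamma> \<epsilon> \<Gamma>"
        and xi: "\<And>t. t \<in> {a..b} \<Longrightarrow> frechet_derivative (snd c \<circ> \<Gamma>)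
          (at (0, t) within {-\<epsilon><..<\<epsilon>} \<times> {a..b}) (1, 0) = ((t - a) * (b - t)) *\<^sub>R w"
        using coordinate_variation[OF adm ab abI c, of w] near(2) by blast
      define e where "e = (\<lambda>t. ((t - a) * (b - t)) * ?E t)"
      have "\<exists>c\<in>A. \<gamma> t \<in> fst c \<and> e t = curve_euler_lagrange \<phi> I \<gamma> c t
          (frechet_derivative (snd c \<circ> \<Gamma>) (at (0, t) within {-\<epsilon><..<\<epsilon>} \<times> {a..b}) (1, 0))"
        if t: "t \<in> {a<..<b}" for t
      proof -
        have t': "t \<in> {a..b}" using t by simp
        show ?thesis
          using c near[OF t'] curve_euler_lagrange_scale[OF \<phi> adm c near(1,2)[OF t']]
          by (intro bexI[of _ c]) (auto simp: xi[OF t'] e_def)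
      qed
      from first_variation[OF \<phi> adm ab abI var this] obtain D where
        D: "((\<lambda>s. action A ?K a b (\<lambda>t. \<Gamma> (s, t))) has_real_derivative D) (at 0)"
          "(e has_integral - D) {a..b}" by blast
      have "((\<lambda>s. action A ?K a b (\<lambda>t. \<Gamma> (s, t))) has_real_derivative 0) (at 0)"
        using geo ab abI var unfolding lagrangian_geodesic_def by blast
      then have "D = 0" using DERIV_unique D(1) by blast
      then have "((\<lambda>t. ?E t0 * e t) has_integral ?E t0 * 0) {a..b}"
        using has_integral_mult_right[OF D(2), of "?E t0"] by simp
      then have i0: "((\<lambda>t. ?E t0 * e t) has_integral 0) (cbox a b)" by simp
      have eq: "?E t0 * e t = ((t - a) * (b - t)) * (?E t0 * ?E t)" for t by (simp add: e_def)
      define m where "m = (a + b) / 2"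
      have m: "m \<in> {a<..<b}" using ab by (simp add: m_def field_simps)
      have "{a..b} \<subseteq> ?Q" using near by auto
      then have "continuous_on {a..b} ?E" by (rule continuous_on_subset[OF cont])
      then have ce: "continuous_on (cbox a b) (\<lambda>t. ?E t0 * e t)"
        unfolding e_def by (auto intro!: continuous_intros)
      \<comment> \<open>A continuous nonnegative function with integral 0 vanishes. At the midpoint
        \<open>m\<close> the weight \<open>(m - a) * (b - m)\<close> is positive, which gives the
        contradiction.\<close>
      have "?E t0 * e m = 0"
      proof (rule has_integral_0_cbox_imp_0[OF ce _ i0])
        show "0 \<le> ?E t0 * e t" if "t \<in> box a b" for t
        proof -
          have t: "t \<in> {a..b}" using that by simp
          then have "0 \<le> (t - a) * (b - t)" by simp
          then show ?thesis unfolding eq by (rule mult_nonneg_nonneg[OF _ less_imp_le[OF near(3)[OF t]]])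
        qed
      qed (use ab m in auto)
      moreover have "?E t0 * e m > 0"
        unfolding eq by (rule mult_pos_pos) (use m near(3)[of m] in simp_all)
      ultimately show False by linarith
    qed
  qed
  ultimately show ?thesis using adm unfolding lagrangian_geodesic_def by blast
qed (simp add: lagrangian_geodesic_def)

end

theorem lemma4p2:
  fixes T :: "'a topology"
    and A :: "('a, 'e::euclidean_space) chart set"
    and U :: "('a, 'e) tangent set"
    and L :: "('a, 'e) tangent \<Rightarrow> real"
    and nab :: "('a, 'e) connection"
    and F :: "('a, 'e) tangent \<Rightarrow> ('a, 'e) tangent"
    and \<phi> :: "'a \<Rightarrow> real"
  assumes "smooth_manifold T A"
    and "mechanical_system A U L F"
    and "chern_connection A U L nab"
    and "conservative A U L F \<phi>"
  shows "(\<forall>I \<gamma>. motion A U nab F I \<gamma> \<longleftrightarrow>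
            lagrangian_geodesic A U (\<lambda>v. 1/2 * L v - \<phi> (fst v)) I \<gamma>) \<and>
         (\<forall>v\<in>U. energy (\<lambda>v. 1/2 * L v - \<phi> (fst v)) v = 1/2 * L v + \<phi> (fst v))"
proof -
  interpret chern T A U L nab
    using assms by unfold_locales (auto simp: mechanical_system_def)
  have \<phi>: "smooth_fun A (points A) \<phi>"
    and F: "\<And>v. v \<in> U \<Longrightarrow> F v = (-1) *\<^sub>T anisotropic_gradient A L \<phi> v"
    using assms(4) by (auto simp: conservative_def)
  show ?thesis
    using motion_iff[OF \<phi> F] geodesic_iff[OF \<phi>] energy_eq by simp
qed

end
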